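(* Let $d\ge 1$, $T>0$, and let $Z_t=(X_t,Y_t)\in\mathbb{R}^{2d}$ be the solution, started from $z=(x,y)\in\mathbb{R}^{2d}$, of $$dX_t=Y_t\,dt,\qquad dY_t=\sigma\,dW_t-\bigl(c(X_t,Y_t)Y_t+\nabla V(X_t)\bigr)dt,$$ where $W$ is a standard $d$-dimensional Brownian motion, $\sigma$ is a constant $d\times d$ matrix, and $\sigma,V,c$ satisfy $\mathcal H_0,\mathcal H_1,\mathcal H_2$ (stated in the context). Let $h_n>0$ with $h_n\to0$. Then, starting from any initial point $z=(x,y)\in\mathbb{R}^{2d}$, stably in law as $n\to\infty$, $$\sqrt{\frac{T}{2h_n}}\left(\sigma^{-1}\hat\sigma_n^2\sigma^{-1}-\mathrm{Id}\right)\longrightarrow\mathcal N_{(d,d)},$$ where $\mathcal N_{(d,d)}$ is a symmetric $d\times d$ random matrix whose entries are centered Gaussian random variables with $\operatorname{Var}(\mathcal N_{i,j})=1+\delta_{i,j}$, all the entries $(i,j)$ with $i\ge j$ being independent.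
   Context: Assumptions. $\mathcal H_0$ (for constant $\sigma$): $\sigma$ is a symmetric matrix with $\sigma\ge\sigma_0\,\mathrm{Id}$ in the sense of quadratic forms for some constant $\sigma_0>0$. $\mathcal H_1$: $V:\mathbb{R}^d\to\mathbb{R}$ is lower bounded and continuously differentiable. $\mathcal H_2$: the $d\times d$ matrix $c(x,y)$ is continuously differentiable, for all $N>0$ $\sup_{|x|\le N,\,y\in\mathbb{R}^d}|c(x,y)|<+\infty$, and there exist $c_0,L>0$ with $c^s(x,y)\ge c_0\,\mathrm{Id}$ for all $|x|>L$, $y\in\mathbb{R}^d$, where $c^s$ is the symmetrization of $c$. The equation has a unique non-explosive strong solution, with law $\mathbb P_z$ when started from $z$. Notation. For $p\ge1$, $\Delta_2X(p,n)=X_{(2p+1)h_n}-2X_{2ph_n}+X_{(2p-1)h_n}$; $A\otimes B=AB^*$ for column vectors; $[\cdot]$ is the integer part; and $$\hat\sigma_n^2=\frac1{[T/(2h_n)]-1}\,\frac{3}{2h_n^3}\sum_{p=1}^{[T/(2h_n)]-1}\Delta_2X(p,n)\otimes\Delta_2X(p,n)$$ (defined for $n$ large enough). Stable convergence: random variables $Y_n$ on $(\Omega,\mathbb F,\mathbb P)$ converge stably in law to $Y$, defined on an extension $(\Omega',\mathbb F',\mathbb P')$, if $\mathbb E(g(Y_n)\zeta)\to\mathbb E'(g(Y)\zeta)$ for every bounded continuous $g$ and every bounded $\mathbb F$-measurable $\zeta$. Here $\mathbb P=\mathbb P_z$ and $\mathbb F=\sigma(Z_s,\ 0\le s\le T)$.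 *)

theory Defs
  imports "HOL-Probability.Probability"
begin

section \<open>Coefficients\<close>

definition continuously_differentiable ::
  "('a::real_normed_vector \<Rightarrow> 'b::real_normed_vector) \<Rightarrow> bool" where
  "continuously_differentiable f \<longleftrightarrow>
     (\<exists>f' :: 'a \<Rightarrow> 'a \<Rightarrow>\<^sub>L 'b.
        (\<forall>x. (f has_derivative blinfun_apply (f' x)) (at x)) \<and> continuous_on UNIV f')"

(* Only meaningful where f is differentiable. *)
definition gradient :: "('a::real_inner \<Rightarrow> real) \<Rightarrow> 'a \<Rightarrow> 'a" where
  "gradient f x = (THE D. GDERIV f x :> D)"

(* A \<ge> B in the sense of quadratic forms; no symmetry is imposed on A or B. *)
definition qform_ge :: "real^'d^'d \<Rightarrow> real^'d^'d \<Rightarrow> bool" where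
  "qform_ge A B \<longleftrightarrow> (\<forall>v. v \<bullet> (A *v v) \<ge> v \<bullet> (B *v v))"

definition sym_part :: "real^'d^'d \<Rightarrow> real^'d^'d" where
  "sym_part A = (1/2) *\<^sub>R (A + transpose A)"

definition hyp_H0 :: "real^'d^'d \<Rightarrow> bool" where
  "hyp_H0 \<sigma> \<longleftrightarrow>
     transpose \<sigma> = \<sigma> \<and> (\<exists>\<sigma>\<^sub>0>0. qform_ge \<sigma> (\<sigma>\<^sub>0 *\<^sub>R mat 1))"

definition hyp_H1 :: "(real^'d \<Rightarrow> real) \<Rightarrow> bool" where
  "hyp_H1 V \<longleftrightarrow> bdd_below (range V) \<and> continuously_differentiable V"

definition hyp_H2 :: "(real^'d \<Rightarrow> real^'d \<Rightarrow> real^'d^'d) \<Rightarrow> bool" where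
  "hyp_H2 c \<longleftrightarrow>
     continuously_differentiable (\<lambda>(x, y). c x y) \<and>
     (\<forall>N>0. bdd_above {norm (c x y) | x y. norm x \<le> N}) \<and>
     (\<exists>c\<^sub>0>0. \<exists>L>0. \<forall>x y. norm x > L \<longrightarrow> qform_ge (sym_part (c x y)) (c\<^sub>0 *\<^sub>R mat 1))"

section \<open>Brownian motion and the equation\<close>

text \<open>Processes are indexed by the reals; only their values at times \<open>t \<ge> 0\<close> matter.\<close>

definition sigma_gen_by ::
  "'w measure \<Rightarrow> real set \<Rightarrow> (real \<Rightarrow> 'w \<Rightarrow> 'a::topological_space) \<Rightarrow> 'w measure" where
  "sigma_gen_by M I Z =
     sigma (space M) (\<Union>s\<in>I. {Z s -` B \<inter> space M | B. B \<in> sets borel})"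

definition augmented_filtration ::
  "'w measure \<Rightarrow> (real \<Rightarrow> 'w \<Rightarrow> 'a::topological_space) \<Rightarrow> real \<Rightarrow> 'w measure" where
  "augmented_filtration M W t =
     sigma (space M) (sets (sigma_gen_by M {0..t} W) \<union> null_sets M)"

definition standard_brownian_motion ::
  "'w measure \<Rightarrow> (real \<Rightarrow> 'w \<Rightarrow> real^'d) \<Rightarrow> bool" where
  "standard_brownian_motion M W \<longleftrightarrow>
     prob_space M \<and>
     (\<forall>t\<ge>0. W t \<in> borel_measurable M) \<and>
     (AE \<omega> in M. W 0 \<omega> = 0 \<and> continuous_on {0..} (\<lambda>t. W t \<omega>)) \<and>
     (\<forall>s t. 0 \<le> s \<and> s < t \<longrightarrow>
        (\<forall>i. distributed M lborel (\<lambda>\<omega>. (W t \<omega> - W s \<omega>) $ i)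
               (normal_density 0 (sqrt (t - s)))) \<and>
        prob_space.indep_vars M (\<lambda>_. borel) (\<lambda>i \<omega>. (W t \<omega> - W s \<omega>) $ i) UNIV) \<and>
     (\<forall>(n::nat) t. 0 \<le> t 0 \<and> strict_mono_on {..n} t \<longrightarrow>
        prob_space.indep_vars M (\<lambda>_. borel) (\<lambda>k \<omega>. W (t (Suc k)) \<omega> - W (t k) \<omega>) {..<n})"

(* Since the diffusion matrix is constant, the stochastic integral of \<sigma> against W over
   [0,t] is \<sigma> W_t (recall W_0 = 0), so the integrated equation can be read path by path. *)
definition strong_solution ::
  "'w measure \<Rightarrow> (real \<Rightarrow> 'w \<Rightarrow> real^'d) \<Rightarrow> real^'d^'d \<Rightarrow> (real^'d \<Rightarrow> real^'d \<Rightarrow> real^'d^'d) \<Rightarrow>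
   (real^'d \<Rightarrow> real) \<Rightarrow> (real^'d) \<times> (real^'d) \<Rightarrow>
   (real \<Rightarrow> 'w \<Rightarrow> (real^'d) \<times> (real^'d)) \<Rightarrow> bool" where
  "strong_solution M W \<sigma> c V z Z \<longleftrightarrow>
     (\<forall>t\<ge>0. Z t \<in> borel_measurable (augmented_filtration M W t)) \<and>
     (AE \<omega> in M.
        continuous_on {0..} (\<lambda>t. Z t \<omega>) \<and>
        (\<forall>t\<ge>0.
           fst (Z t \<omega>) = fst z + integral {0..t} (\<lambda>s. snd (Z s \<omega>)) \<and>
           snd (Z t \<omega>) = snd z + \<sigma> *v W t \<omega>
             - integral {0..t} (\<lambda>s. c (fst (Z s \<omega>)) (snd (Z s \<omega>)) *v snd (Z s \<omega>)
                                     + gradient V (fst (Z s \<omega>)))))"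

definition unique_strong_solution ::
  "'w measure \<Rightarrow> (real \<Rightarrow> 'w \<Rightarrow> real^'d) \<Rightarrow> real^'d^'d \<Rightarrow> (real^'d \<Rightarrow> real^'d \<Rightarrow> real^'d^'d) \<Rightarrow>
   (real^'d \<Rightarrow> real) \<Rightarrow> (real^'d) \<times> (real^'d) \<Rightarrow>
   (real \<Rightarrow> 'w \<Rightarrow> (real^'d) \<times> (real^'d)) \<Rightarrow> bool" where
  "unique_strong_solution M W \<sigma> c V z Z \<longleftrightarrow>
     strong_solution M W \<sigma> c V z Z \<and>
     (\<forall>Z'. strong_solution M W \<sigma> c V z Z' \<longrightarrow> (AE \<omega> in M. \<forall>t\<ge>0. Z' t \<omega> = Z t \<omega>))"

section \<open>The estimator\<close>

definition outer_prod :: "real^'d \<Rightarrow> real^'d \<Rightarrow> real^'d^'d" where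
  "outer_prod a b = (\<chi> i j. a $ i * b $ j)"

definition second_diff :: "(real \<Rightarrow> real^'d) \<Rightarrow> real \<Rightarrow> nat \<Rightarrow> real^'d" where
  "second_diff x h p =
     x ((2 * real p + 1) * h) - 2 *\<^sub>R x (2 * real p * h) + x ((2 * real p - 1) * h)"

(* The number of summands is kept as an integer: it is -1 or 0 when T < 4 h, and the
   value is then the zero matrix. *)
definition sigma2_hat :: "real \<Rightarrow> real \<Rightarrow> (real \<Rightarrow> real^'d) \<Rightarrow> real^'d^'d" where
  "sigma2_hat T h x =
     (let m = \<lfloor>T / (2 * h)\<rfloor> - 1 in
      (1 / real_of_int m * (3 / (2 * h ^ 3))) *\<^sub>R
        (\<Sum>p = 1..nat m. outer_prod (second_diff x h p) (second_diff x h p)))"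

section \<open>Stable convergence and the limit law\<close>

(* \<pi> maps the extension onto the base space; a random variable \<zeta> of the base space is
   viewed on the extension as \<zeta> \<circ> \<pi>. *)
definition prob_extension :: "'w measure \<Rightarrow> 'v measure \<Rightarrow> ('v \<Rightarrow> 'w) \<Rightarrow> bool" where
  "prob_extension M M' \<pi> \<longleftrightarrow>
     prob_space M \<and> prob_space M' \<and> \<pi> \<in> measurable M' M \<and> distr M' M \<pi> = M"

definition stably_converges ::
  "'w measure \<Rightarrow> (nat \<Rightarrow> 'w \<Rightarrow> 'a::topological_space) \<Rightarrow>
   'v measure \<Rightarrow> ('v \<Rightarrow> 'w) \<Rightarrow> ('v \<Rightarrow> 'a) \<Rightarrow> bool" where
  "stably_converges M Y M' \<pi> Y' \<longleftrightarrow>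
     prob_extension M M' \<pi> \<and>
     (\<forall>n. Y n \<in> borel_measurable M) \<and> Y' \<in> borel_measurable M' \<and>
     (\<forall>(g :: 'a \<Rightarrow> real) \<zeta>.
        continuous_on UNIV g \<and> bounded (range g) \<and>
        \<zeta> \<in> borel_measurable M \<and> bounded (\<zeta> ` space M) \<longrightarrow>
        (\<lambda>n. \<integral>\<omega>. g (Y n \<omega>) * \<zeta> \<omega> \<partial>M) \<longlonglongrightarrow> (\<integral>\<omega>. g (Y' \<omega>) * \<zeta> (\<pi> \<omega>) \<partial>M'))"

definition sym_gaussian_matrix ::
  "'v measure \<Rightarrow> ('v \<Rightarrow> real^('d::{finite,linorder})^('d::{finite,linorder})) \<Rightarrow> bool" where
  "sym_gaussian_matrix M' N \<longleftrightarrow>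
     (\<forall>\<omega>\<in>space M'. transpose (N \<omega>) = N \<omega>) \<and>
     (\<forall>i j. distributed M' lborel (\<lambda>\<omega>. N \<omega> $ i $ j)
              (normal_density 0 (sqrt (1 + (if i = j then 1 else 0))))) \<and>
     prob_space.indep_vars M' (\<lambda>_. borel) (\<lambda>(i, j) \<omega>. N \<omega> $ i $ j) {(i, j). i \<ge> j}"

definition independent_of_base ::
  "'w measure \<Rightarrow> 'v measure \<Rightarrow> ('v \<Rightarrow> 'w) \<Rightarrow> ('v \<Rightarrow> 'a::topological_space) \<Rightarrow> bool" where
  "independent_of_base M M' \<pi> N \<longleftrightarrow>
     prob_space.indep_set M'
       {\<pi> -` A \<inter> space M' | A. A \<in> sets M} {N -` B \<inter> space M' | B. B \<in> sets borel}"

end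

(* Write the second difference of the position over the block [(2p-1)h, (2p+1)h] as sigma G_p minus a
   drift term, where G_p is the second difference of the integral of W. The normalised vectors
   xi_p = sqrt (3 / (2 h^3)) G_p are independent standard Gaussian vectors, so the driftless estimator
   fluctuates like the average of xi_p xi_p^T - Id.

   Central limit theorem and mixing: xi_p is correlated with the increment of W over its block, but the
   quadratic xi_p xi_p^T - Id is not. Expanding the joint characteristic function block by block shows
   that the fluctuation is asymptotically Gaussian and independent of every finite family of values of
   W. Exponentials of such families generate all bounded functionals of W up to null sets, and Z is one
   of them, which gives stable convergence for trigonometric test functions; tightness and the
   approximation of g by trigonometric polynomials give it for all bounded continuous g.

   Drift: by continuity of the paths the drift term is h^2 times a continuous random function beta of the
   block midpoint, up to o(h^2). Its contribution is dominated by averages of xi_p beta(2ph), and beta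
   depends on W. By Weierstrass it suffices that the averages of xi_p (2ph)^k vanish almost surely for all
   k, which follows from a second moment bound if h is summable. A general h is reduced to that case by
   passing to subsequences, since the limit law does not depend on h. *)

theory Submission
  imports Defs
begin

section \<open>Trigonometric polynomials\<close>

text \<open>The obstacle is the drift. A second difference has noise of order h^(3/2) and drift of
  order h^2, so relative to the noise the drift is of order sqrt h; after multiplication by sqrt (T
  / (2 h)) the terms linear in it are of order one. Size does not remove them, only cancellation in
  an average does, and the weight in that average depends on the same path as the noise.
  Deterministic weights are harmless because the blocks are orthogonal; having the cancellation
  almost surely, for countably many weights at once, is what permits a choice of weight on each
  path. The drift is thus treated path by path, without a change of measure.

  The constant 3 / (2 h^3) inverts the variance 2 h^3 / 3 of a coordinate of the second difference
  of the integral of W, which is the integral of the square of a tent of height h and base 2 h. The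
  blocks do not overlap, hence their independence.

  Mixing is proved for the Brownian filtration augmented by null sets; the sigma-algebra of Z enters
  only through its inclusion in it.\<close>

inductive trig_poly :: "('a::euclidean_space \<Rightarrow> complex) \<Rightarrow> bool" where
  iexp: "trig_poly (\<lambda>x. iexp (a \<bullet> x))"
| cmult: "trig_poly f \<Longrightarrow> trig_poly (\<lambda>x. k * f x)"
| add: "trig_poly f \<Longrightarrow> trig_poly g \<Longrightarrow> trig_poly (\<lambda>x. f x + g x)"

lemma trig_poly_const: "trig_poly (\<lambda>x. k)"
  using trig_poly.cmult[OF trig_poly.iexp[of 0], of k] by simp

lemma trig_poly_mult:
  assumes "trig_poly f" "trig_poly g"
  shows "trig_poly (\<lambda>x. f x * g x)"
  using assms
proof (induction f)
  case (iexp a)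
  from iexp show ?case
  proof (induction g)
    case (iexp b)
    have "(\<lambda>x. iexp (a \<bullet> x) * iexp (b \<bullet> x)) = (\<lambda>x. iexp ((a + b) \<bullet> x))"
      by (simp add: exp_add[symmetric] inner_add_left distrib_left)
    then show ?case using trig_poly.iexp[of "a + b"] by simp
  next
    case (cmult g k)
    then show ?case using trig_poly.cmult[of "\<lambda>x. iexp (a \<bullet> x) * g x" k] by (simp add: ac_simps)
  next
    case (add g1 g2)
    then show ?case
      using trig_poly.add[of "\<lambda>x. iexp (a \<bullet> x) * g1 x" "\<lambda>x. iexp (a \<bullet> x) * g2 x"]
      by (simp add: distrib_left)
  qed
next
  case (cmult f k)
  then show ?case using trig_poly.cmult[of "\<lambda>x. f x * g x" k] by (simp add: ac_simps)
next
  case (add f1 f2)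
  then show ?case
    using trig_poly.add[of "\<lambda>x. f1 x * g x" "\<lambda>x. f2 x * g x"] by (simp add: distrib_right)
qed

lemma trig_poly_sum:
  "finite I \<Longrightarrow> (\<And>i. i \<in> I \<Longrightarrow> trig_poly (f i)) \<Longrightarrow> trig_poly (\<lambda>x. \<Sum>i\<in>I. f i x)"
  by (induction I rule: finite_induct) (auto intro: trig_poly_const trig_poly.add)

lemma trig_poly_sin: "trig_poly (\<lambda>x. complex_of_real (sin (a \<bullet> x)))"
proof -
  have "(\<lambda>x. complex_of_real (sin (a \<bullet> x))) =
      (\<lambda>x. 1 / (2 * \<i>) * iexp (a \<bullet> x) + (- 1 / (2 * \<i>)) * iexp ((- a) \<bullet> x))"
    by (auto simp: sin_of_real[symmetric] sin_exp_eq field_simps)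
  then show ?thesis by (simp only: trig_poly.add trig_poly.cmult trig_poly.iexp)
qed

lemma trig_poly_bounded: "trig_poly f \<Longrightarrow> \<exists>B. \<forall>x. cmod (f x) \<le> B"
proof (induction rule: trig_poly.induct)
  case (iexp a)
  show ?case by (rule exI[of _ 1]) simp
next
  case (cmult f k)
  then obtain B where "\<forall>x. cmod (f x) \<le> B" by auto
  then show ?case by (intro exI[of _ "cmod k * B"]) (auto simp: norm_mult mult_left_mono)
next
  case (add f g)
  then obtain B C where "\<forall>x. cmod (f x) \<le> B" "\<forall>x. cmod (g x) \<le> C" by auto
  then show ?case by (intro exI[of _ "B + C"] allI) (auto intro!: norm_triangle_le add_mono)
qed

lemma trig_poly_borel [measurable_dest]: "trig_poly f \<Longrightarrow> f \<in> borel_measurable borel"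
  by (induction rule: trig_poly.induct) auto

text \<open>A bounded periodic substitute for the identity: polynomials in it are trigonometric polynomials,
  and it tends to the identity as \<open>L \<rightarrow> \<infinity>\<close>.\<close>

definition sine_wrap :: "real \<Rightarrow> 'a::euclidean_space \<Rightarrow> 'a" where
  "sine_wrap L x = (\<Sum>b\<in>Basis. (L * sin ((x \<bullet> b) / L)) *\<^sub>R b)"

text \<open>Sines of linear functionals are trigonometric polynomials and these form an algebra, so
  only the linear case of the induction needs a computation.\<close>

lemma real_polynomial_function_sine_wrap:
  "real_polynomial_function q \<Longrightarrow> trig_poly (\<lambda>x. complex_of_real (q (sine_wrap L x)))"
proof (induction rule: real_polynomial_function.induct)
  case (linear q)
  then interpret q: bounded_linear q .
  have "(\<lambda>x. complex_of_real (q (sine_wrap L x))) =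
      (\<lambda>x. \<Sum>b\<in>Basis. of_real (q b * L) * complex_of_real (sin (((1 / L) *\<^sub>R b) \<bullet> x)))"
    by (simp add: sine_wrap_def q.sum q.scaleR inner_commute ac_simps)
  moreover have "trig_poly \<dots>"
    by (intro trig_poly_sum trig_poly.cmult trig_poly_sin finite_Basis)
  ultimately show ?case by simp
qed (auto intro: trig_poly_const trig_poly.add trig_poly_mult)

text \<open>\<open>sine_wrap L\<close> maps the whole space into the cube of half-width L, where
  Weierstrass approximation is uniform; composing the polynomial with the wrap makes it
  trigonometric. The error is therefore uniform in x, at the price of approximating \<open>f\<close>
  after wrapping instead of \<open>f\<close> itself.\<close>

lemma trig_poly_approx:
  fixes f :: "'a::euclidean_space \<Rightarrow> real"
  assumes "continuous_on UNIV f" "0 < e" "0 < L"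
  obtains g where "trig_poly g" "\<And>x. cmod (g x - of_real (f (sine_wrap L x))) < e"
proof -
  define S :: "'a set" where "S = cbox ((- L) *\<^sub>R One) (L *\<^sub>R One)"
  have inS: "sine_wrap L x \<in> S" for x :: 'a
  proof -
    have "\<bar>L * sin t\<bar> \<le> L" for t
      using mult_left_mono[OF abs_sin_le_one[of t], of L] \<open>0 < L\<close> by (simp add: abs_mult)
    then show ?thesis by (simp add: S_def sine_wrap_def mem_box abs_le_iff minus_le_iff)
  qed
  have "continuous_on S f" "compact S"
    using assms(1) continuous_on_subset by (blast, simp add: S_def)
  then obtain q where q: "real_polynomial_function q" "\<And>x. x \<in> S \<Longrightarrow> \<bar>f x - q x\<bar> < e"
    using Stone_Weierstrass_real_polynomial_function \<open>0 < e\<close> by metis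
  show ?thesis
  proof
    show "trig_poly (\<lambda>x. complex_of_real (q (sine_wrap L x)))"
      by (rule real_polynomial_function_sine_wrap[OF q(1)])
    show "cmod (of_real (q (sine_wrap L x)) - of_real (f (sine_wrap L x))) < e" for x
      using q(2)[OF inS[of x]] by (simp flip: of_real_diff add: abs_minus_commute)
  qed
qed

lemma sine_wrap_dist:
  fixes x :: "'a::euclidean_space"
  assumes "0 < L"
  shows "norm (sine_wrap L x - x) \<le> DIM('a) * (norm x ^ 2 / L)"
proof -
  have *: "\<bar>L * sin (t / L) - t\<bar> \<le> t\<^sup>2 / L" for t
  proof -
    have "\<bar>sin u - u\<bar> \<le> u\<^sup>2" for u :: real
    proof -
      \<comment> \<open>The Taylor polynomial with two coefficients is u. The quadratic remainder is
        cruder than the cubic one, but after scaling it still decays like 1 / L.\<close>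
      have "\<bar>sin u - (\<Sum>m<2. sin_coeff m * u ^ m)\<bar> \<le> inverse (fact 2) * \<bar>u\<bar> ^ 2"
        by (rule Maclaurin_sin_bound)
      then show ?thesis
        using zero_le_power2[of u] abs_ge_zero[of "sin u - u"]
        by (simp add: eval_nat_numeral sin_coeff_def del: abs_ge_zero)
    qed
    from this[of "t / L"] have "L * \<bar>sin (t / L) - t / L\<bar> \<le> L * (t / L)\<^sup>2"
      using assms by simp
    moreover have "L * \<bar>sin (t / L) - t / L\<bar> = \<bar>L * (sin (t / L) - t / L)\<bar>"
      using assms by (simp add: abs_mult)
    moreover have "L * (sin (t / L) - t / L) = L * sin (t / L) - t" "L * (t / L)\<^sup>2 = t\<^sup>2 / L"
      using assms by (simp_all add: field_simps power2_eq_square)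
    ultimately show ?thesis by simp
  qed
  have "norm (sine_wrap L x - x) = norm (\<Sum>b\<in>Basis. (L * sin ((x \<bullet> b) / L) - x \<bullet> b) *\<^sub>R b)"
    by (simp add: sine_wrap_def scaleR_diff_left sum_subtractf euclidean_representation)
  also have "\<dots> \<le> (\<Sum>b\<in>(Basis::'a set). norm x ^ 2 / L)"
  proof (rule sum_norm_le)
    fix b :: 'a assume b: "b \<in> Basis"
    have "(x \<bullet> b)\<^sup>2 \<le> norm x ^ 2"
      using Basis_le_norm[OF b, of x] by (simp add: abs_le_square_iff[symmetric])
    then have "(x \<bullet> b)\<^sup>2 / L \<le> norm x ^ 2 / L" using assms by (simp add: divide_right_mono)
    then show "norm ((L * sin ((x \<bullet> b) / L) - x \<bullet> b) *\<^sub>R b) \<le> norm x ^ 2 / L"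
      using *[of "x \<bullet> b"] b by simp
  qed
  finally show ?thesis by simp
qed

lemma sine_wrap_tendsto: "((\<lambda>L. sine_wrap L x) \<longlongrightarrow> x) at_top"
proof (rule LIM_zero_cancel)
  show "((\<lambda>L. sine_wrap L x - x) \<longlongrightarrow> 0) at_top"
  proof (rule Lim_null_comparison)
    show "\<forall>\<^sub>F L in at_top. norm (sine_wrap L x - x) \<le> DIM('a) * (norm x ^ 2 / L)"
      using eventually_gt_at_top[of 0]
      by eventually_elim (rule sine_wrap_dist)
    show "((\<lambda>L. DIM('a) * (norm x ^ 2 / L)) \<longlongrightarrow> 0) at_top"
      by (intro tendsto_mult_right_zero tendsto_divide_0[OF tendsto_const]
          filterlim_at_top_imp_at_infinity filterlim_ident)
  qed
qed

section \<open>Exponentials of Gaussian variables\<close>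

lemma norm_iexp_diff_le: "cmod (iexp a - iexp b) \<le> \<bar>a - b\<bar>"
proof -
  have "iexp a - iexp b = iexp b * (iexp (a - b) - 1)"
    by (simp add: algebra_simps exp_add[symmetric])
  then have "cmod (iexp a - iexp b) = cmod (iexp (a - b) - 1)" by (simp add: norm_mult)
  also have "\<dots> \<le> \<bar>a - b\<bar>" using iexp_approx1[of "a - b" 0] by simp
  finally show ?thesis .
qed

text \<open>Specified by its characteristic function so that v = 0 is allowed, which a density would
  exclude; linear combinations of a Gaussian family may well be degenerate.\<close>

definition centered_gaussian :: "'w measure \<Rightarrow> real \<Rightarrow> ('w \<Rightarrow> real) \<Rightarrow> bool" where
  "centered_gaussian M v X \<longleftrightarrow> prob_space M \<and> X \<in> borel_measurable M \<and> 0 \<le> v \<and>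
     (\<forall>t. (\<integral>\<omega>. iexp (t * X \<omega>) \<partial>M) = of_real (exp (- (t\<^sup>2 * v / 2))))"

lemma centered_gaussianI:
  assumes "prob_space M" "X \<in> borel_measurable M" "0 \<le> v"
    and "\<And>t. (\<integral>\<omega>. iexp (t * X \<omega>) \<partial>M) = of_real (exp (- (t\<^sup>2 * v / 2)))"
  shows "centered_gaussian M v X"
  using assms by (simp add: centered_gaussian_def)

text \<open>Levy's uniqueness theorem turns the condition on the characteristic function into a law,
  from which the moments are those of a scaled standard normal variable, also for v = 0.\<close>

lemma centered_gaussian_distr:
  assumes "centered_gaussian M v X"
  shows "distr M borel X = distr std_normal_distribution borel (\<lambda>x. sqrt v * x)"
proof (rule Levy_uniqueness)
  from assms interpret prob_space M by (simp add: centered_gaussian_def)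
  interpret N: real_distribution std_normal_distribution by (rule real_dist_normal_dist)
  have [measurable]: "X \<in> borel_measurable M" using assms by (simp add: centered_gaussian_def)
  show "real_distribution (distr M borel X)" by (rule real_distribution_distr) simp
  show "real_distribution (distr std_normal_distribution borel ((*) (sqrt v)))"
    by (rule N.real_distribution_distr) simp
  show "char (distr M borel X) = char (distr std_normal_distribution borel ((*) (sqrt v)))"
  proof
    fix t
    have "char (distr std_normal_distribution borel ((*) (sqrt v))) t
        = char std_normal_distribution (t * sqrt v)"
      by (simp add: char_def integral_distr ac_simps)
    also have "\<dots> = of_real (exp (- (t\<^sup>2 * v / 2)))"
      using assms by (simp add: char_std_normal_distribution centered_gaussian_def power_mult_distrib)
    also have "\<dots> = char (distr M borel X) t"
      using assms by (simp add: char_def integral_distr centered_gaussian_def)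
    finally show "char (distr M borel X) t = char (distr std_normal_distribution borel ((*) (sqrt v))) t"
      by simp
  qed
qed

lemma centered_gaussian_moment:
  assumes "centered_gaussian M v X"
  shows "integrable M (\<lambda>\<omega>. X \<omega> ^ k)"
    and "(\<integral>\<omega>. X \<omega> ^ k \<partial>M) = sqrt v ^ k * (\<integral>x. x ^ k \<partial>std_normal_distribution)"
proof -
  have [measurable]: "X \<in> borel_measurable M" using assms by (simp add: centered_gaussian_def)
  have "integrable M (\<lambda>\<omega>. X \<omega> ^ k) \<longleftrightarrow> integrable (distr M borel X) (\<lambda>x. x ^ k)"
    by (simp add: integrable_distr_eq)
  also have "\<dots> \<longleftrightarrow> integrable std_normal_distribution (\<lambda>x. sqrt v ^ k * x ^ k)"
    by (simp add: centered_gaussian_distr[OF assms] integrable_distr_eq power_mult_distrib)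
  finally show "integrable M (\<lambda>\<omega>. X \<omega> ^ k)"
    using integrable_std_normal_distribution_moment[of k] by simp
  have "(\<integral>\<omega>. X \<omega> ^ k \<partial>M) = (\<integral>x. x ^ k \<partial>distr M borel X)" by (simp add: integral_distr)
  also have "\<dots> = sqrt v ^ k * (\<integral>x. x ^ k \<partial>std_normal_distribution)"
    by (simp add: centered_gaussian_distr[OF assms] integral_distr power_mult_distrib)
  finally show "(\<integral>\<omega>. X \<omega> ^ k \<partial>M) = sqrt v ^ k * (\<integral>x. x ^ k \<partial>std_normal_distribution)" .
qed

text \<open>Orders 2, 3 and 4 feed the polarization identities below; order 6 controls the third
  absolute moment of a quadratic form.\<close>

lemma centered_gaussian_moments:
  assumes "centered_gaussian M v X"
  shows "(\<integral>\<omega>. X \<omega> ^ 2 \<partial>M) = v" "(\<integral>\<omega>. X \<omega> ^ 3 \<partial>M) = 0"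
    "(\<integral>\<omega>. X \<omega> ^ 4 \<partial>M) = 3 * v ^ 2" "(\<integral>\<omega>. X \<omega> ^ 6 \<partial>M) = 15 * v ^ 3"
    "(\<integral>\<omega>. X \<omega> \<partial>M) = 0"
proof -
  have v: "0 \<le> v" using assms by (simp add: centered_gaussian_def)
  have m: "(\<integral>x. x ^ (2 * k) \<partial>std_normal_distribution) = fact (2 * k) / (2 ^ k * fact k)" for k
    by (rule std_normal_distribution_even_moments)
  have s: "sqrt v ^ (2 * k) = v ^ k" for k using v by (simp add: power_mult)
  have *: "(\<integral>\<omega>. X \<omega> ^ (2 * k) \<partial>M) = v ^ k * (fact (2 * k) / (2 ^ k * fact k))" for k
    unfolding centered_gaussian_moment(2)[OF assms] m s ..
  have odd: "odd k \<Longrightarrow> (\<integral>\<omega>. X \<omega> ^ k \<partial>M) = 0" for k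
    unfolding centered_gaussian_moment(2)[OF assms]
    using integral_std_normal_distribution_moment_odd[of k] by simp
  show "(\<integral>\<omega>. X \<omega> ^ 3 \<partial>M) = 0" by (rule odd) simp
  show "(\<integral>\<omega>. X \<omega> \<partial>M) = 0" using odd[of 1] by simp
  show "(\<integral>\<omega>. X \<omega> ^ 2 \<partial>M) = v" using *[of 1] by simp
  show "(\<integral>\<omega>. X \<omega> ^ 4 \<partial>M) = 3 * v ^ 2" using *[of 2] by (simp add: fact_numeral)
  show "(\<integral>\<omega>. X \<omega> ^ 6 \<partial>M) = 15 * v ^ 3" using *[of 3] by (simp add: fact_numeral)
qed

lemma distributed_normal_iexp:
  assumes "prob_space M" "distributed M lborel X (normal_density 0 s)" "0 < s"
  shows "(\<integral>\<omega>. iexp (a * X \<omega>) \<partial>M) = of_real (exp (- (a\<^sup>2 * s\<^sup>2 / 2)))"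
proof -
  interpret prob_space M by fact
  define N where "N \<omega> = X \<omega> / s" for \<omega>
  have d: "distributed M lborel N std_normal_density"
    using assms(2,3) unfolding N_def[abs_def]
    by (subst (asm) normal_standard_normal_convert) auto
  have "(\<integral>\<omega>. iexp (a * X \<omega>) \<partial>M) = (\<integral>\<omega>. iexp ((a * s) * N \<omega>) \<partial>M)"
    using assms(3) by (simp add: N_def)
  also have "\<dots> = char (distr M lborel N) (a * s)"
    using d by (subst char_def, subst integral_distr) (auto simp: distributed_def)
  also have "distr M lborel N = std_normal_distribution"
    using d by (simp add: distributed_def)
  also have "char std_normal_distribution (a * s) = of_real (exp (- (a\<^sup>2 * s\<^sup>2 / 2)))"
    by (simp add: char_std_normal_distribution power_mult_distrib)
  finally show ?thesis .
qed

text \<open>The one-block estimate of the central limit theorem. Both quantities are compared with 1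
  - s / 2: the second-order Taylor expansion of the complex exponential costs the third absolute
  moment over 6, and \<bar>exp (- x) - (1 - x)\<bar> \<le> x^2 / 2 at x = s / 2 costs s^2 /
  8.\<close>

lemma (in prob_space) char_gaussian_approx:
  assumes X: "X \<in> borel_measurable M" "integrable M (\<lambda>\<omega>. X \<omega> ^ 2)" "integrable M (\<lambda>\<omega>. \<bar>X \<omega>\<bar> ^ 3)"
    and mean: "expectation X = 0"
  defines "s \<equiv> expectation (\<lambda>\<omega>. X \<omega> ^ 2)"
  shows "cmod ((\<integral>\<omega>. iexp (X \<omega>) \<partial>M) - of_real (exp (- s / 2)))
    \<le> expectation (\<lambda>\<omega>. \<bar>X \<omega>\<bar> ^ 3) / 6 + s\<^sup>2 / 8"
proof -
  have [measurable]: "X \<in> borel_measurable M" by fact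
  have iX: "integrable M X"
  proof (rule Bochner_Integration.integrable_bound)
    show "integrable M (\<lambda>\<omega>. 1 + X \<omega> ^ 2)" using X(2) by simp
    show "AE \<omega> in M. norm (X \<omega>) \<le> norm (1 + (X \<omega>)\<^sup>2)"
    proof (intro always_eventually allI)
      fix \<omega>
      have "2 * \<bar>X \<omega>\<bar> \<le> 1 + (X \<omega>)\<^sup>2"
        using zero_le_power2[of "\<bar>X \<omega>\<bar> - 1"] by (simp add: power2_diff)
      then show "norm (X \<omega>) \<le> norm (1 + (X \<omega>)\<^sup>2)" by simp
    qed
  qed simp
  have ii: "integrable M (\<lambda>\<omega>. iexp (X \<omega>))"
    by (intro integrable_const_bound[of _ 1]) auto
  define R where "R \<omega> = iexp (X \<omega>) - (1 + \<i> * of_real (X \<omega>) - of_real (X \<omega> ^ 2) / 2)" for \<omega>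
  have R: "cmod (R \<omega>) \<le> \<bar>X \<omega>\<bar> ^ 3 / 6" for \<omega>
  proof -
    have "(\<Sum>k\<le>2. (\<i> * complex_of_real (X \<omega>)) ^ k / fact k)
        = 1 + \<i> * of_real (X \<omega>) - of_real (X \<omega> ^ 2) / 2"
    proof -
      have "{..2::nat} = {0, 1, 2}" by auto
      then show ?thesis by (simp add: power_mult_distrib)
    qed
    then show ?thesis
      using iexp_approx1[of "X \<omega>" 2] by (simp add: R_def fact_numeral eval_nat_numeral)
  qed
  have "(\<integral>\<omega>. R \<omega> \<partial>M) = (\<integral>\<omega>. iexp (X \<omega>) \<partial>M) - (1 + \<i> * of_real (expectation X) - of_real s / 2)"
  proof -
    have "complex_integrable M (\<lambda>\<omega>. (complex_of_real (X \<omega>))\<^sup>2)"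
      "(\<integral>\<omega>. (complex_of_real (X \<omega>))\<^sup>2 \<partial>M) = of_real (expectation (\<lambda>\<omega>. (X \<omega>)\<^sup>2))"
      using integrable_of_real[OF X(2), where 'a = complex] integral_complex_of_real[of M "\<lambda>\<omega>. (X \<omega>)\<^sup>2"]
      by simp_all
    then show ?thesis using ii iX by (simp add: prob_space R_def[abs_def] s_def)
  qed
  then have "cmod ((\<integral>\<omega>. iexp (X \<omega>) \<partial>M) - (1 - of_real s / 2)) = cmod (\<integral>\<omega>. R \<omega> \<partial>M)"
    using mean by simp
  also have "\<dots> \<le> expectation (\<lambda>\<omega>. \<bar>X \<omega>\<bar> ^ 3 / 6)"
    by (rule order_trans[OF integral_norm_bound integral_mono']) (use X(3) R in auto)
  finally have 1: "cmod ((\<integral>\<omega>. iexp (X \<omega>) \<partial>M) - (1 - of_real s / 2)) \<le> expectation (\<lambda>\<omega>. \<bar>X \<omega>\<bar> ^ 3) / 6"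
    by simp
  have s0: "0 \<le> s" by (simp add: s_def)
  have "\<bar>exp (- (s / 2)) - (1 - s / 2)\<bar> \<le> (s / 2)\<^sup>2 / 2"
  proof -
    have l: "1 - s / 2 \<le> exp (- (s / 2))" using exp_ge_add_one_self[of "- (s / 2)"] by simp
    have "exp (- x) \<le> 1 - x + x\<^sup>2 / 2" if "0 \<le> x" for x :: real
    proof -
      let ?f = "\<lambda>x::real. 1 - x + x\<^sup>2 / 2 - exp (- x)"
      have "?f 0 \<le> ?f x"
      proof (rule DERIV_nonneg_imp_nondecreasing[OF that])
        fix y :: real assume "0 \<le> y" "y \<le> x"
        have "(?f has_real_derivative (- 1 + y + exp (- y))) (at y)"
          by (auto intro!: derivative_eq_intros)
        moreover have "0 \<le> - 1 + y + exp (- y)" using exp_ge_add_one_self[of "- y"] by simp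
        ultimately show "\<exists>z. (?f has_real_derivative z) (at y) \<and> 0 \<le> z" by blast
      qed
      then show ?thesis by simp
    qed
    from this[of "s / 2"] l s0 show ?thesis by simp
  qed
  then have "cmod ((1 - of_real s / 2) - of_real (exp (- s / 2))) \<le> s\<^sup>2 / 8"
  proof -
    have "(1 - of_real s / 2) - of_real (exp (- s / 2)) = complex_of_real (1 - s / 2 - exp (- (s / 2)))"
      by simp
    then show ?thesis
      using \<open>\<bar>exp (- (s / 2)) - (1 - s / 2)\<bar> \<le> (s / 2)\<^sup>2 / 2\<close>
      by (simp only: norm_of_real abs_minus_commute[of "1 - s / 2"]) (simp add: power_divide)
  qed
  with 1 show ?thesis
    using norm_triangle_ineq[of "(\<integral>\<omega>. iexp (X \<omega>) \<partial>M) - (1 - of_real s / 2)"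
        "(1 - of_real s / 2) - of_real (exp (- s / 2))"] by simp
qed

text \<open>The series of squares has finite expectation by Tonelli, so it converges almost surely
  and its terms vanish. Variables with different n may be dependent, as they are in the application,
  where all come from one path.\<close>

lemma AE_tendsto_zero_of_summable_second_moments:
  fixes X :: "nat \<Rightarrow> 'w \<Rightarrow> real"
  assumes [measurable]: "\<And>n. X n \<in> borel_measurable M"
    and int: "\<And>n. integrable M (\<lambda>\<omega>. X n \<omega> ^ 2)"
    and le: "\<And>n. (\<integral>\<omega>. X n \<omega> ^ 2 \<partial>M) \<le> b n" and sum: "summable b"
  shows "AE \<omega> in M. (\<lambda>n. X n \<omega>) \<longlonglongrightarrow> 0"
proof -
  have b0: "0 \<le> b n" for n
    using le[of n] by (rule order_trans[rotated]) simp
  have "(\<integral>\<^sup>+\<omega>. (\<Sum>n. ennreal (X n \<omega> ^ 2)) \<partial>M) = (\<Sum>n. \<integral>\<^sup>+\<omega>. ennreal (X n \<omega> ^ 2) \<partial>M)"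
    by (rule nn_integral_suminf) simp
  also have "\<dots> = (\<Sum>n. ennreal (\<integral>\<omega>. X n \<omega> ^ 2 \<partial>M))"
    by (intro suminf_cong nn_integral_eq_integral int) simp
  also have "\<dots> \<le> (\<Sum>n. ennreal (b n))"
    by (intro suminf_le ennreal_leI le) auto
  also have "\<dots> < \<infinity>"
    using sum b0 by (simp add: suminf_ennreal2)
  finally have "AE \<omega> in M. (\<Sum>n. ennreal (X n \<omega> ^ 2)) \<noteq> \<infinity>"
    by (intro nn_integral_PInf_AE) auto
  then show ?thesis
  proof eventually_elim
    case (elim \<omega>)
    then have "summable (\<lambda>n. X n \<omega> ^ 2)"
      by (intro summable_suminf_not_top) (auto simp: top_unique infinity_ennreal_def)
    then have "(\<lambda>n. X n \<omega> ^ 2) \<longlonglongrightarrow> 0" by (rule summable_LIMSEQ_zero)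
    then have "(\<lambda>n. sqrt (X n \<omega> ^ 2)) \<longlonglongrightarrow> sqrt 0" by (rule tendsto_real_sqrt)
    then show ?case by (simp add: tendsto_rabs_zero_iff)
  qed
qed

section \<open>Isserlis' formula\<close>

text \<open>Joint Gaussianity in Cramer-Wold form. The variances of linear combinations determine
  only the symmetric part of \<open>C\<close>, hence the symmetry clause, which makes
  \<open>C\<close> the covariance.\<close>

definition gaussian_family :: "'w measure \<Rightarrow> 'i set \<Rightarrow> ('i \<Rightarrow> 'i \<Rightarrow> real) \<Rightarrow> ('i \<Rightarrow> 'w \<Rightarrow> real) \<Rightarrow> bool" where
  "gaussian_family M J C X \<longleftrightarrow> finite J \<and> (\<forall>i j. C i j = C j i) \<and>
     (\<forall>u. centered_gaussian M (\<Sum>i\<in>J. \<Sum>j\<in>J. u i * u j * C i j) (\<lambda>\<omega>. \<Sum>i\<in>J. u i * X i \<omega>))"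

text \<open>The sign of the first variable is fixed, so n variables give 2^(n - 1) signed sums and
  the constant n! 2^(n - 1): here 24, and 192 for four variables.\<close>

lemma polarization_cubic:
  fixes a b c :: real
  shows "(a + b + c) ^ 3 - (a + b - c) ^ 3 - (a - b + c) ^ 3 + (a - b - c) ^ 3 = 24 * (a * b * c)"
  by (simp add: power3_eq_cube algebra_simps)

lemma polarization_quartic:
  fixes a b c d :: real
  shows "(a + b + c + d) ^ 4 - (a + b + c - d) ^ 4 - (a + b - c + d) ^ 4 + (a + b - c - d) ^ 4
    - (a - b + c + d) ^ 4 + (a - b + c - d) ^ 4 + (a - b - c + d) ^ 4 - (a - b - c - d) ^ 4
    = 192 * (a * b * (c * d))"
proof -
  \<comment> \<open>Pairing the two signs of d reduces the claim to the cubic identity; the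
    contributions 8 d^3 s cancel because the signed sum of the four values of s is zero.\<close>
  have *: "(s + d) ^ 4 - (s - d) ^ 4 = 8 * d * s ^ 3 + 8 * d ^ 3 * s" for s
    by (simp add: power4_eq_xxxx power3_eq_cube algebra_simps)
  have "8 * d * ((a + b + c) ^ 3 - (a + b - c) ^ 3 - (a - b + c) ^ 3 + (a - b - c) ^ 3)
      = 192 * (a * b * (c * d))"
    unfolding polarization_cubic by simp
  then show ?thesis
    using *[of "a + b + c"] *[of "a + b - c"] *[of "a - b + c"] *[of "a - b - c"]
    by (simp add: algebra_simps)
qed

context
  fixes M :: "'w measure" and J :: "'i set" and C X
  assumes fam: "gaussian_family M J C X"
begin

text \<open>The weights are sums of indicators, so coinciding indices simply add up. One statement
  then serves for one to four variables: repeat an index and give it the coefficient zero.\<close>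

lemma gaussian_family_comb:
  assumes "a \<in> J" "b \<in> J" "c \<in> J" "d \<in> J"
  shows "centered_gaussian M
    (s\<^sup>2 * C a a + t\<^sup>2 * C b b + u\<^sup>2 * C c c + v\<^sup>2 * C d d + 2 * (s * t * C a b + s * u * C a c
      + s * v * C a d + t * u * C b c + t * v * C b d + u * v * C c d))
    (\<lambda>\<omega>. s * X a \<omega> + t * X b \<omega> + u * X c \<omega> + v * X d \<omega>)"
proof -
  define w where "w i = s * of_bool (i = a) + t * of_bool (i = b) + u * of_bool (i = c) + v * of_bool (i = d)" for i
  have fin: "finite J" and sym: "C i j = C j i" for i j
    using fam by (simp_all add: gaussian_family_def)
  have w: "(\<Sum>i\<in>J. w i * f i) = s * f a + t * f b + u * f c + v * f d" for f :: "'i \<Rightarrow> real"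
  proof -
    have "w i * f i = (if i = a then s * f i else 0) + (if i = b then t * f i else 0)
        + (if i = c then u * f i else 0) + (if i = d then v * f i else 0)" for i
      by (simp add: w_def distrib_right)
    then show ?thesis using assms fin by (simp add: sum.distrib)
  qed
  have "(\<Sum>i\<in>J. \<Sum>j\<in>J. w i * w j * C i j) = (\<Sum>i\<in>J. w i * (\<Sum>j\<in>J. w j * C i j))"
    by (simp add: sum_distrib_left ac_simps)
  also have "\<dots> = s\<^sup>2 * C a a + t\<^sup>2 * C b b + u\<^sup>2 * C c c + v\<^sup>2 * C d d + 2 * (s * t * C a b + s * u * C a c
      + s * v * C a d + t * u * C b c + t * v * C b d + u * v * C c d)"
    unfolding w by (simp add: sym[of b a] sym[of c a] sym[of d a] sym[of c b] sym[of d b] sym[of d c]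
        algebra_simps power2_eq_square)
  finally show ?thesis
    using fam[unfolded gaussian_family_def, THEN conjunct2, THEN conjunct2, rule_format, of w]
    by (simp add: w)
qed

lemma gaussian_family_single:
  assumes "a \<in> J" shows "centered_gaussian M (C a a) (X a)"
  using gaussian_family_comb[OF assms assms assms assms, of 1 0 0 0] by simp

lemma gaussian_family_covariance:
  assumes "a \<in> J" "b \<in> J"
  shows "integrable M (\<lambda>\<omega>. X a \<omega> * X b \<omega>)" "(\<integral>\<omega>. X a \<omega> * X b \<omega> \<partial>M) = C a b"
proof -
  note g = gaussian_family_comb[OF assms assms(1) assms(1), of 1 _ 0 0]
  have *: "(\<lambda>\<omega>. X a \<omega> * X b \<omega>) = (\<lambda>\<omega>. ((1 * X a \<omega> + 1 * X b \<omega> + 0 * X a \<omega> + 0 * X a \<omega>)\<^sup>2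
      - (1 * X a \<omega> + - 1 * X b \<omega> + 0 * X a \<omega> + 0 * X a \<omega>)\<^sup>2) / 4)"
    by (auto simp: power2_eq_square algebra_simps)
  note i = centered_gaussian_moment(1)[OF g[of 1], of 2] centered_gaussian_moment(1)[OF g[of "- 1"], of 2]
  show "integrable M (\<lambda>\<omega>. X a \<omega> * X b \<omega>)"
    unfolding * using i by (intro integrable_divide_zero Bochner_Integration.integrable_diff) auto
  show "(\<integral>\<omega>. X a \<omega> * X b \<omega> \<partial>M) = C a b"
    unfolding * integral_divide_zero Bochner_Integration.integral_diff[OF i]
      centered_gaussian_moments(1)[OF g] by (simp add: field_simps)
qed

text \<open>By polarization the product is a combination of cubes of centered Gaussian variables,
  whose odd moments vanish.\<close>

lemma gaussian_family_third_moment: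
  assumes "a \<in> J" "b \<in> J" "c \<in> J"
  shows "integrable M (\<lambda>\<omega>. X a \<omega> * X b \<omega> * X c \<omega>)" "(\<integral>\<omega>. X a \<omega> * X b \<omega> * X c \<omega> \<partial>M) = 0"
proof -
  note g = gaussian_family_comb[OF assms assms(1), of 1 _ _ 0]
  define f where "f e e' \<omega> = (1 * X a \<omega> + e * X b \<omega> + e' * X c \<omega> + 0 * X a \<omega>) ^ 3" for e e' \<omega>
  have *: "(\<lambda>\<omega>. X a \<omega> * X b \<omega> * X c \<omega>) = (\<lambda>\<omega>. (f 1 1 \<omega> - f 1 (- 1) \<omega> - f (- 1) 1 \<omega> + f (- 1) (- 1) \<omega>) / 24)"
    using polarization_cubic by (auto simp: f_def)
  have i: "integrable M (f e e')" and z: "(\<integral>\<omega>. f e e' \<omega> \<partial>M) = 0" for e e'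
    unfolding f_def[abs_def]
    by (rule centered_gaussian_moment(1)[OF g] centered_gaussian_moments(2)[OF g])+
  show "integrable M (\<lambda>\<omega>. X a \<omega> * X b \<omega> * X c \<omega>)" unfolding * using i by simp
  show "(\<integral>\<omega>. X a \<omega> * X b \<omega> * X c \<omega> \<partial>M) = 0" unfolding * using i z by simp
qed

text \<open>Polarization leaves the fourth moments of eight signed sums, each equal to 3 v^2 with v
  the variance of the sum, and v is explicit in the covariances.\<close>

lemma gaussian_family_isserlis:
  assumes "a \<in> J" "b \<in> J" "c \<in> J" "d \<in> J"
  shows "integrable M (\<lambda>\<omega>. X a \<omega> * X b \<omega> * (X c \<omega> * X d \<omega>))"
    "(\<integral>\<omega>. X a \<omega> * X b \<omega> * (X c \<omega> * X d \<omega>) \<partial>M) = C a b * C c d + C a c * C b d + C a d * C b c"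
proof -
  note g = gaussian_family_comb[OF assms, of 1]
  define f where "f e e' e'' \<omega> = (1 * X a \<omega> + e * X b \<omega> + e' * X c \<omega> + e'' * X d \<omega>) ^ 4" for e e' e'' \<omega>
  have *: "(\<lambda>\<omega>. X a \<omega> * X b \<omega> * (X c \<omega> * X d \<omega>)) =
    (\<lambda>\<omega>. (f 1 1 1 \<omega> - f 1 1 (- 1) \<omega> - f 1 (- 1) 1 \<omega> + f 1 (- 1) (- 1) \<omega>
      - f (- 1) 1 1 \<omega> + f (- 1) 1 (- 1) \<omega> + f (- 1) (- 1) 1 \<omega> - f (- 1) (- 1) (- 1) \<omega>) / 192)"
    using polarization_quartic by (auto simp: f_def)
  have i: "integrable M (f e e' e'')" for e e' e''
    unfolding f_def[abs_def] by (rule centered_gaussian_moment(1)[OF g])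
  note z = centered_gaussian_moments(3)[OF g, folded f_def]
  show "integrable M (\<lambda>\<omega>. X a \<omega> * X b \<omega> * (X c \<omega> * X d \<omega>))" unfolding * using i by simp
  show "(\<integral>\<omega>. X a \<omega> * X b \<omega> * (X c \<omega> * X d \<omega>) \<partial>M) = C a b * C c d + C a c * C b d + C a d * C b c"
  proof -
    \<comment> \<open>S is the sum of the four variances and p, ..., z are the six covariances.
      Changing signs of variables changes the signs of covariances, and in the signed sum of squares
      only the products of complementary pairs survive.\<close>
    have pol: "3 * (S + 2 * (p + q + r + x + y + z))\<^sup>2 - 3 * (S + 2 * (p + q - r + x - y - z))\<^sup>2
        - 3 * (S + 2 * (p - q + r - x + y - z))\<^sup>2 + 3 * (S + 2 * (p - q - r - x - y + z))\<^sup>2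
        - 3 * (S + 2 * (- p + q + r - x - y + z))\<^sup>2 + 3 * (S + 2 * (- p + q - r - x + y - z))\<^sup>2
        + 3 * (S + 2 * (- p - q + r + x - y - z))\<^sup>2 - 3 * (S + 2 * (- p - q - r + x + y + z))\<^sup>2
        = 192 * (p * z + q * y + r * x)" for S p q r x y z :: real
      by algebra
    show ?thesis
      unfolding * using i
      by (simp add: z) (use pol[of "C a a + C b b + C c c + C d d" "C a b" "C a c" "C a d" "C b c" "C b d" "C c d"]
        in simp)
  qed
qed

end

section \<open>Half-lines from exponentials\<close>

text \<open>A functional monotone class argument on the line. It is stated for an abstract
  \<open>K\<close> so that one factor of a product of half-line indicators can be treated while the
  other factors are frozen inside \<open>K\<close>.\<close>

lemma trig_closed_class_contains_halflines:
  fixes K :: "(real \<Rightarrow> complex) \<Rightarrow> bool"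
  assumes iexp: "\<And>u. K (\<lambda>x. iexp (u * x))"
    and cmult: "\<And>f k. K f \<Longrightarrow> K (\<lambda>x. k * f x)"
    and add: "\<And>f g. K f \<Longrightarrow> K g \<Longrightarrow> K (\<lambda>x. f x + g x)"
    and lim: "\<And>f g B. (\<And>n. K (f n)) \<Longrightarrow> (\<And>n x. cmod (f n x) \<le> B) \<Longrightarrow> (\<And>x. (\<lambda>n. f n x) \<longlonglongrightarrow> g x) \<Longrightarrow> K g"
  shows "K (indicator {..a})"
proof -
  have trig: "trig_poly f \<Longrightarrow> K f" for f :: "real \<Rightarrow> complex"
  proof (induction rule: trig_poly.induct)
    case (iexp a)
    show ?case using assms(1)[of a] by simp
  next
    case (cmult f k)
    show ?case by (rule assms(2)[OF cmult.IH])
  next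
    case (add f g)
    show ?case by (rule assms(3)[OF add.IH])
  qed
  have cont: "K (\<lambda>x. of_real (f x))" if f: "continuous_on UNIV f" "\<And>x. \<bar>f x\<bar> \<le> 1" for f
  proof -
    \<comment> \<open>Wrapping scale and accuracy are tied to the same n: the wrapped function tends
      to \<open>f\<close> pointwise while the uniform error vanishes, so the approximants converge
      pointwise and stay below 2.\<close>
    have "\<forall>n. \<exists>g. trig_poly g \<and>
        (\<forall>x. cmod (g x - of_real (f (sine_wrap (real (Suc n)) x))) < 1 / real (Suc n))"
    proof
      fix n
      show "\<exists>g. trig_poly g \<and>
          (\<forall>x. cmod (g x - of_real (f (sine_wrap (real (Suc n)) x))) < 1 / real (Suc n))"
        by (rule trig_poly_approx[OF f(1), of "1 / real (Suc n)" "real (Suc n)"]) auto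
    qed
    from choice[OF this] obtain g where g: "\<And>n. trig_poly (g n)"
      "\<And>n x. cmod (g n x - of_real (f (sine_wrap (real (Suc n)) x))) < 1 / real (Suc n)"
      by blast
    show ?thesis
    proof (rule lim)
      show "K (g n)" for n by (rule trig[OF g(1)])
      show "cmod (g n x) \<le> 2" for n x
      proof -
        have "cmod (g n x) \<le> cmod (g n x - of_real (f (sine_wrap (real (Suc n)) x)))
            + cmod (of_real (f (sine_wrap (real (Suc n)) x)))" by (metis add.commute norm_triangle_sub)
        also have "\<dots> \<le> 1 + 1"
        proof (rule add_mono)
          have "1 / real (Suc n) \<le> 1" by simp
          then show "cmod (g n x - of_real (f (sine_wrap (real (Suc n)) x))) \<le> 1" 
            using g(2)[of n x] by linarith
        qed (use f(2) in simp)
        finally show ?thesis by simp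
      qed
      show "(\<lambda>n. g n x) \<longlonglongrightarrow> of_real (f x)" for x
      proof (rule Lim_transform)
        have "filterlim (\<lambda>n. real (Suc n)) at_top sequentially"
          by (rule filterlim_compose[OF filterlim_real_sequentially filterlim_Suc])
        from filterlim_compose[OF sine_wrap_tendsto this]
        have "(\<lambda>n. sine_wrap (real (Suc n)) x) \<longlonglongrightarrow> x" by simp
        moreover have "isCont f x" using f(1) by (simp add: continuous_on_eq_continuous_at)
        ultimately show "(\<lambda>n. complex_of_real (f (sine_wrap (real (Suc n)) x))) \<longlonglongrightarrow> of_real (f x)"
          by (intro tendsto_of_real isCont_tendsto_compose[of x f])
        show "(\<lambda>n. g n x - complex_of_real (f (sine_wrap (real (Suc n)) x))) \<longlonglongrightarrow> 0"
        proof (rule Lim_null_comparison)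
          show "\<forall>\<^sub>F n in sequentially. cmod (g n x - complex_of_real (f (sine_wrap (real (Suc n)) x))) \<le> 1 / real (Suc n)"
            by (intro always_eventually allI) (rule less_imp_le[OF g(2)])
          show "(\<lambda>n. 1 / real (Suc n)) \<longlonglongrightarrow> 0" by (rule lim_1_over_n[THEN LIMSEQ_Suc])
        qed
      qed
    qed
  qed
  \<comment> \<open>Ramps that equal 1 up to a and, for n > 0, vanish from a + 1 / n on; their limit
    is the closed half-line.\<close>
  define f where "f n x = max 0 (min 1 (1 - real n * (x - a)))" for n x
  show ?thesis
  proof (rule lim)
    show "K (\<lambda>x. of_real (f n x))" for n
      by (rule cont) (auto simp: f_def intro!: continuous_intros)
    show "cmod (of_real (f n x)) \<le> 1" for n x
    proof -
      have "0 \<le> f n x" "f n x \<le> 1" unfolding f_def by linarith+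
      then show ?thesis by simp
    qed
    show "(\<lambda>n. complex_of_real (f n x)) \<longlonglongrightarrow> indicator {..a} x" for x
    proof (cases "x \<le> a")
      case True
      then have "real n * (x - a) \<le> 0" for n by (simp add: mult_nonneg_nonpos)
      then show ?thesis using True
      proof -
        have "f n x = 1" for n
          unfolding f_def using \<open>\<And>n. real n * (x - a) \<le> 0\<close>[of n] by linarith
        then show ?thesis using True by simp
      qed
    next
      case False
      obtain N where N: "1 / (x - a) < real N" using reals_Archimedean2 by blast
      have z: "f n x = 0" if "n \<ge> N" for n
      proof -
        have "1 / (x - a) < real n" using N that by linarith
        then have "1 < real n * (x - a)" using False by (simp add: field_simps)
        then show ?thesis unfolding f_def by linarith
      qed
      have "\<forall>\<^sub>F n in sequentially. complex_of_real (f n x) = indicator {..a} x"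
        using eventually_ge_at_top[of N] by eventually_elim (use False z in simp)
      then show ?thesis by (rule tendsto_eventually)
    qed
  qed
qed

section \<open>Block functionals of Brownian motion\<close>

text \<open>Left-endpoint sums, with \<open>Suc N\<close> cells so that the mesh is always defined.
  They present the integral of a path as a limit of functions of finitely many of its values, to
  which measurability and independence apply.\<close>

lemma riemann_sum_tendsto_integral:
  fixes f :: "real \<Rightarrow> 'a::euclidean_space"
  assumes f: "continuous_on {a..a + h} f" and h: "0 < h"
  shows "(\<lambda>N. (h / real (Suc N)) *\<^sub>R (\<Sum>k<Suc N. f (a + real k * (h / real (Suc N)))))
    \<longlonglongrightarrow> integral {a..a + h} f"
proof (rule LIMSEQ_I)
  fix e :: real assume e: "0 < e"
  have "uniformly_continuous_on {a..a + h} f" by (rule compact_uniformly_continuous[OF f]) simp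
  then obtain d where d: "0 < d" "\<And>x y. x \<in> {a..a + h} \<Longrightarrow> y \<in> {a..a + h} \<Longrightarrow> dist y x < d \<Longrightarrow> dist (f y) (f x) < e / (2 * h)"
    unfolding uniformly_continuous_on_def using e h
    by (metis divide_pos_pos mult_pos_pos zero_less_numeral)
  obtain N0 where N0: "h / d < real N0" using reals_Archimedean2 by blast
  have "norm ((h / real (Suc N)) *\<^sub>R (\<Sum>k<Suc N. f (a + real k * (h / real (Suc N)))) - integral {a..a + h} f) < e"
    if "N \<ge> N0" for N
  proof -
    define \<delta> where "\<delta> = h / real (Suc N)"
    have \<delta>: "0 < \<delta>" "real (Suc N) * \<delta> = h" using h by (simp_all add: \<delta>_def)
    have "h / d < real (Suc N)" using N0 that by simp
    then have "h < real (Suc N) * d" using d(1) by (simp add: field_simps)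
    then have "\<delta> < d" by (simp add: \<delta>_def field_simps)
    have sub: "{a..a + real K * \<delta>} \<subseteq> {a..a + h}" if "K \<le> Suc N" for K
    proof -
      have "real K * \<delta> \<le> real (Suc N) * \<delta>" using that \<delta>(1) by (intro mult_right_mono) auto
      then show ?thesis using \<delta>(2) by auto
    qed
    have int: "f integrable_on {a..a + real K * \<delta>}" if "K \<le> Suc N" for K
      using integrable_continuous_interval[OF continuous_on_subset[OF f sub[OF that]]] .
    \<comment> \<open>Induction over the cells: each contributes at most \<delta> e / (2 h), so all
      together contribute at most e / 2.\<close>
    have "norm (\<delta> *\<^sub>R (\<Sum>k<K. f (a + real k * \<delta>)) - integral {a..a + real K * \<delta>} f) \<le> real K * \<delta> * (e / (2 * h))"
      if "K \<le> Suc N" for K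
      using that
    proof (induction K)
      case 0
      then show ?case by simp
    next
      case (Suc K)
      let ?l = "a + real K * \<delta>" and ?r = "a + real (Suc K) * \<delta>"
      have lr: "a \<le> ?l" "?l \<le> ?r" "?r - ?l = \<delta>" using \<delta>(1) by (simp_all add: algebra_simps)
      have i: "f integrable_on {?l..?r}"
        by (rule integrable_subinterval_real[OF int[OF Suc.prems]]) (use lr in auto)
      have "norm (integral {?l..?r} (\<lambda>s. f ?l - f s)) \<le> e / (2 * h) * (?r - ?l)"
      proof (rule integral_bound)
        show "continuous_on {?l..?r} (\<lambda>s. f ?l - f s)"
          by (intro continuous_intros continuous_on_subset[OF f]) (use sub[OF Suc.prems] lr in auto)
        fix s assume s: "s \<in> {?l..?r}"
        have "?r \<in> {a..?r}" using lr by (simp only: atLeastAtMost_iff) linarith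
        then have "?r \<le> a + h" using sub[OF Suc.prems] by auto
        then have in': "s \<in> {a..a + h}" "?l \<in> {a..a + h}"
          using s lr(1,2) unfolding atLeastAtMost_iff by linarith+
        have "dist ?l s < d" using s lr \<open>\<delta> < d\<close> by (simp add: dist_real_def)
        from d(2)[OF in' this] show "norm (f ?l - f s) \<le> e / (2 * h)" by (simp add: dist_norm)
      qed (use lr in simp)
      moreover have "integral {?l..?r} (\<lambda>s. f ?l - f s) = \<delta> *\<^sub>R f ?l - integral {?l..?r} f"
        using i lr by (subst Henstock_Kurzweil_Integration.integral_diff) auto
      moreover have "integral {a..?r} f = integral {a..?l} f + integral {?l..?r} f"
        by (rule Henstock_Kurzweil_Integration.integral_combine[symmetric]) (use lr int[OF Suc.prems] in auto)
      ultimately have "\<delta> *\<^sub>R (\<Sum>k<Suc K. f (a + real k * \<delta>)) - integral {a..?r} f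
          = (\<delta> *\<^sub>R (\<Sum>k<K. f (a + real k * \<delta>)) - integral {a..?l} f) + integral {?l..?r} (\<lambda>s. f ?l - f s)"
        by (simp add: scaleR_add_right)
      also have "norm \<dots> \<le> real K * \<delta> * (e / (2 * h)) + e / (2 * h) * \<delta>"
        using Suc \<open>norm (integral {?l..?r} (\<lambda>s. f ?l - f s)) \<le> e / (2 * h) * (?r - ?l)\<close> lr
        by (intro norm_triangle_mono) auto
      also have "\<dots> = real (Suc K) * \<delta> * (e / (2 * h))" by (simp add: algebra_simps add_divide_distrib)
      finally show ?case .
    qed
    from this[of "Suc N"] have "norm (\<delta> *\<^sub>R (\<Sum>k<Suc N. f (a + real k * \<delta>)) - integral {a..a + h} f) \<le> h * (e / (2 * h))"
      using \<delta>(2) by simp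
    also have "\<dots> < e" using e h by simp
    finally show ?thesis unfolding \<delta>_def .
  qed
  then show "\<exists>no. \<forall>n\<ge>no. norm ((h / real (Suc n)) *\<^sub>R (\<Sum>k<Suc n. f (a + real k * (h / real (Suc n)))) - integral {a..a + h} f) < e"
    by blast
qed

text \<open>The difference of the Riemann sums over two adjacent intervals is, by Abel summation, a weighted sum
  of the increments over the grid; these are the weights.\<close>

definition tent :: "nat \<Rightarrow> nat \<Rightarrow> real" where
  "tent N r = (if r < N then real r + 1 else 2 * real N - 1 - real r)"

lemma sum_double_split:
  fixes g :: "nat \<Rightarrow> 'a::comm_monoid_add"
  shows "(\<Sum>r<2 * N. g r) = (\<Sum>r<N. g r) + (\<Sum>r<N. g (N + r))"
  using sum.atLeastLessThan_concat[of 0 N "2 * N" g] sum.shift_bounds_nat_ivl[of g 0 N N]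
  by (simp add: lessThan_atLeast0 mult_2 add.commute)

text \<open>Abel summation on each half: the rising weights give N f(N) minus the left sum, the
  falling weights give the right sum minus N f(N), and the boundary terms cancel.\<close>

lemma sum_tent_increments:
  fixes f :: "nat \<Rightarrow> 'a::real_vector"
  shows "(\<Sum>r<2 * N. tent N r *\<^sub>R (f (Suc r) - f r)) = (\<Sum>k<N. f (N + k) - f k)"
proof -
  have 1: "(\<Sum>r<N. (real r + 1) *\<^sub>R (f (Suc r) - f r)) = real N *\<^sub>R f N - (\<Sum>k<N. f k)" for N and f :: "nat \<Rightarrow> 'a"
    by (induction N) (simp_all add: algebra_simps)
  have 2: "(\<Sum>r<N. (real N - 1 - real r) *\<^sub>R (f (Suc r) - f r)) = (\<Sum>k<N. f k) - real N *\<^sub>R f 0" for N and f :: "nat \<Rightarrow> 'a"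
  proof (induction N)
    case (Suc N)
    have "(\<Sum>r<N. (real (Suc N) - 1 - real r) *\<^sub>R (f (Suc r) - f r))
        = (\<Sum>r<N. (real N - 1 - real r) *\<^sub>R (f (Suc r) - f r)) + (\<Sum>r<N. f (Suc r) - f r)"
      unfolding sum.distrib[symmetric] by (intro sum.cong) (simp_all add: algebra_simps)
    also have "(\<Sum>r<N. f (Suc r) - f r) = f N - f 0" by (rule sum_lessThan_telescope)
    finally have *: "(\<Sum>r<N. (real (Suc N) - 1 - real r) *\<^sub>R (f (Suc r) - f r))
        = (\<Sum>r<N. (real N - 1 - real r) *\<^sub>R (f (Suc r) - f r)) + (f N - f 0)" .
    show ?case unfolding sum.lessThan_Suc * Suc.IH by (simp add: algebra_simps)
  qed simp
  have "(\<Sum>r<2 * N. tent N r *\<^sub>R (f (Suc r) - f r)) = (\<Sum>r<N. (real r + 1) *\<^sub>R (f (Suc r) - f r))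
      + (\<Sum>r<N. (real N - 1 - real r) *\<^sub>R (f (N + Suc r) - f (N + r)))"
    unfolding sum_double_split by (simp add: tent_def algebra_simps)
  also have "\<dots> = (real N *\<^sub>R f N - (\<Sum>k<N. f k)) + ((\<Sum>k<N. f (N + k)) - real N *\<^sub>R f (N + 0))"
    unfolding 1 by (simp only: 2[of N "\<lambda>r. f (N + r)"])
  finally show ?thesis by (simp add: sum_subtractf)
qed

text \<open>Determines the covariance of a block sum with the increment over the block: (h / N)^2
  times this value is h^2, for every N.\<close>

lemma sum_tent: "(\<Sum>r<2 * N. tent N r) = (real N)\<^sup>2"
proof -
  have "(\<Sum>r<2 * N. tent N r) = (\<Sum>r<N. (real r + 1)) + (\<Sum>r<N. real (N - Suc r))"
    unfolding sum_double_split
    by (intro arg_cong2[of _ _ _ _ "(+)"] sum.cong) (auto simp: tent_def of_nat_diff algebra_simps)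
  also have "(\<Sum>r<N. real (N - Suc r)) = (\<Sum>r<N. real r)" by (rule sum.nat_diff_reindex)
  also have "(\<Sum>r<N. (real r + 1)) + (\<Sum>r<N. real r) = (real N)\<^sup>2"
    by (induction N) (simp_all add: power2_eq_square algebra_simps)
  finally show ?thesis .
qed

text \<open>Determines the variance of a block sum: (h / N)^3 times this value is h^3 (2 / 3 + 1 /
  (3 N^2)), whose limit is 2 h^3 / 3.\<close>

lemma sum_tent_squares: "(\<Sum>r<2 * N. (tent N r)\<^sup>2) = real N * (2 * (real N)\<^sup>2 + 1) / 3"
proof -
  have "(\<Sum>r<2 * N. (tent N r)\<^sup>2) = (\<Sum>r<N. (real r + 1)\<^sup>2) + (\<Sum>r<N. (real (N - Suc r))\<^sup>2)"
    unfolding sum_double_split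
    by (intro arg_cong2[of _ _ _ _ "(+)"] sum.cong) (auto simp: tent_def of_nat_diff algebra_simps)
  also have "(\<Sum>r<N. (real (N - Suc r))\<^sup>2) = (\<Sum>r<N. (real r)\<^sup>2)"
    by (rule sum.nat_diff_reindex[of "\<lambda>r. (real r)\<^sup>2"])
  also have "(\<Sum>r<N. (real r + 1)\<^sup>2) + (\<Sum>r<N. (real r)\<^sup>2) = real N * (2 * (real N)\<^sup>2 + 1) / 3"
    by (induction N) (simp_all add: power2_eq_square field_simps)
  finally show ?thesis .
qed

section \<open>Brownian increments on a grid\<close>

locale brownian_motion = prob_space M for M :: "'w measure" +
  fixes W :: "real \<Rightarrow> 'w \<Rightarrow> real^'d"
  assumes bm: "standard_brownian_motion M W"
begin

lemma W_measurable [measurable]: "0 \<le> t \<Longrightarrow> W t \<in> borel_measurable M"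
  using bm by (simp add: standard_brownian_motion_def)

lemma AE_continuous: "AE \<omega> in M. W 0 \<omega> = 0 \<and> continuous_on {0..} (\<lambda>t. W t \<omega>)"
  using bm by (simp add: standard_brownian_motion_def)

lemma increment_char:
  assumes "0 \<le> s" "s < t"
  shows "(\<integral>\<omega>. iexp (u \<bullet> (W t \<omega> - W s \<omega>)) \<partial>M) = of_real (exp (- ((t - s) * (u \<bullet> u) / 2)))"
proof -
  have dist: "distributed M lborel (\<lambda>\<omega>. (W t \<omega> - W s \<omega>) $ i) (normal_density 0 (sqrt (t - s)))" for i
    using bm assms by (simp add: standard_brownian_motion_def)
  have ind: "indep_vars (\<lambda>_. borel) (\<lambda>i \<omega>. (W t \<omega> - W s \<omega>) $ i) UNIV"
    using bm assms by (simp add: standard_brownian_motion_def)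
  have 1: "(\<integral>\<omega>. iexp (a * (W t \<omega> - W s \<omega>) $ i) \<partial>M) = of_real (exp (- ((t - s) * a\<^sup>2 / 2)))" for a i
    using distributed_normal_iexp[OF prob_space_axioms dist, of a i] assms by (simp add: mult.commute)
  have ind': "indep_vars (\<lambda>_. borel) (\<lambda>i \<omega>. iexp (u $ i * (W t \<omega> - W s \<omega>) $ i)) UNIV"
    by (rule indep_vars_compose2[OF ind]) simp
  have "(\<integral>\<omega>. iexp (u \<bullet> (W t \<omega> - W s \<omega>)) \<partial>M) = (\<integral>\<omega>. (\<Prod>i\<in>UNIV. iexp (u $ i * (W t \<omega> - W s \<omega>) $ i)) \<partial>M)"
    by (simp add: inner_vec_def exp_sum[symmetric] sum_distrib_left)
  also have "\<dots> = (\<Prod>i\<in>UNIV. \<integral>\<omega>. iexp (u $ i * (W t \<omega> - W s \<omega>) $ i) \<partial>M)"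
  proof (rule indep_vars_lebesgue_integral[OF finite ind'])
    show "integrable M (\<lambda>\<omega>. iexp (u $ i * (W t \<omega> - W s \<omega>) $ i))" for i
    proof (rule integrable_const_bound[of _ 1])
      have "(\<lambda>\<omega>. (W t \<omega> - W s \<omega>) $ i) \<in> borel_measurable M"
        using ind by (auto simp: indep_vars_def)
      from measurable_compose[OF this, of "\<lambda>x. iexp (u $ i * x)" borel]
      show "(\<lambda>\<omega>. iexp (u $ i * (W t \<omega> - W s \<omega>) $ i)) \<in> borel_measurable M" by simp
    qed simp
  qed
  also have "\<dots> = of_real (\<Prod>i\<in>UNIV. exp (- ((t - s) * (u $ i)\<^sup>2 / 2)))"
    unfolding 1 by simp
  also have "(\<Prod>i\<in>UNIV. exp (- ((t - s) * (u $ i)\<^sup>2 / 2))) = exp (- ((t - s) * (u \<bullet> u) / 2))"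
    by (simp add: exp_sum[symmetric] inner_vec_def power2_eq_square sum_negf sum_divide_distrib sum_distrib_left)
  finally show ?thesis .
qed

text \<open>The grid starts at time h because the blocks, numbered from zero, are the intervals
  [(2 p + 1) h, (2 p + 3) h]; each of them holds 2 N steps.\<close>

definition grid_step :: "real \<Rightarrow> nat \<Rightarrow> nat \<Rightarrow> 'w \<Rightarrow> real^'d" where
  "grid_step h N j \<omega> = W (h + real (Suc j) * (h / N)) \<omega> - W (h + real j * (h / N)) \<omega>"

lemma grid_step_measurable [measurable]: "0 \<le> h \<Longrightarrow> grid_step h N j \<in> borel_measurable M"
  unfolding grid_step_def[abs_def] by (intro borel_measurable_diff W_measurable) auto

lemma grid_step_indep:
  assumes "0 < h" "0 < N"
  shows "indep_vars (\<lambda>_. borel) (grid_step h N) {..<K}"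
proof -
  have "indep_vars (\<lambda>_. borel) (\<lambda>k \<omega>. W (h + real (Suc k) * (h / N)) \<omega> - W (h + real k * (h / N)) \<omega>) {..<K}"
    using bm[unfolded standard_brownian_motion_def, THEN conjunct2, THEN conjunct2, THEN conjunct2, THEN conjunct2,
        rule_format, of "\<lambda>k. h + real k * (h / N)" K] assms
    by (simp add: strict_mono_on_def divide_strict_right_mono)
  then show ?thesis by (simp add: grid_step_def[abs_def])
qed

lemma grid_char:
  assumes "0 < h" "0 < N"
  shows "(\<integral>\<omega>. iexp (\<Sum>j<K. a j \<bullet> grid_step h N j \<omega>) \<partial>M)
    = of_real (exp (- (h / N * (\<Sum>j<K. a j \<bullet> a j) / 2)))"
proof -
  have m: "h + real j * (h / N) < h + real (Suc j) * (h / N)" for j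
    using assms by (intro add_strict_left_mono mult_strict_right_mono) auto
  have ind: "indep_vars (\<lambda>_. borel) (\<lambda>j \<omega>. iexp (a j \<bullet> grid_step h N j \<omega>)) {..<K}"
    by (rule indep_vars_compose2[OF grid_step_indep[OF assms]]) simp
  have "(\<integral>\<omega>. iexp (\<Sum>j<K. a j \<bullet> grid_step h N j \<omega>) \<partial>M) = (\<integral>\<omega>. (\<Prod>j<K. iexp (a j \<bullet> grid_step h N j \<omega>)) \<partial>M)"
    by (simp add: exp_sum[symmetric] sum_distrib_left)
  also have "\<dots> = (\<Prod>j<K. \<integral>\<omega>. iexp (a j \<bullet> grid_step h N j \<omega>) \<partial>M)"
  proof (rule indep_vars_lebesgue_integral[OF _ ind])
    show "integrable M (\<lambda>\<omega>. iexp (a j \<bullet> grid_step h N j \<omega>))" for j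
      by (rule integrable_const_bound[of _ 1]) (use assms in auto)
  qed simp
  also have "\<dots> = (\<Prod>j<K. of_real (exp (- (h / N * (a j \<bullet> a j) / 2))))"
  proof (rule prod.cong[OF refl])
    fix j
    have "h + real (Suc j) * (h / N) - (h + real j * (h / N)) = h / N"
      by (simp add: algebra_simps add_divide_distrib)
    then show "(\<integral>\<omega>. iexp (a j \<bullet> grid_step h N j \<omega>) \<partial>M) = of_real (exp (- (h / N * (a j \<bullet> a j) / 2)))"
      using increment_char[OF _ m[of j], of "a j"] assms unfolding grid_step_def by simp
  qed
  also have "\<dots> = of_real (exp (\<Sum>j<K. - (h / N * (a j \<bullet> a j) / 2)))"
    by (simp add: exp_sum)
  also have "(\<Sum>j<K. - (h / N * (a j \<bullet> a j) / 2)) = - (h / N * (\<Sum>j<K. a j \<bullet> a j) / 2)"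
    by (simp add: sum_negf sum_divide_distrib sum_distrib_left)
  finally show ?thesis .
qed

end

lemma sum_blocks:
  fixes f :: "nat \<Rightarrow> 'a::comm_monoid_add"
  shows "(\<Sum>j<m * k. f j) = (\<Sum>p<m. \<Sum>r<k. f (p * k + r))"
proof -
  have "(\<Sum>j<m * k. f j) = (\<Sum>p<m. \<Sum>j=p * k..<p * k + k. f j)"
    by (rule sum.nat_group[symmetric])
  also have "\<dots> = (\<Sum>p<m. \<Sum>r<k. f (p * k + r))"
  proof (rule sum.cong[OF refl])
    fix p
    show "(\<Sum>j=p * k..<p * k + k. f j) = (\<Sum>r<k. f (p * k + r))"
      using sum.shift_bounds_nat_ivl[of f 0 "p * k" k] by (simp add: lessThan_atLeast0 add.commute)
  qed
  finally show ?thesis .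
qed

section \<open>Second differences of integrated Brownian motion\<close>

context brownian_motion
begin

text \<open>The difference of the Riemann sums of W over the two halves of a block, written through
  independent increments so that its law can be read off; \<open>block_sum_eq\<close> recovers the
  Riemann sums.\<close>

definition block_sum :: "real \<Rightarrow> nat \<Rightarrow> nat \<Rightarrow> 'w \<Rightarrow> real^'d" where
  "block_sum h N p \<omega> = (h / N) *\<^sub>R (\<Sum>r<2 * N. tent N r *\<^sub>R grid_step h N (p * (2 * N) + r) \<omega>)"

definition block_increment :: "real \<Rightarrow> nat \<Rightarrow> 'w \<Rightarrow> real^'d" where
  "block_increment h p \<omega> = W ((2 * real p + 3) * h) \<omega> - W ((2 * real p + 1) * h) \<omega>"

text \<open>The second difference of the integral of \<open>W\<close> over the \<open>p\<close>-th block. It is defined as a limit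
  of Riemann sums because \<open>M\<close> need not be complete, so that the integral itself might fail to be measurable.\<close>

definition block_diff :: "real \<Rightarrow> nat \<Rightarrow> 'w \<Rightarrow> real^'d" where
  "block_diff h p \<omega> = lim (\<lambda>N. block_sum h (Suc N) p \<omega>)"

lemma block_measurable [measurable]:
  assumes "0 \<le> h"
  shows "block_sum h N p \<in> borel_measurable M" "block_increment h p \<in> borel_measurable M"
    "block_diff h p \<in> borel_measurable M"
proof -
  show 1: "block_sum h N p \<in> borel_measurable M" for N
    unfolding block_sum_def[abs_def]
    by (intro borel_measurable_scaleR borel_measurable_sum borel_measurable_const grid_step_measurable assms)
  show "block_increment h p \<in> borel_measurable M"
    unfolding block_increment_def[abs_def] using assms by (intro borel_measurable_diff W_measurable) auto
  show "block_diff h p \<in> borel_measurable M"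
    unfolding block_diff_def[abs_def] by (rule borel_measurable_lim_metric[OF 1])
qed

lemma block_sum_eq:
  assumes "0 < N"
  shows "block_sum h N p \<omega> = (h / N) *\<^sub>R (\<Sum>k<N. W ((2 * real p + 2) * h + real k * (h / N)) \<omega>)
    - (h / N) *\<^sub>R (\<Sum>k<N. W ((2 * real p + 1) * h + real k * (h / N)) \<omega>)"
proof -
  define f where "f r = W (h + real (p * (2 * N) + r) * (h / N)) \<omega>" for r
  have "block_sum h N p \<omega> = (h / N) *\<^sub>R (\<Sum>r<2 * N. tent N r *\<^sub>R (f (Suc r) - f r))"
    by (simp add: block_sum_def grid_step_def f_def)
  also have "\<dots> = (h / N) *\<^sub>R (\<Sum>k<N. f (N + k) - f k)"
    by (simp only: sum_tent_increments)
  also have "\<dots> = (h / N) *\<^sub>R (\<Sum>k<N. f (N + k)) - (h / N) *\<^sub>R (\<Sum>k<N. f k)"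
    by (simp add: sum_subtractf scaleR_diff_right)
  finally have "block_sum h N p \<omega> = (h / N) *\<^sub>R (\<Sum>k<N. f (N + k)) - (h / N) *\<^sub>R (\<Sum>k<N. f k)" .
  moreover have "f (N + k) = W ((2 * real p + 2) * h + real k * (h / N)) \<omega>" for k
    using assms by (simp add: f_def field_simps)
  moreover have "f k = W ((2 * real p + 1) * h + real k * (h / N)) \<omega>" for k
    using assms by (simp add: f_def field_simps)
  ultimately show ?thesis by (simp only:)
qed

lemma block_increment_eq:
  assumes "0 < N"
  shows "block_increment h p \<omega> = (\<Sum>r<2 * N. grid_step h N (p * (2 * N) + r) \<omega>)"
proof -
  define f where "f r = W (h + real (p * (2 * N) + r) * (h / N)) \<omega>" for r
  have "(\<Sum>r<2 * N. grid_step h N (p * (2 * N) + r) \<omega>) = (\<Sum>r<2 * N. f (Suc r) - f r)"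
    by (simp add: grid_step_def f_def)
  also have "\<dots> = f (2 * N) - f 0" by (rule sum_lessThan_telescope)
  also have "h + real (p * (2 * N) + 2 * N) * (h / N) = (2 * real p + 3) * h"
    "h + real (p * (2 * N) + 0) * (h / N) = (2 * real p + 1) * h"
    using assms by (simp_all add: field_simps)
  then have "f (2 * N) - f 0 = block_increment h p \<omega>"
    unfolding f_def block_increment_def by simp
  finally show ?thesis by simp
qed

lemma AE_block_diff:
  assumes "0 < h"
  shows "AE \<omega> in M. \<forall>p. (\<lambda>N. block_sum h (Suc N) p \<omega>) \<longlonglongrightarrow> block_diff h p \<omega> \<and>
    block_diff h p \<omega> = integral {(2 * real p + 2) * h..(2 * real p + 3) * h} (\<lambda>t. W t \<omega>)
      - integral {(2 * real p + 1) * h..(2 * real p + 2) * h} (\<lambda>t. W t \<omega>)"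
  using AE_continuous
proof eventually_elim
  case (elim \<omega>)
  show ?case
  proof
    fix p :: nat
    let ?I = "integral {(2 * real p + 2) * h..(2 * real p + 3) * h} (\<lambda>t. W t \<omega>)
      - integral {(2 * real p + 1) * h..(2 * real p + 2) * h} (\<lambda>t. W t \<omega>)"
    have e: "(2 * real p + 2) * h + h = (2 * real p + 3) * h" "(2 * real p + 1) * h + h = (2 * real p + 2) * h"
      by (simp_all add: algebra_simps)
    have c: "continuous_on {(2 * real p + c) * h..(2 * real p + c) * h + h} (\<lambda>t. W t \<omega>)" if "0 \<le> c" for c
    proof (rule continuous_on_subset[OF conjunct2[OF elim]])
      have "0 \<le> (2 * real p + c) * h" using assms that by simp
      then show "{(2 * real p + c) * h..(2 * real p + c) * h + h} \<subseteq> {0..}" by auto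
    qed
    have "(\<lambda>N. block_sum h (Suc N) p \<omega>) \<longlonglongrightarrow> ?I"
      unfolding block_sum_eq[OF zero_less_Suc]
      using tendsto_diff[OF riemann_sum_tendsto_integral[OF c[of 2] assms]
          riemann_sum_tendsto_integral[OF c[of 1] assms]]
      unfolding e by simp
    then show "(\<lambda>N. block_sum h (Suc N) p \<omega>) \<longlonglongrightarrow> block_diff h p \<omega> \<and> block_diff h p \<omega> = ?I"
      using limI by (fastforce simp: block_diff_def)
  qed
qed

text \<open>The exponent is linear in the grid steps: step r of block p has the coefficient (h / N)
  \<open>tent N r\<close> times l p, plus \<mu> p. The quadratic form is the sum of the squared
  coefficients, evaluated by the sums of \<open>tent\<close> and of its squares.\<close>

lemma block_sum_char:
  assumes h: "0 < h" and N: "0 < N"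
  shows "(\<integral>\<omega>. iexp (\<Sum>p<m. l p \<bullet> block_sum h N p \<omega> + \<mu> p \<bullet> block_increment h p \<omega>) \<partial>M)
    = of_real (exp (- ((\<Sum>p<m. h ^ 3 * (2 / 3 + (1 / 3) * (1 / N)\<^sup>2) * (l p \<bullet> l p) + 2 * h\<^sup>2 * (l p \<bullet> \<mu> p)
        + 2 * h * (\<mu> p \<bullet> \<mu> p)) / 2)))"
proof -
  define b where "b p r = (h / N * tent N r) *\<^sub>R l p + \<mu> p" for p r
  \<comment> \<open>Quotient and remainder by 2 N decode the flat grid index into block number and
    position within the block.\<close>
  define a where "a j = b (j div (2 * N)) (j mod (2 * N))" for j
  have a: "a (p * (2 * N) + r) = b p r" if "r < 2 * N" for p r
    using that by (simp add: a_def)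
  have "l p \<bullet> block_sum h N p \<omega> + \<mu> p \<bullet> block_increment h p \<omega>
      = (\<Sum>r<2 * N. a (p * (2 * N) + r) \<bullet> grid_step h N (p * (2 * N) + r) \<omega>)" for p \<omega>
  proof -
    have "(\<Sum>r<2 * N. a (p * (2 * N) + r) \<bullet> grid_step h N (p * (2 * N) + r) \<omega>)
        = (\<Sum>r<2 * N. h / N * (tent N r * (l p \<bullet> grid_step h N (p * (2 * N) + r) \<omega>))
            + \<mu> p \<bullet> grid_step h N (p * (2 * N) + r) \<omega>)"
      by (rule sum.cong[OF refl], subst a) (auto simp: b_def inner_add_left)
    also have "\<dots> = l p \<bullet> block_sum h N p \<omega> + \<mu> p \<bullet> block_increment h p \<omega>"
      unfolding block_sum_def block_increment_eq[OF N] sum.distrib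
      by (simp add: inner_sum_right sum_distrib_left)
    finally show ?thesis by simp
  qed
  then have "(\<integral>\<omega>. iexp (\<Sum>p<m. l p \<bullet> block_sum h N p \<omega> + \<mu> p \<bullet> block_increment h p \<omega>) \<partial>M)
      = (\<integral>\<omega>. iexp (\<Sum>j<m * (2 * N). a j \<bullet> grid_step h N j \<omega>) \<partial>M)"
    by (simp only: sum_blocks)
  also have "\<dots> = of_real (exp (- (h / N * (\<Sum>j<m * (2 * N). a j \<bullet> a j) / 2)))"
    by (rule grid_char[OF h N])
  also have "h / N * (\<Sum>j<m * (2 * N). a j \<bullet> a j)
      = (\<Sum>p<m. h ^ 3 * (2 / 3 + (1 / 3) * (1 / N)\<^sup>2) * (l p \<bullet> l p) + 2 * h\<^sup>2 * (l p \<bullet> \<mu> p) + 2 * h * (\<mu> p \<bullet> \<mu> p))"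
    unfolding sum_blocks[of _ m "2 * N"] sum_distrib_left[of _ _ "{..<m}"]
  proof (rule sum.cong[OF refl])
    fix p
    have "(\<Sum>r<2 * N. a (p * (2 * N) + r) \<bullet> a (p * (2 * N) + r))
      = (\<Sum>r<2 * N. (h / N)\<^sup>2 * (l p \<bullet> l p) * (tent N r)\<^sup>2 + 2 * (h / N) * (l p \<bullet> \<mu> p) * tent N r + \<mu> p \<bullet> \<mu> p)"
    proof (rule sum.cong[OF refl])
      fix r assume "r \<in> {..<2 * N}"
      then have "a (p * (2 * N) + r) = (h / N * tent N r) *\<^sub>R l p + \<mu> p" by (simp add: a b_def)
      then show "a (p * (2 * N) + r) \<bullet> a (p * (2 * N) + r)
          = (h / N)\<^sup>2 * (l p \<bullet> l p) * (tent N r)\<^sup>2 + 2 * (h / N) * (l p \<bullet> \<mu> p) * tent N r + \<mu> p \<bullet> \<mu> p"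
        using N by (simp add: inner_add_left inner_add_right power2_eq_square inner_commute[of "\<mu> p" "l p"] field_simps)
    qed
    also have "\<dots> = (h / N)\<^sup>2 * (l p \<bullet> l p) * (real N * (2 * (real N)\<^sup>2 + 1) / 3)
        + 2 * (h / N) * (l p \<bullet> \<mu> p) * (real N)\<^sup>2 + 2 * real N * (\<mu> p \<bullet> \<mu> p)"
      by (simp only: sum.distrib sum_distrib_left[symmetric] sum_tent sum_tent_squares) simp
    finally have *: "(\<Sum>r<2 * N. a (p * (2 * N) + r) \<bullet> a (p * (2 * N) + r)) = \<dots>" .
    show "h / N * (\<Sum>r<2 * N. a (p * (2 * N) + r) \<bullet> a (p * (2 * N) + r))
        = h ^ 3 * (2 / 3 + (1 / 3) * (1 / N)\<^sup>2) * (l p \<bullet> l p) + 2 * h\<^sup>2 * (l p \<bullet> \<mu> p) + 2 * h * (\<mu> p \<bullet> \<mu> p)"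
      unfolding * using N
      by (simp add: power2_eq_square power3_eq_cube field_simps)
  qed
  finally show ?thesis .
qed

text \<open>Dominated convergence in N. Only the correction 1 / (3 N^2) to the variance disappears;
  the cross term and the increment term are already exact for finite N.\<close>

lemma block_diff_char:
  assumes h: "0 < h"
  shows "(\<integral>\<omega>. iexp (\<Sum>p<m. l p \<bullet> block_diff h p \<omega> + \<mu> p \<bullet> block_increment h p \<omega>) \<partial>M)
    = of_real (exp (- ((\<Sum>p<m. h ^ 3 * (2 / 3) * (l p \<bullet> l p) + 2 * h\<^sup>2 * (l p \<bullet> \<mu> p)
        + 2 * h * (\<mu> p \<bullet> \<mu> p)) / 2)))" (is "_ = ?R")
proof -
  have [measurable]: "block_sum h N p \<in> borel_measurable M" "block_increment h p \<in> borel_measurable M"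
    "block_diff h p \<in> borel_measurable M" for N p using h by auto
  have "(\<lambda>N. \<integral>\<omega>. iexp (\<Sum>p<m. l p \<bullet> block_sum h (Suc N) p \<omega> + \<mu> p \<bullet> block_increment h p \<omega>) \<partial>M)
    \<longlonglongrightarrow> (\<integral>\<omega>. iexp (\<Sum>p<m. l p \<bullet> block_diff h p \<omega> + \<mu> p \<bullet> block_increment h p \<omega>) \<partial>M)"
  proof (rule integral_dominated_convergence[where w = "\<lambda>_. 1"])
    show "AE \<omega> in M. (\<lambda>N. iexp (\<Sum>p<m. l p \<bullet> block_sum h (Suc N) p \<omega> + \<mu> p \<bullet> block_increment h p \<omega>))
        \<longlonglongrightarrow> iexp (\<Sum>p<m. l p \<bullet> block_diff h p \<omega> + \<mu> p \<bullet> block_increment h p \<omega>)"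
      using AE_block_diff[OF h] by eventually_elim (intro tendsto_intros, blast)
  qed auto
  moreover have "(\<lambda>N. \<integral>\<omega>. iexp (\<Sum>p<m. l p \<bullet> block_sum h (Suc N) p \<omega> + \<mu> p \<bullet> block_increment h p \<omega>) \<partial>M) \<longlonglongrightarrow> ?R"
  proof -
    have "(\<lambda>N. 1 / real (Suc N)) \<longlonglongrightarrow> 0" by (rule lim_1_over_n[THEN LIMSEQ_Suc])
    from tendsto_power[OF this, of 2] have "(\<lambda>N. 2 / 3 + (1 / 3) * (1 / real (Suc N))\<^sup>2) \<longlonglongrightarrow> 2 / 3 + (1 / 3) * 0\<^sup>2"
      by (intro tendsto_add tendsto_mult[OF tendsto_const] tendsto_const)
    then have "(\<lambda>N. 2 / 3 + (1 / 3) * (1 / real (Suc N))\<^sup>2) \<longlonglongrightarrow> 2 / 3" by simp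
    then show ?thesis
      unfolding block_sum_char[OF h zero_less_Suc] by (intro tendsto_intros) auto
  qed
  ultimately show ?thesis by (rule LIMSEQ_unique)
qed

text \<open>The constants normalise the coordinates to unit variance; coordinates of \<open>xi\<close> and \<open>eta\<close> in the same
  block and direction then have correlation \<open>sqrt 3 / 2\<close>.\<close>

definition xi :: "real \<Rightarrow> nat \<Rightarrow> 'w \<Rightarrow> real^'d" where
  "xi h p \<omega> = sqrt (3 / (2 * h ^ 3)) *\<^sub>R block_diff h p \<omega>"

definition eta :: "real \<Rightarrow> nat \<Rightarrow> 'w \<Rightarrow> real^'d" where
  "eta h p \<omega> = (1 / sqrt (2 * h)) *\<^sub>R block_increment h p \<omega>"

lemma xi_eta_measurable [measurable]:
  assumes "0 \<le> h"
  shows "xi h p \<in> borel_measurable M" "eta h p \<in> borel_measurable M"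
  unfolding xi_def[abs_def] eta_def[abs_def]
  by (intro borel_measurable_scaleR borel_measurable_const block_measurable assms)+

text \<open>The index \<open>(b, p, k)\<close> refers to the \<open>k\<close>-th coordinate of \<open>xi h p\<close> if \<open>b\<close> holds and of \<open>eta h p\<close> otherwise.\<close>

definition block_var :: "real \<Rightarrow> bool \<times> nat \<times> 'd \<Rightarrow> 'w \<Rightarrow> real" where
  "block_var h = (\<lambda>(b, p, k) \<omega>. (if b then xi h p \<omega> else eta h p \<omega>) $ k)"

text \<open>The value sqrt 3 / 2 is the covariance h^2 divided by the standard deviations sqrt (2
  h^3 / 3) and sqrt (2 h).\<close>

definition block_cov :: "bool \<times> nat \<times> 'd \<Rightarrow> bool \<times> nat \<times> 'd \<Rightarrow> real" where
  "block_cov = (\<lambda>(b, p, k) (b', p', k'). of_bool (p = p') * of_bool (k = k') * (if b = b' then 1 else sqrt 3 / 2))"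

lemma block_gaussian:
  assumes h: "0 < h"
  shows "gaussian_family M (UNIV \<times> {..<m} \<times> UNIV) block_cov (block_var h)"
  unfolding gaussian_family_def
proof (intro conjI allI)
  show "finite ((UNIV::bool set) \<times> {..<m} \<times> (UNIV::'d set))" by simp
  show "block_cov i j = block_cov j i" for i j :: "bool \<times> nat \<times> 'd"
    by (cases i; cases j) (auto simp: block_cov_def)
  fix u :: "bool \<times> nat \<times> 'd \<Rightarrow> real"
  let ?J = "(UNIV::bool set) \<times> {..<m} \<times> (UNIV::'d set)"
  define v1 v2 where "v1 p = (\<chi> k. u (True, p, k))" and "v2 p = (\<chi> k. u (False, p, k))" for p
  have split: "(\<Sum>i\<in>?J. g i) = (\<Sum>p<m. \<Sum>k\<in>UNIV. g (True, p, k) + g (False, p, k))" for g :: "_ \<Rightarrow> real"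
    by (simp add: sum.cartesian_product' UNIV_bool sum.distrib add.commute)
  have lin: "(\<Sum>i\<in>?J. u i * block_var h i \<omega>) = (\<Sum>p<m. v1 p \<bullet> xi h p \<omega> + v2 p \<bullet> eta h p \<omega>)" for \<omega>
    unfolding split by (simp add: block_var_def v1_def v2_def inner_vec_def sum.distrib)
  \<comment> \<open>A row of the covariance has only two nonzero entries: the index itself and the
    one with the other Boolean.\<close>
  have inner: "(\<Sum>j\<in>?J. u i * u j * block_cov i j) = u i * (u i + sqrt 3 / 2 * u (\<not> fst i, snd i))"
    if "i \<in> ?J" for i
  proof -
    obtain b p k where i: "i = (b, p, k)" by (cases i) auto
    have p: "p < m" using that i by auto
    define c where "c = u i * (u i + sqrt 3 / 2 * u (\<not> b, p, k))"
    have c: "u i * u (True, q, k') * block_cov i (True, q, k') + u i * u (False, q, k') * block_cov i (False, q, k')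
        = (if p = q then if k = k' then c else 0 else 0)" for q k'
      by (cases b; cases "p = q"; cases "k = k'") (simp_all add: c_def i block_cov_def algebra_simps)
    have "(\<Sum>j\<in>?J. u i * u j * block_cov i j) = (\<Sum>q<m. if p = q then c else 0)"
      unfolding split c
    proof (rule sum.cong[OF refl])
      fix q
      show "(\<Sum>k'\<in>UNIV. if p = q then if k = k' then c else 0 else 0) = (if p = q then c else 0)"
        by (cases "p = q") simp_all
    qed
    then show ?thesis using p by (simp add: i c_def)
  qed
  have var: "(\<Sum>i\<in>?J. \<Sum>j\<in>?J. u i * u j * block_cov i j)
      = (\<Sum>p<m. v1 p \<bullet> v1 p + sqrt 3 * (v1 p \<bullet> v2 p) + v2 p \<bullet> v2 p)"
  proof -
    have "(\<Sum>i\<in>?J. \<Sum>j\<in>?J. u i * u j * block_cov i j) = (\<Sum>i\<in>?J. u i * (u i + sqrt 3 / 2 * u (\<not> fst i, snd i)))"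
      by (rule sum.cong[OF refl inner])
    also have "\<dots> = (\<Sum>p<m. v1 p \<bullet> v1 p + sqrt 3 * (v1 p \<bullet> v2 p) + v2 p \<bullet> v2 p)"
      unfolding split
      by (simp add: v1_def v2_def inner_vec_def sum.distrib[symmetric] sum_distrib_left algebra_simps)
    finally show ?thesis .
  qed
  show "centered_gaussian M (\<Sum>i\<in>?J. \<Sum>j\<in>?J. u i * u j * block_cov i j) (\<lambda>\<omega>. \<Sum>i\<in>?J. u i * block_var h i \<omega>)"
    unfolding var lin
  proof (rule centered_gaussianI)
    show "prob_space M" by (rule prob_space_axioms)
    show "(\<lambda>\<omega>. \<Sum>p<m. v1 p \<bullet> xi h p \<omega> + v2 p \<bullet> eta h p \<omega>) \<in> borel_measurable M"
      using h by (intro borel_measurable_sum borel_measurable_add borel_measurable_inner xi_eta_measurable) auto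
    show "0 \<le> (\<Sum>p<m. v1 p \<bullet> v1 p + sqrt 3 * (v1 p \<bullet> v2 p) + v2 p \<bullet> v2 p)"
    proof (rule sum_nonneg)
      fix p
      \<comment> \<open>Completing the square; the factor 1 / 4 is 1 - (sqrt 3 / 2)^2, the part of
        the variance that the correlation leaves over.\<close>
      have "v1 p \<bullet> v1 p + sqrt 3 * (v1 p \<bullet> v2 p) + v2 p \<bullet> v2 p
        = (v1 p + (sqrt 3 / 2) *\<^sub>R v2 p) \<bullet> (v1 p + (sqrt 3 / 2) *\<^sub>R v2 p) + (1 / 4) * (v2 p \<bullet> v2 p)"
      proof -
        have "(v1 p + c *\<^sub>R v2 p) \<bullet> (v1 p + c *\<^sub>R v2 p) = v1 p \<bullet> v1 p + 2 * c * (v1 p \<bullet> v2 p) + c\<^sup>2 * (v2 p \<bullet> v2 p)" for c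
          by (simp add: inner_add_left inner_add_right inner_commute[of "v2 p" "v1 p"] power2_eq_square algebra_simps)
        then show ?thesis by (simp add: power_divide)
      qed
      also have "0 \<le> \<dots>" by (intro add_nonneg_nonneg mult_nonneg_nonneg inner_ge_zero) simp
      finally show "0 \<le> v1 p \<bullet> v1 p + sqrt 3 * (v1 p \<bullet> v2 p) + v2 p \<bullet> v2 p" .
    qed
    fix t
    \<comment> \<open>The normalising factors of \<open>xi\<close> and \<open>eta\<close>. The
      identity 2 h^2 \<alpha> \<beta> = sqrt 3 produces the cross coefficient of the quadratic
      form.\<close>
    define \<alpha> \<beta> where "\<alpha> = sqrt (3 / (2 * h ^ 3))" and "\<beta> = 1 / sqrt (2 * h)"
    have \<alpha>\<beta>: "\<alpha>\<^sup>2 = 3 / (2 * h ^ 3)" "\<beta>\<^sup>2 = 1 / (2 * h)" "2 * h\<^sup>2 * (\<alpha> * \<beta>) = sqrt 3"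
    proof -
      show "\<alpha>\<^sup>2 = 3 / (2 * h ^ 3)" "\<beta>\<^sup>2 = 1 / (2 * h)" using h by (simp_all add: \<alpha>_def \<beta>_def power_divide)
      have "\<alpha> * \<beta> = sqrt (3 / (2 * h ^ 3) * (1 / (2 * h)))"
        by (simp add: \<alpha>_def \<beta>_def real_sqrt_mult real_sqrt_divide)
      also have "3 / (2 * h ^ 3) * (1 / (2 * h)) = 3 / (2 * h\<^sup>2)\<^sup>2"
        by (simp add: power2_eq_square power3_eq_cube)
      also have "sqrt (3 / (2 * h\<^sup>2)\<^sup>2) = sqrt 3 / (2 * h\<^sup>2)"
        unfolding real_sqrt_divide real_sqrt_abs by simp
      finally show "2 * h\<^sup>2 * (\<alpha> * \<beta>) = sqrt 3" using h by simp
    qed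
    have "(\<integral>\<omega>. iexp (t * (\<Sum>p<m. v1 p \<bullet> xi h p \<omega> + v2 p \<bullet> eta h p \<omega>)) \<partial>M)
        = (\<integral>\<omega>. iexp (\<Sum>p<m. ((t * \<alpha>) *\<^sub>R v1 p) \<bullet> block_diff h p \<omega> + ((t * \<beta>) *\<^sub>R v2 p) \<bullet> block_increment h p \<omega>) \<partial>M)"
    proof -
      have "xi h p \<omega> = \<alpha> *\<^sub>R block_diff h p \<omega>" "eta h p \<omega> = \<beta> *\<^sub>R block_increment h p \<omega>" for p \<omega>
        by (simp_all add: xi_def eta_def \<alpha>_def \<beta>_def)
      then show ?thesis by (simp add: sum_distrib_left algebra_simps)
    qed
    also have "\<dots> = of_real (exp (- ((\<Sum>p<m. t\<^sup>2 * (v1 p \<bullet> v1 p + sqrt 3 * (v1 p \<bullet> v2 p) + v2 p \<bullet> v2 p)) / 2)))"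
      unfolding block_diff_char[OF h]
    proof (rule arg_cong[where f = "\<lambda>x. of_real (exp (- (x / 2)))"], rule sum.cong[OF refl])
      fix p
      have "h ^ 3 * (2 / 3) * (((t * \<alpha>) *\<^sub>R v1 p) \<bullet> ((t * \<alpha>) *\<^sub>R v1 p))
          + 2 * h\<^sup>2 * (((t * \<alpha>) *\<^sub>R v1 p) \<bullet> ((t * \<beta>) *\<^sub>R v2 p)) + 2 * h * (((t * \<beta>) *\<^sub>R v2 p) \<bullet> ((t * \<beta>) *\<^sub>R v2 p))
        = t\<^sup>2 * ((h ^ 3 * (2 / 3) * \<alpha>\<^sup>2) * (v1 p \<bullet> v1 p) + (2 * h\<^sup>2 * (\<alpha> * \<beta>)) * (v1 p \<bullet> v2 p)
            + (2 * h * \<beta>\<^sup>2) * (v2 p \<bullet> v2 p))"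
        by (simp add: power2_eq_square algebra_simps)
      also have "\<dots> = t\<^sup>2 * (v1 p \<bullet> v1 p + sqrt 3 * (v1 p \<bullet> v2 p) + v2 p \<bullet> v2 p)"
        unfolding \<alpha>\<beta> using h by simp
      finally show "h ^ 3 * (2 / 3) * (((t * \<alpha>) *\<^sub>R v1 p) \<bullet> ((t * \<alpha>) *\<^sub>R v1 p))
          + 2 * h\<^sup>2 * (((t * \<alpha>) *\<^sub>R v1 p) \<bullet> ((t * \<beta>) *\<^sub>R v2 p)) + 2 * h * (((t * \<beta>) *\<^sub>R v2 p) \<bullet> ((t * \<beta>) *\<^sub>R v2 p))
        = t\<^sup>2 * (v1 p \<bullet> v1 p + sqrt 3 * (v1 p \<bullet> v2 p) + v2 p \<bullet> v2 p)" .
    qed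
    finally show "(\<integral>\<omega>. iexp (t * (\<Sum>p<m. v1 p \<bullet> xi h p \<omega> + v2 p \<bullet> eta h p \<omega>)) \<partial>M)
        = of_real (exp (- (t\<^sup>2 * (\<Sum>p<m. v1 p \<bullet> v1 p + sqrt 3 * (v1 p \<bullet> v2 p) + v2 p \<bullet> v2 p) / 2)))"
      by (simp only: sum_distrib_left)
  qed
qed

text \<open>Different blocks read disjoint sets of grid steps, and disjoint groups of independent
  variables are independent.\<close>

lemma block_sum_indep:
  assumes h: "0 < h" and N: "0 < N"
  shows "indep_vars (\<lambda>_. borel) (\<lambda>p \<omega>. (block_sum h N p \<omega>, block_increment h p \<omega>)) {..<m}"
proof -
  define K where "K p = {p * (2 * N)..<p * (2 * N) + 2 * N}" for p :: nat
  define Y :: "nat \<Rightarrow> (nat \<Rightarrow> real^'d) \<Rightarrow> (real^'d) \<times> (real^'d)" where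
    "Y p x = ((h / N) *\<^sub>R (\<Sum>r<2 * N. tent N r *\<^sub>R x (p * (2 * N) + r)), \<Sum>r<2 * N. x (p * (2 * N) + r))" for p x
  have Kdiv: "j div (2 * N) = p" if "j \<in> K p" for j p
  proof -
    from that have "j = p * (2 * N) + (j - p * (2 * N))" "j - p * (2 * N) < 2 * N" by (auto simp: K_def)
    then show ?thesis using N by (metis div_mult_self3 div_less add.right_neutral mult_is_0 not_gr0 zero_neq_numeral)
  qed
  have "indep_vars (\<lambda>p. PiM (K p) (\<lambda>_. borel)) (\<lambda>p \<omega>. restrict (\<lambda>j. grid_step h N j \<omega>) (K p)) {..<m}"
  proof (rule indep_vars_restrict[OF grid_step_indep[OF h N, of "m * (2 * N)"]])
    fix p assume p: "p \<in> {..<m}"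
    then have "Suc p * (2 * N) \<le> m * (2 * N)" by (intro mult_le_mono1) auto
    then show "K p \<subseteq> {..<m * (2 * N)}" by (auto simp: K_def)
  next
    show "disjoint_family_on K {..<m}"
      unfolding disjoint_family_on_def using Kdiv by blast
  qed
  then have "indep_vars (\<lambda>_. borel) (\<lambda>p \<omega>. Y p (restrict (\<lambda>j. grid_step h N j \<omega>) (K p))) {..<m}"
  proof (rule indep_vars_compose2)
    fix p
    have [measurable]: "(\<lambda>x. x (p * (2 * N) + r)) \<in> borel_measurable (PiM (K p) (\<lambda>_. borel))" if "r < 2 * N" for r
      by (rule measurable_component_singleton) (use that in \<open>simp add: K_def\<close>)
    show "Y p \<in> measurable (PiM (K p) (\<lambda>_. borel)) borel"
      unfolding Y_def[abs_def]
      by (intro borel_measurable_Pair borel_measurable_scaleR borel_measurable_sum borel_measurable_const) auto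
  qed
  moreover have "Y p (restrict (\<lambda>j. grid_step h N j \<omega>) (K p)) = (block_sum h N p \<omega>, block_increment h p \<omega>)" for p \<omega>
    unfolding Y_def block_sum_def block_increment_eq[OF N] by (simp add: K_def)
  ultimately show ?thesis by simp
qed

text \<open>Independence of the blocks in the form in which it survives the limit of Riemann sums:
  factorisation of expectations of bounded continuous functions, by dominated convergence on both
  sides. The factors depend on p because the weights of the increments will.\<close>

lemma block_expectation_prod:
  fixes F :: "nat \<Rightarrow> (real^'d) \<times> (real^'d) \<Rightarrow> complex"
  assumes h: "0 < h" and cont: "\<And>p. continuous_on UNIV (F p)" and le1: "\<And>p x. cmod (F p x) \<le> 1"
  shows "(\<integral>\<omega>. (\<Prod>p<m. F p (xi h p \<omega>, eta h p \<omega>)) \<partial>M) = (\<Prod>p<m. \<integral>\<omega>. F p (xi h p \<omega>, eta h p \<omega>) \<partial>M)"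
proof -
  define H where "H p x = F p (sqrt (3 / (2 * h ^ 3)) *\<^sub>R fst x, (1 / sqrt (2 * h)) *\<^sub>R snd x)" for p x
  have H: "continuous_on UNIV (H p)" for p
    unfolding H_def[abs_def] by (rule continuous_on_compose2[OF cont]) (auto intro!: continuous_intros)
  have le: "cmod (H p x) \<le> 1" for p x by (simp add: H_def le1)
  have [measurable]: "H p \<in> borel_measurable borel" for p by (rule borel_measurable_continuous_onI[OF H])
  have [measurable]: "block_sum h N p \<in> borel_measurable M" "block_increment h p \<in> borel_measurable M"
    "block_diff h p \<in> borel_measurable M" for N p using h by auto
  have lim: "AE \<omega> in M. \<forall>p. (\<lambda>N. H p (block_sum h (Suc N) p \<omega>, block_increment h p \<omega>))
      \<longlonglongrightarrow> H p (block_diff h p \<omega>, block_increment h p \<omega>)"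
    using AE_block_diff[OF h]
  proof eventually_elim
    case (elim \<omega>)
    show ?case
    proof
      fix p
      have "isCont (H p) (block_diff h p \<omega>, block_increment h p \<omega>)"
        using H[of p] by (simp add: continuous_on_eq_continuous_at)
      moreover have "(\<lambda>N. block_sum h (Suc N) p \<omega>) \<longlonglongrightarrow> block_diff h p \<omega>" using elim by blast
      ultimately show "(\<lambda>N. H p (block_sum h (Suc N) p \<omega>, block_increment h p \<omega>))
          \<longlonglongrightarrow> H p (block_diff h p \<omega>, block_increment h p \<omega>)"
        by (intro isCont_tendsto_compose[of _ "H p"] tendsto_Pair tendsto_const)
    qed
  qed
  have 1: "(\<lambda>N. \<integral>\<omega>. (\<Prod>p<m. H p (block_sum h (Suc N) p \<omega>, block_increment h p \<omega>)) \<partial>M)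
      \<longlonglongrightarrow> (\<integral>\<omega>. (\<Prod>p<m. H p (block_diff h p \<omega>, block_increment h p \<omega>)) \<partial>M)"
  proof (rule integral_dominated_convergence[where w = "\<lambda>_. 1"])
    show "AE \<omega> in M. (\<lambda>N. \<Prod>p<m. H p (block_sum h (Suc N) p \<omega>, block_increment h p \<omega>))
        \<longlonglongrightarrow> (\<Prod>p<m. H p (block_diff h p \<omega>, block_increment h p \<omega>))"
      using lim by eventually_elim (intro tendsto_prod, blast)
    show "AE \<omega> in M. norm (\<Prod>p<m. H p (block_sum h (Suc N) p \<omega>, block_increment h p \<omega>)) \<le> 1" for N
      unfolding prod_norm[symmetric] by (intro always_eventually allI prod_le_1) (auto simp: le)
  qed auto
  have 2: "(\<lambda>N. \<integral>\<omega>. H p (block_sum h (Suc N) p \<omega>, block_increment h p \<omega>) \<partial>M)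
      \<longlonglongrightarrow> (\<integral>\<omega>. H p (block_diff h p \<omega>, block_increment h p \<omega>) \<partial>M)" for p
  proof (rule integral_dominated_convergence[where w = "\<lambda>_. 1"])
    show "AE \<omega> in M. (\<lambda>N. H p (block_sum h (Suc N) p \<omega>, block_increment h p \<omega>))
        \<longlonglongrightarrow> H p (block_diff h p \<omega>, block_increment h p \<omega>)"
      using lim by eventually_elim blast
  qed (auto simp: le)
  have 3: "(\<integral>\<omega>. (\<Prod>p<m. H p (block_sum h (Suc N) p \<omega>, block_increment h p \<omega>)) \<partial>M)
      = (\<Prod>p<m. \<integral>\<omega>. H p (block_sum h (Suc N) p \<omega>, block_increment h p \<omega>) \<partial>M)" for N
  proof (rule indep_vars_lebesgue_integral)
    show "indep_vars (\<lambda>_. borel) (\<lambda>p \<omega>. H p (block_sum h (Suc N) p \<omega>, block_increment h p \<omega>)) {..<m}"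
      by (rule indep_vars_compose2[OF block_sum_indep[OF h zero_less_Suc]]) simp
    show "integrable M (\<lambda>\<omega>. H p (block_sum h (Suc N) p \<omega>, block_increment h p \<omega>))" for p
      by (rule integrable_const_bound[of _ 1]) (auto simp: le)
  qed simp
  have "(\<integral>\<omega>. (\<Prod>p<m. H p (block_diff h p \<omega>, block_increment h p \<omega>)) \<partial>M)
      = (\<Prod>p<m. \<integral>\<omega>. H p (block_diff h p \<omega>, block_increment h p \<omega>) \<partial>M)"
    using LIMSEQ_unique[OF 1[unfolded 3] tendsto_prod[OF 2]] .
  then show ?thesis by (simp add: H_def xi_def eta_def)
qed

end

section \<open>Central limit theorem along blocks\<close>

text \<open>Centering the two products removes the contraction \<open>C a b * C c d\<close> from
  Isserlis' formula.\<close>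

lemma gaussian_family_wick:
  assumes fam: "gaussian_family M J C X" and J: "a \<in> J" "b \<in> J" "c \<in> J" "d \<in> J"
  shows "integrable M (\<lambda>\<omega>. (X a \<omega> * X b \<omega> - C a b) * (X c \<omega> * X d \<omega> - C c d))"
    "(\<integral>\<omega>. (X a \<omega> * X b \<omega> - C a b) * (X c \<omega> * X d \<omega> - C c d) \<partial>M) = C a c * C b d + C a d * C b c"
proof -
  interpret prob_space M
    using gaussian_family_single[OF fam J(1)] by (simp add: centered_gaussian_def)
  note i = gaussian_family_covariance(1)[OF fam J(1,2)] gaussian_family_covariance(1)[OF fam J(3,4)]
    gaussian_family_isserlis(1)[OF fam J]
  have eq: "(\<lambda>\<omega>. (X a \<omega> * X b \<omega> - C a b) * (X c \<omega> * X d \<omega> - C c d)) =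
      (\<lambda>\<omega>. X a \<omega> * X b \<omega> * (X c \<omega> * X d \<omega>) - C c d * (X a \<omega> * X b \<omega>) - C a b * (X c \<omega> * X d \<omega>) + C a b * C c d)"
    by (auto simp: algebra_simps)
  show "integrable M (\<lambda>\<omega>. (X a \<omega> * X b \<omega> - C a b) * (X c \<omega> * X d \<omega> - C c d))"
    unfolding eq using i by simp
  show "(\<integral>\<omega>. (X a \<omega> * X b \<omega> - C a b) * (X c \<omega> * X d \<omega> - C c d) \<partial>M) = C a c * C b d + C a d * C b c"
    unfolding eq using i
    by (simp add: gaussian_family_covariance(2)[OF fam] gaussian_family_isserlis(2)[OF fam] J prob_space)
qed

text \<open>Each term is at most the cube root R of the sum of cubes, so the sum is at most card I
  times R.\<close>

lemma sum_cube_le: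
  fixes x :: "'i \<Rightarrow> real"
  assumes "finite I" "\<And>i. i \<in> I \<Longrightarrow> 0 \<le> x i"
  shows "(\<Sum>i\<in>I. x i) ^ 3 \<le> real (card I) ^ 3 * (\<Sum>i\<in>I. x i ^ 3)"
proof -
  define R where "R = root 3 (\<Sum>i\<in>I. x i ^ 3)"
  have s: "0 \<le> (\<Sum>i\<in>I. x i ^ 3)" using assms by (intro sum_nonneg) auto
  have "x i \<le> R" if "i \<in> I" for i
  proof -
    have "root 3 (x i ^ 3) \<le> R" unfolding R_def
      using that assms by (subst real_root_le_iff) (auto intro!: member_le_sum)
    then show ?thesis using assms(2)[OF that] by (simp add: real_root_power_cancel)
  qed
  then have "(\<Sum>i\<in>I. x i) \<le> real (card I) * R" using sum_bounded_above[of I x R] by simp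
  then have "(\<Sum>i\<in>I. x i) ^ 3 \<le> (real (card I) * R) ^ 3"
    using assms by (intro power_mono sum_nonneg) auto
  also have "\<dots> = real (card I) ^ 3 * (\<Sum>i\<in>I. x i ^ 3)"
    using s by (simp add: power_mult_distrib R_def real_root_pow_pos2)
  finally show ?thesis .
qed

definition quad :: "real^'d^'d \<Rightarrow> real^'d \<Rightarrow> real" where
  "quad A a = (\<Sum>i\<in>UNIV. \<Sum>j\<in>UNIV. A $ i $ j * (a $ i * a $ j - of_bool (i = j)))"

text \<open>The variance of \<open>quad A\<close> at a standard Gaussian vector.\<close>

definition quad_var :: "real^'d^'d \<Rightarrow> real" where
  "quad_var A = (\<Sum>i\<in>UNIV. \<Sum>j\<in>UNIV. A $ i $ j * A $ i $ j + A $ i $ j * A $ j $ i)"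

text \<open>The integer count of the estimator, truncated at zero; with positive T and h the
  truncation takes effect only for T < 2 h, where the estimator has an empty sum anyway.\<close>

definition block_count :: "real \<Rightarrow> real \<Rightarrow> nat" where
  "block_count T h = nat (\<lfloor>T / (2 * h)\<rfloor> - 1)"

lemma quad_eq_inner: "quad A a = A \<bullet> (outer_prod a a - mat 1)"
  by (simp add: quad_def inner_vec_def outer_prod_def mat_def of_bool_def)

lemma continuous_on_quad [continuous_intros]:
  "continuous_on S f \<Longrightarrow> continuous_on S (\<lambda>x. quad A (f x))"
  unfolding quad_def by (intro continuous_intros)

lemma abs_quad_le: "\<bar>quad A a\<bar> \<le> (\<Sum>i\<in>UNIV. \<Sum>j\<in>UNIV. \<bar>A $ i $ j\<bar>) * (1 + (\<Sum>i\<in>UNIV. (a $ i)\<^sup>2))"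
proof -
  let ?s = "1 + (\<Sum>i\<in>UNIV. (a $ i)\<^sup>2)"
  have 1: "\<bar>a $ i * a $ j - of_bool (i = j)\<bar> \<le> ?s" for i j
  proof -
    have le: "(a $ k)\<^sup>2 \<le> (\<Sum>i\<in>UNIV. (a $ i)\<^sup>2)" for k by (rule member_le_sum) auto
    have "\<bar>2 * (a $ i * a $ j)\<bar> \<le> (a $ i)\<^sup>2 + (a $ j)\<^sup>2"
      using zero_le_power2[of "a $ i - a $ j"] zero_le_power2[of "a $ i + a $ j"]
      by (simp add: power2_eq_square algebra_simps abs_le_iff)
    then have "\<bar>a $ i * a $ j\<bar> \<le> (\<Sum>i\<in>UNIV. (a $ i)\<^sup>2)" using le[of i] le[of j] by (simp add: abs_mult)
    moreover have "\<bar>of_bool (i = j) :: real\<bar> \<le> 1" by simp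
    ultimately show ?thesis using abs_triangle_ineq4[of "a $ i * a $ j" "of_bool (i = j)"] by linarith
  qed
  have "\<bar>quad A a\<bar> \<le> (\<Sum>i\<in>UNIV. \<Sum>j\<in>UNIV. \<bar>A $ i $ j\<bar> * ?s)"
    unfolding quad_def
    by (intro order_trans[OF sum_abs] sum_mono) (unfold abs_mult, rule mult_left_mono[OF 1 abs_ge_zero])
  then show ?thesis by (simp add: sum_distrib_right)
qed

text \<open>Symmetrising the double sum turns twice the value into the sum of the squares of A_ij +
  A_ji.\<close>

lemma quad_var_nonneg: "0 \<le> quad_var (A :: real^'d^'d)"
proof -
  have "2 * quad_var A = quad_var A + (\<Sum>i\<in>UNIV. \<Sum>j\<in>UNIV. A $ j $ i * A $ j $ i + A $ j $ i * A $ i $ j)"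
    unfolding quad_var_def by (subst (3) sum.swap) simp
  also have "\<dots> = (\<Sum>i\<in>UNIV. \<Sum>j\<in>UNIV. (A $ i $ j + A $ j $ i)\<^sup>2)"
    unfolding quad_var_def sum.distrib[symmetric]
    by (intro sum.cong refl) (simp add: power2_eq_square algebra_simps)
  also have "0 \<le> \<dots>" by (intro sum_nonneg) auto
  finally show ?thesis by simp
qed

text \<open>The threshold 4 is where X - 2 \<ge> X / 2, for X = T / (2 h); it makes the count
  comparable to X.\<close>

lemma block_count_bounds:
  assumes "0 < h" "4 \<le> T / (2 * h)"
  shows "T / (2 * h) / 2 \<le> real (block_count T h)" "real (block_count T h) \<le> T / (2 * h)"
    "T / (2 * h) - 2 \<le> real (block_count T h)"
proof -
  have "(4::int) \<le> \<lfloor>T / (2 * h)\<rfloor>" using assms by (simp add: le_floor_iff)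
  then have "real (block_count T h) = of_int \<lfloor>T / (2 * h)\<rfloor> - 1" by (simp add: block_count_def)
  then have "T / (2 * h) - 2 \<le> real (block_count T h) \<and> real (block_count T h) \<le> T / (2 * h)"
    using floor_correct[of "T / (2 * h)"] by linarith
  then show "T / (2 * h) - 2 \<le> real (block_count T h)" "real (block_count T h) \<le> T / (2 * h)"
    "T / (2 * h) / 2 \<le> real (block_count T h)"
    using assms(2) by auto
qed

section \<open>Moments of the normalised blocks\<close>

context brownian_motion
begin

lemma xi_moments:
  assumes h: "0 < h"
  shows "integrable M (\<lambda>\<omega>. xi h p \<omega> $ i ^ k)" "(\<integral>\<omega>. (xi h p \<omega> $ i) ^ 6 \<partial>M) = 15"
    "integrable M (\<lambda>\<omega>. eta h p \<omega> $ i ^ k)" "(\<integral>\<omega>. (eta h p \<omega> $ i) ^ 6 \<partial>M) = 15"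
    "integrable M (\<lambda>\<omega>. eta h p \<omega> $ i * eta h p \<omega> $ j)"
    "(\<integral>\<omega>. eta h p \<omega> $ i * eta h p \<omega> $ j \<partial>M) = of_bool (i = j)"
    "(\<integral>\<omega>. eta h p \<omega> $ i \<partial>M) = 0"
proof -
  note fam = block_gaussian[OF h, of "Suc p"]
  have J: "(b, p, i) \<in> UNIV \<times> {..<Suc p} \<times> UNIV" for b and i :: 'd by simp
  have x: "centered_gaussian M 1 (\<lambda>\<omega>. xi h p \<omega> $ i)" for i
    using gaussian_family_single[OF fam J[of True i]] by (simp add: block_cov_def block_var_def)
  have e: "centered_gaussian M 1 (\<lambda>\<omega>. eta h p \<omega> $ i)" for i
    using gaussian_family_single[OF fam J[of False i]] by (simp add: block_cov_def block_var_def)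
  show "integrable M (\<lambda>\<omega>. xi h p \<omega> $ i ^ k)" by (rule centered_gaussian_moment(1)[OF x])
  show "integrable M (\<lambda>\<omega>. eta h p \<omega> $ i ^ k)" by (rule centered_gaussian_moment(1)[OF e])
  show "(\<integral>\<omega>. (xi h p \<omega> $ i) ^ 6 \<partial>M) = 15" using centered_gaussian_moments(4)[OF x[of i]] by simp
  show "(\<integral>\<omega>. (eta h p \<omega> $ i) ^ 6 \<partial>M) = 15" using centered_gaussian_moments(4)[OF e[of i]] by simp
  show "(\<integral>\<omega>. eta h p \<omega> $ i \<partial>M) = 0" using centered_gaussian_moments(5)[OF e[of i]] by simp
  show "integrable M (\<lambda>\<omega>. eta h p \<omega> $ i * eta h p \<omega> $ j)"
    "(\<integral>\<omega>. eta h p \<omega> $ i * eta h p \<omega> $ j \<partial>M) = of_bool (i = j)"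
    using gaussian_family_covariance[OF fam J[of False i] J[of False j]]
    by (simp_all add: block_cov_def block_var_def)
qed

lemma xi_wick:
  assumes h: "0 < h"
  shows "integrable M (\<lambda>\<omega>. (xi h p \<omega> $ i * xi h p \<omega> $ j - of_bool (i = j)) * (xi h q \<omega> $ k * xi h q \<omega> $ l - of_bool (k = l)))"
    "(\<integral>\<omega>. (xi h p \<omega> $ i * xi h p \<omega> $ j - of_bool (i = j)) * (xi h q \<omega> $ k * xi h q \<omega> $ l - of_bool (k = l)) \<partial>M)
      = of_bool (p = q) * (of_bool (i = k) * of_bool (j = l) + of_bool (i = l) * of_bool (j = k))"
proof -
  note fam = block_gaussian[OF h, of "Suc (max p q)"]
  have J: "(True, p, i) \<in> UNIV \<times> {..<Suc (max p q)} \<times> UNIV" "(True, q, i) \<in> UNIV \<times> {..<Suc (max p q)} \<times> UNIV"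
    for i :: 'd by auto
  note w = gaussian_family_wick[OF fam J(1)[of i] J(1)[of j] J(2)[of k] J(2)[of l]]
  show "integrable M (\<lambda>\<omega>. (xi h p \<omega> $ i * xi h p \<omega> $ j - of_bool (i = j)) * (xi h q \<omega> $ k * xi h q \<omega> $ l - of_bool (k = l)))"
    using w(1) by (simp add: block_cov_def block_var_def)
  show "(\<integral>\<omega>. (xi h p \<omega> $ i * xi h p \<omega> $ j - of_bool (i = j)) * (xi h q \<omega> $ k * xi h q \<omega> $ l - of_bool (k = l)) \<partial>M)
      = of_bool (p = q) * (of_bool (i = k) * of_bool (j = l) + of_bool (i = l) * of_bool (j = k))"
    using w(2) by (simp add: block_cov_def block_var_def)
qed

lemma xi_covariance:
  assumes h: "0 < h"
  shows "integrable M (\<lambda>\<omega>. xi h p \<omega> $ i * xi h q \<omega> $ j)"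
    "(\<integral>\<omega>. xi h p \<omega> $ i * xi h q \<omega> $ j \<partial>M) = of_bool (p = q) * of_bool (i = j)"
proof -
  note fam = block_gaussian[OF h, of "Suc (max p q)"]
  have J: "(True, p, i) \<in> UNIV \<times> {..<Suc (max p q)} \<times> UNIV" "(True, q, i) \<in> UNIV \<times> {..<Suc (max p q)} \<times> UNIV"
    for i :: 'd by auto
  note w = gaussian_family_covariance[OF fam J(1)[of i] J(2)[of j]]
  show "integrable M (\<lambda>\<omega>. xi h p \<omega> $ i * xi h q \<omega> $ j)"
    "(\<integral>\<omega>. xi h p \<omega> $ i * xi h q \<omega> $ j \<partial>M) = of_bool (p = q) * of_bool (i = j)"
    using w by (simp_all add: block_cov_def block_var_def)
qed

text \<open>All terms are odd moments of jointly centered Gaussian variables. This orthogonality is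
  what makes the limit independent of W: the variance of a block contains no cross term between the
  quadratic part and the increment, although \<open>xi\<close> and \<open>eta\<close> are themselves
  correlated.\<close>

lemma xi_xi_eta:
  assumes h: "0 < h"
  shows "integrable M (\<lambda>\<omega>. (xi h p \<omega> $ i * xi h p \<omega> $ j - of_bool (i = j)) * eta h p \<omega> $ k)"
    "(\<integral>\<omega>. (xi h p \<omega> $ i * xi h p \<omega> $ j - of_bool (i = j)) * eta h p \<omega> $ k \<partial>M) = 0"
proof -
  note fam = block_gaussian[OF h, of "Suc p"]
  have J: "(b, p, i) \<in> UNIV \<times> {..<Suc p} \<times> UNIV" for b and i :: 'd by simp
  note w = gaussian_family_third_moment[OF fam J[of True i] J[of True j] J[of False k]]
  have i: "integrable M (\<lambda>\<omega>. xi h p \<omega> $ i * xi h p \<omega> $ j * eta h p \<omega> $ k)"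
    and z: "(\<integral>\<omega>. xi h p \<omega> $ i * xi h p \<omega> $ j * eta h p \<omega> $ k \<partial>M) = 0"
    using w by (simp_all add: block_var_def)
  have i1: "integrable M (\<lambda>\<omega>. eta h p \<omega> $ k)" using xi_moments(3)[OF h, of p k 1] by simp
  have eq: "(\<lambda>\<omega>. (xi h p \<omega> $ i * xi h p \<omega> $ j - of_bool (i = j)) * eta h p \<omega> $ k)
      = (\<lambda>\<omega>. xi h p \<omega> $ i * xi h p \<omega> $ j * eta h p \<omega> $ k - of_bool (i = j) * eta h p \<omega> $ k)"
    by (simp add: left_diff_distrib)
  show "integrable M (\<lambda>\<omega>. (xi h p \<omega> $ i * xi h p \<omega> $ j - of_bool (i = j)) * eta h p \<omega> $ k)"
    unfolding eq using i i1 by (intro Bochner_Integration.integrable_diff integrable_mult_right)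
  show "(\<integral>\<omega>. (xi h p \<omega> $ i * xi h p \<omega> $ j - of_bool (i = j)) * eta h p \<omega> $ k \<partial>M) = 0"
    unfolding eq using i i1 z xi_moments(7)[OF h, of p k] by simp
qed

lemma quad_moments:
  assumes h: "0 < h"
  shows "integrable M (\<lambda>\<omega>. quad A (xi h p \<omega>))" "(\<integral>\<omega>. quad A (xi h p \<omega>) \<partial>M) = 0"
    "integrable M (\<lambda>\<omega>. quad A (xi h p \<omega>) * quad B (xi h q \<omega>))"
    "(\<integral>\<omega>. quad A (xi h p \<omega>) * quad B (xi h q \<omega>) \<partial>M)
      = of_bool (p = q) * (\<Sum>i\<in>UNIV. \<Sum>j\<in>UNIV. A $ i $ j * B $ i $ j + A $ i $ j * B $ j $ i)"
    "integrable M (\<lambda>\<omega>. quad A (xi h p \<omega>) * (u \<bullet> eta h p \<omega>))"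
    "(\<integral>\<omega>. quad A (xi h p \<omega>) * (u \<bullet> eta h p \<omega>) \<partial>M) = 0"
    "integrable M (\<lambda>\<omega>. u \<bullet> eta h p \<omega>)" "(\<integral>\<omega>. u \<bullet> eta h p \<omega> \<partial>M) = 0"
    "integrable M (\<lambda>\<omega>. (u \<bullet> eta h p \<omega>)\<^sup>2)" "(\<integral>\<omega>. (u \<bullet> eta h p \<omega>)\<^sup>2 \<partial>M) = u \<bullet> u"
proof -
  define y where "y p i j \<omega> = xi h p \<omega> $ i * xi h p \<omega> $ j - of_bool (i = j)" for p i j \<omega>
  have iy: "integrable M (y p i j)" and zy: "(\<integral>\<omega>. y p i j \<omega> \<partial>M) = 0" for p i j
    unfolding y_def[abs_def] using xi_covariance[OF h, of p i p j] by (auto simp: prob_space)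
  have Q: "quad A (xi h p \<omega>) = (\<Sum>i\<in>UNIV. \<Sum>j\<in>UNIV. A $ i $ j * y p i j \<omega>)" for A p \<omega>
    by (simp add: quad_def y_def)
  have U: "u \<bullet> eta h p \<omega> = (\<Sum>k\<in>UNIV. u $ k * eta h p \<omega> $ k)" for u \<omega> by (simp add: inner_vec_def)
  have ie: "integrable M (\<lambda>\<omega>. eta h p \<omega> $ k)" for k using xi_moments(3)[OF h, of p k 1] by simp
  show "integrable M (\<lambda>\<omega>. quad A (xi h p \<omega>))" "(\<integral>\<omega>. quad A (xi h p \<omega>) \<partial>M) = 0"
    unfolding Q using iy zy by simp_all
  show "integrable M (\<lambda>\<omega>. u \<bullet> eta h p \<omega>)" "(\<integral>\<omega>. u \<bullet> eta h p \<omega> \<partial>M) = 0"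
    unfolding U using ie xi_moments(7)[OF h] by simp_all
  have w: "integrable M (\<lambda>\<omega>. y p i j \<omega> * y q k l \<omega>)"
    "(\<integral>\<omega>. y p i j \<omega> * y q k l \<omega> \<partial>M)
      = of_bool (p = q) * (of_bool (i = k) * of_bool (j = l) + of_bool (i = l) * of_bool (j = k))" for i j k l
    unfolding y_def using xi_wick[OF h] by auto
  have QQ: "(\<lambda>\<omega>. quad A (xi h p \<omega>) * quad B (xi h q \<omega>)) = (\<lambda>\<omega>. \<Sum>i\<in>UNIV. \<Sum>j\<in>UNIV. \<Sum>k\<in>UNIV. \<Sum>l\<in>UNIV.
      (A $ i $ j * B $ k $ l) * (y p i j \<omega> * y q k l \<omega>))"
    unfolding Q[of A p] sum_distrib_right unfolding Q[of B q] sum_distrib_left by (simp add: ac_simps)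
  show "integrable M (\<lambda>\<omega>. quad A (xi h p \<omega>) * quad B (xi h q \<omega>))"
    unfolding QQ using w(1) by (intro Bochner_Integration.integrable_sum integrable_mult_right)
  have "(\<integral>\<omega>. quad A (xi h p \<omega>) * quad B (xi h q \<omega>) \<partial>M) = (\<Sum>i\<in>UNIV. \<Sum>j\<in>UNIV. \<Sum>k\<in>UNIV. \<Sum>l\<in>UNIV.
      (A $ i $ j * B $ k $ l) * (of_bool (p = q) * (of_bool (i = k) * of_bool (j = l) + of_bool (i = l) * of_bool (j = k))))"
    unfolding QQ
    by (subst Bochner_Integration.integral_sum, use w(1) in \<open>intro Bochner_Integration.integrable_sum integrable_mult_right; simp\<close>)+
      (simp add: w)
  also have "\<dots> = (\<Sum>i\<in>UNIV. \<Sum>j\<in>UNIV. of_bool (p = q) * (A $ i $ j * B $ i $ j + A $ i $ j * B $ j $ i))"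
  proof (intro sum.cong refl)
    fix i j
    have e: "(A $ i $ j * B $ k $ l) * (of_bool (p = q) * (of_bool (i = k) * of_bool (j = l) + of_bool (i = l) * of_bool (j = k)))
      = (if i = k then if j = l then of_bool (p = q) * (A $ i $ j * B $ i $ j) else 0 else 0)
        + (if j = k then if i = l then of_bool (p = q) * (A $ i $ j * B $ j $ i) else 0 else 0)" for k l
      by (auto simp: algebra_simps)
    have d: "(\<Sum>k\<in>UNIV. \<Sum>l\<in>UNIV. if a = k then if b = l then r else 0 else 0) = r" for a b :: 'd and r :: real
    proof -
      have "(\<Sum>l\<in>UNIV. if a = k then if b = l then r else 0 else 0) = (if a = k then r else 0)" for k
        by (cases "a = k") simp_all
      then show ?thesis by simp
    qed
    show "(\<Sum>k\<in>UNIV. \<Sum>l\<in>UNIV. (A $ i $ j * B $ k $ l) * (of_bool (p = q) * (of_bool (i = k) * of_bool (j = l) + of_bool (i = l) * of_bool (j = k))))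
      = of_bool (p = q) * (A $ i $ j * B $ i $ j + A $ i $ j * B $ j $ i)"
      unfolding e sum.distrib d by (simp add: distrib_left)
  qed
  finally show "(\<integral>\<omega>. quad A (xi h p \<omega>) * quad B (xi h q \<omega>) \<partial>M)
      = of_bool (p = q) * (\<Sum>i\<in>UNIV. \<Sum>j\<in>UNIV. A $ i $ j * B $ i $ j + A $ i $ j * B $ j $ i)"
    by (simp add: sum_distrib_left)
  have v: "integrable M (\<lambda>\<omega>. y p i j \<omega> * eta h p \<omega> $ k)" "(\<integral>\<omega>. y p i j \<omega> * eta h p \<omega> $ k \<partial>M) = 0" for i j k
    unfolding y_def using xi_xi_eta[OF h] by auto
  have QU: "(\<lambda>\<omega>. quad A (xi h p \<omega>) * (u \<bullet> eta h p \<omega>)) = (\<lambda>\<omega>. \<Sum>i\<in>UNIV. \<Sum>j\<in>UNIV. \<Sum>k\<in>UNIV.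
      (A $ i $ j * u $ k) * (y p i j \<omega> * eta h p \<omega> $ k))"
    unfolding Q U by (simp add: sum_distrib_left sum_distrib_right ac_simps)
  show "integrable M (\<lambda>\<omega>. quad A (xi h p \<omega>) * (u \<bullet> eta h p \<omega>))" "(\<integral>\<omega>. quad A (xi h p \<omega>) * (u \<bullet> eta h p \<omega>) \<partial>M) = 0"
    unfolding QU using v by simp_all
  have UU: "(\<lambda>\<omega>. (u \<bullet> eta h p \<omega>)\<^sup>2) = (\<lambda>\<omega>. \<Sum>k\<in>UNIV. \<Sum>l\<in>UNIV. (u $ k * u $ l) * (eta h p \<omega> $ k * eta h p \<omega> $ l))"
    unfolding U power2_eq_square by (simp add: sum_distrib_left sum_distrib_right ac_simps)
  have d: "(\<Sum>l\<in>UNIV. (u $ k * u $ l) * of_bool (k = l)) = u $ k * u $ k" for k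
    by (simp add: of_bool_def if_distrib[of "(*) _"] cong: if_cong)
  show "integrable M (\<lambda>\<omega>. (u \<bullet> eta h p \<omega>)\<^sup>2)" "(\<integral>\<omega>. (u \<bullet> eta h p \<omega>)\<^sup>2 \<partial>M) = u \<bullet> u"
    unfolding UU using xi_moments(5,6)[OF h] by (simp_all add: d inner_vec_def)
qed

end

lemma three_cube_le:
  fixes a b c :: real
  assumes "0 \<le> a" "0 \<le> b" "0 \<le> c"
  shows "(a + b + c) ^ 3 \<le> 27 * (a ^ 3 + b ^ 3 + c ^ 3)"
  using sum_cube_le[of "{0, 1, 2 :: nat}" "\<lambda>i. if i = 0 then a else if i = 1 then b else c"] assms
  by (simp add: add.assoc split: if_splits)

lemma divide_at_top:
  fixes h :: "nat \<Rightarrow> real"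
  assumes T: "0 < T" and h: "\<And>n. 0 < h n" "h \<longlonglongrightarrow> 0"
  shows "filterlim (\<lambda>n. T / (2 * h n)) at_top sequentially"
proof -
  have "(\<lambda>n. 2 * h n) \<longlonglongrightarrow> 0" using tendsto_mult_right_zero[OF h(2), of 2] .
  moreover have "\<forall>\<^sub>F n in sequentially. 0 < 2 * h n" using h(1) by simp
  ultimately have "filterlim (\<lambda>n. inverse (2 * h n)) at_top sequentially"
    by (rule filterlim_inverse_at_top)
  then have "filterlim (\<lambda>n. T * inverse (2 * h n)) at_top sequentially"
    by (rule filterlim_tendsto_pos_mult_at_top[OF tendsto_const T])
  then show ?thesis by (simp only: divide_inverse)
qed

section \<open>Characteristic function of the fluctuation\<close>

context brownian_motion
begin

text \<open>The number s bounds both coefficients, so the exponent is at most s (2 + X + Y) in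
  modulus, with X and Y the squared lengths of \<open>xi\<close> and \<open>eta\<close>. Its cube is
  at most 27 s^3 (8 + X^3 + Y^3); X^3 is at most d^3 times the sum of the d sixth powers, each of
  mean 15, and likewise for Y. This gives 8 + 30 d^4.\<close>

lemma block_char_bound:
  assumes h: "0 < h"
    and s: "\<bar>\<kappa>\<bar> * (\<Sum>i\<in>UNIV. \<Sum>j\<in>UNIV. \<bar>A $ i $ j\<bar>) \<le> s" "sqrt (2 * h) * norm \<phi> \<le> s"
  defines "v \<equiv> \<kappa>\<^sup>2 * quad_var A + 2 * h * (\<phi> \<bullet> \<phi>)"
  shows "cmod ((\<integral>\<omega>. iexp (\<kappa> * quad A (xi h p \<omega>) + sqrt (2 * h) * (\<phi> \<bullet> eta h p \<omega>)) \<partial>M) - of_real (exp (- v / 2)))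
    \<le> s ^ 3 * (27 * (8 + 30 * real CARD('d) ^ 4)) / 6 + v\<^sup>2 / 8"
proof -
  let ?d = "real CARD('d)"
  define S where "S \<omega> = \<kappa> * quad A (xi h p \<omega>) + sqrt (2 * h) * (\<phi> \<bullet> eta h p \<omega>)" for \<omega>
  define B where "B \<omega> = s ^ 3 * (27 * (8 + ?d ^ 3 * (\<Sum>i\<in>UNIV. (xi h p \<omega> $ i) ^ 6) + ?d ^ 3 * (\<Sum>i\<in>UNIV. (eta h p \<omega> $ i) ^ 6)))" for \<omega>
  note q = quad_moments[OF h]
  have s0: "0 \<le> s" using s(2) by (rule order_trans[rotated]) (use h in simp)
  have iS: "integrable M S" and zS: "expectation S = 0"
    unfolding S_def[abs_def] using q(1,2,7,8) by simp_all
  have [measurable]: "S \<in> borel_measurable M" using iS by simp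
  have S2: "(S \<omega>)\<^sup>2 = \<kappa>\<^sup>2 * (quad A (xi h p \<omega>) * quad A (xi h p \<omega>))
      + 2 * \<kappa> * sqrt (2 * h) * (quad A (xi h p \<omega>) * (\<phi> \<bullet> eta h p \<omega>)) + 2 * h * (\<phi> \<bullet> eta h p \<omega>)\<^sup>2" for \<omega>
  proof -
    have "(a + sqrt (2 * h) * c)\<^sup>2 = a\<^sup>2 + 2 * a * sqrt (2 * h) * c + (sqrt (2 * h))\<^sup>2 * c\<^sup>2" for a c
      by (simp add: power2_eq_square algebra_simps)
    then show ?thesis using h unfolding S_def by (simp add: power2_eq_square)
  qed
  have iS2: "integrable M (\<lambda>\<omega>. (S \<omega>)\<^sup>2)" and ES2: "expectation (\<lambda>\<omega>. (S \<omega>)\<^sup>2) = v"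
    unfolding S2 v_def quad_var_def using q(3-6,9,10) by simp_all
  have le: "\<bar>S \<omega>\<bar> ^ 3 \<le> B \<omega>" for \<omega>
  proof -
    let ?X = "\<Sum>i\<in>UNIV. (xi h p \<omega> $ i)\<^sup>2" and ?Y = "\<Sum>i\<in>UNIV. (eta h p \<omega> $ i)\<^sup>2"
    have X0: "0 \<le> ?X" "0 \<le> ?Y" by (auto intro: sum_nonneg)
    have nY: "norm (eta h p \<omega>) \<le> 1 + ?Y"
    proof -
      have "norm (eta h p \<omega>) ^ 2 = ?Y" unfolding power2_norm_eq_inner inner_vec_def by (simp add: power2_eq_square)
      moreover have "2 * norm (eta h p \<omega>) \<le> 1 + norm (eta h p \<omega>) ^ 2"
        using zero_le_power2[of "norm (eta h p \<omega>) - 1"] by (simp add: power2_diff)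
      ultimately show ?thesis using norm_ge_zero[of "eta h p \<omega>"] by linarith
    qed
    have "\<bar>\<kappa> * quad A (xi h p \<omega>)\<bar> \<le> \<bar>\<kappa>\<bar> * ((\<Sum>i\<in>UNIV. \<Sum>j\<in>UNIV. \<bar>A $ i $ j\<bar>) * (1 + ?X))"
      unfolding abs_mult by (rule mult_left_mono[OF abs_quad_le abs_ge_zero])
    also have "\<dots> \<le> s * (1 + ?X)"
      unfolding mult.assoc[symmetric] using X0 by (intro mult_right_mono[OF s(1)]) auto
    finally have 1: "\<bar>\<kappa> * quad A (xi h p \<omega>)\<bar> \<le> s * (1 + ?X)" .
    have "\<bar>sqrt (2 * h) * (\<phi> \<bullet> eta h p \<omega>)\<bar> \<le> sqrt (2 * h) * (norm \<phi> * norm (eta h p \<omega>))"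
      unfolding abs_mult using h by (simp add: Cauchy_Schwarz_ineq2)
    also have "\<dots> \<le> s * norm (eta h p \<omega>)"
      unfolding mult.assoc[symmetric] by (rule mult_right_mono[OF s(2) norm_ge_zero])
    also have "\<dots> \<le> s * (1 + ?Y)" by (rule mult_left_mono[OF nY s0])
    finally have "\<bar>S \<omega>\<bar> \<le> s * (1 + ?X) + s * (1 + ?Y)"
      using 1 unfolding S_def by (intro order_trans[OF abs_triangle_ineq] add_mono)
    also have "\<dots> = s * (2 + ?X + ?Y)" by (simp add: algebra_simps)
    finally have "\<bar>S \<omega>\<bar> ^ 3 \<le> (s * (2 + ?X + ?Y)) ^ 3" by (rule power_mono) simp
    also have "\<dots> = s ^ 3 * (2 + ?X + ?Y) ^ 3" by (rule power_mult_distrib)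
    also have "\<dots> \<le> s ^ 3 * (27 * (2 ^ 3 + ?X ^ 3 + ?Y ^ 3))"
      using X0 s0 by (intro mult_left_mono three_cube_le) auto
    also have "\<dots> \<le> s ^ 3 * (27 * (2 ^ 3 + ?d ^ 3 * (\<Sum>i\<in>UNIV. ((xi h p \<omega> $ i)\<^sup>2) ^ 3) + ?d ^ 3 * (\<Sum>i\<in>UNIV. ((eta h p \<omega> $ i)\<^sup>2) ^ 3)))"
      using s0 by (intro mult_left_mono add_mono order_refl sum_cube_le) auto
    finally show ?thesis by (simp add: B_def flip: power_mult)
  qed
  have iB: "integrable M B" and EB: "expectation B = s ^ 3 * (27 * (8 + 30 * ?d ^ 4))"
    unfolding B_def[abs_def] using xi_moments(1-4)[OF h]
    by (simp_all add: prob_space power4_eq_xxxx power3_eq_cube)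
  have iS3: "integrable M (\<lambda>\<omega>. \<bar>S \<omega>\<bar> ^ 3)"
    by (rule Bochner_Integration.integrable_bound[OF iB]) (auto intro!: order_trans[OF le])
  have "expectation (\<lambda>\<omega>. \<bar>S \<omega>\<bar> ^ 3) \<le> s ^ 3 * (27 * (8 + 30 * ?d ^ 4))"
    unfolding EB[symmetric] by (rule integral_mono[OF iS3 iB le])
  moreover have "S \<in> borel_measurable M" by measurable
  from char_gaussian_approx[OF this iS2 iS3 zS, unfolded ES2]
  have "cmod ((\<integral>\<omega>. iexp (S \<omega>) \<partial>M) - of_real (exp (- v / 2))) \<le> expectation (\<lambda>\<omega>. \<bar>S \<omega>\<bar> ^ 3) / 6 + v\<^sup>2 / 8" .
  ultimately have "cmod ((\<integral>\<omega>. iexp (S \<omega>) \<partial>M) - of_real (exp (- v / 2))) \<le> s ^ 3 * (27 * (8 + 30 * ?d ^ 4)) / 6 + v\<^sup>2 / 8"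
    by linarith
  then show ?thesis by (simp only: S_def)
qed

text \<open>The normalised error of the estimator without drift. The matrix \<sigma> does not appear
  because the estimator is conjugated by its inverse.\<close>

definition fluctuation :: "real \<Rightarrow> real \<Rightarrow> 'w \<Rightarrow> real^'d^'d" where
  "fluctuation T h \<omega> = (sqrt (T / (2 * h)) / real (block_count T h)) *\<^sub>R
     (\<Sum>p<block_count T h. outer_prod (xi h p \<omega>) (xi h p \<omega>) - mat 1)"

lemma inner_fluctuation:
  "A \<bullet> fluctuation T h \<omega> = sqrt (T / (2 * h)) / real (block_count T h) * (\<Sum>p<block_count T h. quad A (xi h p \<omega>))"
  by (simp only: fluctuation_def inner_scaleR_right inner_sum_right quad_eq_inner)

lemma block_increment_char:
  assumes "0 < h"
  shows "(\<integral>\<omega>. iexp (\<Sum>p<m. \<phi> p \<bullet> block_increment h p \<omega>) \<partial>M) = of_real (\<Prod>p<m. exp (- (2 * h * (\<phi> p \<bullet> \<phi> p)) / 2))"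
  using block_diff_char[OF assms, of "\<lambda>_. 0" \<phi> m]
  by (simp add: exp_sum[symmetric] sum_negf sum_divide_distrib sum_distrib_left)

text \<open>With X = T / (2 h), each of the m \<le> X factors has modulus at most one and lies
  within order X^(-3/2) of its Gaussian counterpart. The two products differ by at most the sum of
  these errors, which is of order X^(-1/2).\<close>

lemma fluctuation_char_bound:
  fixes A :: "real^'d^'d"
  assumes T: "0 < T" and h: "0 < h" and x: "4 \<le> T / (2 * h)" and b: "\<And>p. norm (\<phi> p) \<le> b"
  defines "m \<equiv> block_count T h"
  defines "c \<equiv> 2 * (\<Sum>i\<in>UNIV. \<Sum>j\<in>UNIV. \<bar>A $ i $ j\<bar>) + sqrt T * b" and "c' \<equiv> 4 * quad_var A + T * b\<^sup>2"
  shows "cmod ((\<integral>\<omega>. iexp (A \<bullet> fluctuation T h \<omega> + (\<Sum>p<m. \<phi> p \<bullet> block_increment h p \<omega>)) \<partial>M)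
      - of_real (exp (- (T / (2 * h) / real m * quad_var A) / 2)) * (\<integral>\<omega>. iexp (\<Sum>p<m. \<phi> p \<bullet> block_increment h p \<omega>) \<partial>M))
    \<le> c ^ 3 * (27 * (8 + 30 * real CARD('d) ^ 4)) / 6 * (1 / sqrt (T / (2 * h))) + c'\<^sup>2 / 8 * (1 / (T / (2 * h)))"
proof -
  define X where "X = T / (2 * h)"
  define K where "K = 27 * (8 + 30 * real CARD('d) ^ 4)"
  define \<kappa> where "\<kappa> = sqrt X / real m"
  define F where "F p y = iexp (\<kappa> * quad A (fst y) + sqrt (2 * h) * (\<phi> p \<bullet> snd y))" for p and y :: "(real^'d) \<times> (real^'d)"
  define v where "v p = \<kappa>\<^sup>2 * quad_var A + 2 * h * (\<phi> p \<bullet> \<phi> p)" for p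
  \<comment> \<open>The common bound for both coefficients: m \<ge> X / 2 gives \<kappa> \<le> 2 /
    sqrt X, and 2 h = T / X gives sqrt (2 h) b = sqrt T b / sqrt X. This is the origin of
    \<open>c\<close>; the squared estimates give \<open>c'\<close>.\<close>
  define s where "s = c / sqrt X"
  have X: "4 \<le> X" "0 < X" using x by (simp_all add: X_def)
  have m: "X / 2 \<le> real m" "real m \<le> X" using block_count_bounds[OF h x] by (simp_all add: X_def m_def)
  then have m0: "0 < real m" using X by linarith
  have b0: "0 \<le> b" using b[of 0] norm_ge_zero order_trans by blast
  have \<kappa>: "0 \<le> \<kappa>" "\<kappa> \<le> 2 / sqrt X" "\<kappa>\<^sup>2 \<le> 4 / X"
  proof -
    show 0: "0 \<le> \<kappa>" using X by (simp add: \<kappa>_def)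
    have "\<kappa> \<le> sqrt X / (X / 2)" unfolding \<kappa>_def using m X by (intro divide_left_mono) auto
    also have "\<dots> = 2 / sqrt X" using X by (simp add: field_simps)
    finally show 1: "\<kappa> \<le> 2 / sqrt X" .
    have "\<kappa>\<^sup>2 \<le> (2 / sqrt X)\<^sup>2" using 0 1 by (intro power_mono) auto
    then show "\<kappa>\<^sup>2 \<le> 4 / X" using X by (simp add: power_divide)
  qed
  have h2: "2 * h = T / X" using T h by (simp add: X_def)
  have s1: "\<bar>\<kappa>\<bar> * (\<Sum>i\<in>UNIV. \<Sum>j\<in>UNIV. \<bar>A $ i $ j\<bar>) \<le> s" "sqrt (2 * h) * norm (\<phi> p) \<le> s" for p
  proof -
    have a0: "0 \<le> (\<Sum>i\<in>UNIV. \<Sum>j\<in>UNIV. \<bar>A $ i $ j\<bar>)" by (intro sum_nonneg) auto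
    have tb: "0 \<le> sqrt T * b" using T b0 by simp
    have "\<bar>\<kappa>\<bar> * (\<Sum>i\<in>UNIV. \<Sum>j\<in>UNIV. \<bar>A $ i $ j\<bar>) \<le> 2 / sqrt X * (\<Sum>i\<in>UNIV. \<Sum>j\<in>UNIV. \<bar>A $ i $ j\<bar>)"
      using \<kappa> a0 by (intro mult_right_mono) auto
    also have "\<dots> \<le> s" using X tb by (simp add: s_def c_def divide_right_mono)
    finally show "\<bar>\<kappa>\<bar> * (\<Sum>i\<in>UNIV. \<Sum>j\<in>UNIV. \<bar>A $ i $ j\<bar>) \<le> s" .
    have "sqrt (2 * h) * norm (\<phi> p) \<le> sqrt (T / X) * b" unfolding h2 using b b0 T X by (intro mult_left_mono) auto
    also have "\<dots> = sqrt T * b / sqrt X" by (simp add: real_sqrt_divide)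
    also have "\<dots> \<le> s" using X a0 by (simp add: s_def c_def divide_right_mono)
    finally show "sqrt (2 * h) * norm (\<phi> p) \<le> s" .
  qed
  have v: "0 \<le> v p" "v p \<le> c' / X" for p
  proof -
    show "0 \<le> v p" using quad_var_nonneg[of A] h by (simp add: v_def)
    have "\<phi> p \<bullet> \<phi> p \<le> b\<^sup>2" using power_mono[OF b norm_ge_zero, of p 2] by (simp add: power2_norm_eq_inner)
    then have "v p \<le> 4 / X * quad_var A + T / X * b\<^sup>2"
      unfolding v_def h2 using \<kappa>(3) quad_var_nonneg[of A] T X by (intro add_mono mult_right_mono mult_left_mono) auto
    then show "v p \<le> c' / X" using X by (simp add: c'_def add_divide_distrib)
  qed
  have sq: "sqrt (2 * h) * (u \<bullet> eta h p \<omega>) = u \<bullet> block_increment h p \<omega>" for u p \<omega>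
    using h by (simp add: eta_def)
  have "iexp (A \<bullet> fluctuation T h \<omega> + (\<Sum>p<m. \<phi> p \<bullet> block_increment h p \<omega>)) = (\<Prod>p<m. F p (xi h p \<omega>, eta h p \<omega>))" for \<omega>
  proof -
    have "A \<bullet> fluctuation T h \<omega> + (\<Sum>p<m. \<phi> p \<bullet> block_increment h p \<omega>)
        = (\<Sum>p<m. \<kappa> * quad A (xi h p \<omega>) + sqrt (2 * h) * (\<phi> p \<bullet> eta h p \<omega>))"
      unfolding inner_fluctuation sq by (simp add: sum.distrib sum_distrib_left \<kappa>_def X_def m_def)
    then show ?thesis unfolding F_def fst_conv snd_conv by (simp only: of_real_sum sum_distrib_left exp_sum finite_lessThan)
  qed
  then have 1: "(\<integral>\<omega>. iexp (A \<bullet> fluctuation T h \<omega> + (\<Sum>p<m. \<phi> p \<bullet> block_increment h p \<omega>)) \<partial>M)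
      = (\<Prod>p<m. \<integral>\<omega>. F p (xi h p \<omega>, eta h p \<omega>) \<partial>M)"
    by (simp only:) (rule block_expectation_prod[OF h], auto simp: F_def[abs_def] intro!: continuous_intros)
  have "exp (- (X / real m * quad_var A) / 2) = (\<Prod>p<m. exp (- (\<kappa>\<^sup>2 * quad_var A) / 2))"
  proof -
    have "real m * \<kappa>\<^sup>2 = X / real m" using X m0 by (simp add: \<kappa>_def power_divide power2_eq_square)
    then show ?thesis by (simp add: exp_of_nat_mult[symmetric] mult.assoc[symmetric])
  qed
  moreover have f: "exp (- v p / 2) = exp (- (\<kappa>\<^sup>2 * quad_var A) / 2) * exp (- (2 * h * (\<phi> p \<bullet> \<phi> p)) / 2)" for p
    by (simp add: v_def exp_add[symmetric] add_divide_distrib diff_divide_distrib)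
  ultimately have 2: "of_real (exp (- (X / real m * quad_var A) / 2)) * (\<integral>\<omega>. iexp (\<Sum>p<m. \<phi> p \<bullet> block_increment h p \<omega>) \<partial>M)
      = (\<Prod>p<m. complex_of_real (exp (- v p / 2)))"
    by (simp only: block_increment_char[OF h] of_real_mult[symmetric] of_real_prod[symmetric] prod.distrib f)
  have "cmod ((\<Prod>p<m. \<integral>\<omega>. F p (xi h p \<omega>, eta h p \<omega>) \<partial>M) - (\<Prod>p<m. complex_of_real (exp (- v p / 2))))
      \<le> (\<Sum>p<m. cmod ((\<integral>\<omega>. F p (xi h p \<omega>, eta h p \<omega>) \<partial>M) - of_real (exp (- v p / 2))))"
  proof (rule norm_prod_diff)
    show "cmod (\<integral>\<omega>. F p (xi h p \<omega>, eta h p \<omega>) \<partial>M) \<le> 1" for p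
      by (rule order_trans[OF integral_norm_bound]) (simp add: F_def prob_space)
    show "cmod (complex_of_real (exp (- v p / 2))) \<le> 1" for p using v(1)[of p] by simp
  qed
  also have "\<dots> \<le> (\<Sum>p<m. s ^ 3 * K / 6 + (c' / X)\<^sup>2 / 8)"
  proof (rule sum_mono)
    fix p
    have "cmod ((\<integral>\<omega>. F p (xi h p \<omega>, eta h p \<omega>) \<partial>M) - of_real (exp (- v p / 2))) \<le> s ^ 3 * K / 6 + (v p)\<^sup>2 / 8"
      using block_char_bound[OF h s1(1) s1(2)[of p], of p] by (simp add: F_def v_def K_def)
    also have "(v p)\<^sup>2 \<le> (c' / X)\<^sup>2" using v by (intro power_mono) auto
    finally show "cmod ((\<integral>\<omega>. F p (xi h p \<omega>, eta h p \<omega>) \<partial>M) - of_real (exp (- v p / 2))) \<le> s ^ 3 * K / 6 + (c' / X)\<^sup>2 / 8"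
      by simp
  qed
  also have "\<dots> = real m * (s ^ 3 * K / 6 + (c' / X)\<^sup>2 / 8)" by simp
  also have "\<dots> \<le> X * (s ^ 3 * K / 6 + (c' / X)\<^sup>2 / 8)"
  proof (rule mult_right_mono[OF m(2)])
    have "0 \<le> s" using s1(2)[of 0] by (rule order_trans[rotated]) (use h in simp)
    then show "0 \<le> s ^ 3 * K / 6 + (c' / X)\<^sup>2 / 8" by (simp add: K_def)
  qed
  also have "\<dots> = c ^ 3 * K / 6 * (1 / sqrt X) + c'\<^sup>2 / 8 * (1 / X)"
  proof -
    have "X * (c / sqrt X) ^ 3 = c ^ 3 * (1 / sqrt X)"
    proof -
      have "(sqrt X) ^ 3 = X * sqrt X" using X by (simp add: power3_eq_cube)
      then show ?thesis using X by (simp add: power_divide)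
    qed
    moreover have "X * (c' / X)\<^sup>2 = c'\<^sup>2 * (1 / X)" using X by (simp add: power2_eq_square)
    moreover have "X * (s ^ 3 * K / 6 + (c' / X)\<^sup>2 / 8) = (X * s ^ 3) * (K / 6) + (X * (c' / X)\<^sup>2) / 8"
      by (simp add: algebra_simps)
    ultimately show ?thesis unfolding s_def by simp
  qed
  finally show ?thesis using 1 2 unfolding X_def K_def by simp
qed

text \<open>For finite n the Gaussian factor carries X / m, because the normalisation uses T / (2 h)
  while the average runs over m blocks; this ratio tends to 1. The weights may change with n and p
  under a common bound, as the mesh does.\<close>

lemma fluctuation_char_tendsto:
  assumes T: "0 < T" and h: "\<And>n. 0 < h n" "h \<longlonglongrightarrow> 0" and b: "\<And>n p. norm (\<phi> n p) \<le> b"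
  defines "\<Lambda> \<equiv> \<lambda>n \<omega>. \<Sum>p<block_count T (h n). \<phi> n p \<bullet> block_increment (h n) p \<omega>"
  shows "(\<lambda>n. (\<integral>\<omega>. iexp (A \<bullet> fluctuation T (h n) \<omega> + \<Lambda> n \<omega>) \<partial>M)
      - of_real (exp (- quad_var A / 2)) * (\<integral>\<omega>. iexp (\<Lambda> n \<omega>) \<partial>M)) \<longlonglongrightarrow> 0"
proof -
  define X where "X n = T / (2 * h n)" for n
  have X: "filterlim X at_top sequentially"
    unfolding X_def using divide_at_top[OF T h] .
  have ev: "\<forall>\<^sub>F n in sequentially. 4 \<le> X n" using X by (simp add: filterlim_at_top)
  have inv: "(\<lambda>n. 1 / X n) \<longlonglongrightarrow> 0"
    by (rule tendsto_divide_0[OF tendsto_const filterlim_at_top_imp_at_infinity[OF X]])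
  have isq: "(\<lambda>n. 1 / sqrt (X n)) \<longlonglongrightarrow> 0"
    using tendsto_real_sqrt[OF inv] by (simp add: real_sqrt_divide)
  have ratio: "(\<lambda>n. X n / real (block_count T (h n))) \<longlonglongrightarrow> 1"
  proof -
    have "(\<lambda>n. real (block_count T (h n)) / X n) \<longlonglongrightarrow> 1"
    proof (rule tendsto_sandwich)
      show "\<forall>\<^sub>F n in sequentially. 1 - 2 * (1 / X n) \<le> real (block_count T (h n)) / X n"
        using ev
      proof eventually_elim
        case (elim n)
        then have "(X n - 2) / X n \<le> real (block_count T (h n)) / X n"
          using block_count_bounds(3)[OF h(1)[of n], of T] by (intro divide_right_mono) (auto simp: X_def)
        then show ?case using elim by (simp add: diff_divide_distrib)
      qed
      show "\<forall>\<^sub>F n in sequentially. real (block_count T (h n)) / X n \<le> 1"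
        using ev
      proof eventually_elim
        case (elim n)
        then have "real (block_count T (h n)) \<le> X n"
          using block_count_bounds(2)[OF h(1)[of n], of T] by (simp only: X_def)
        then show ?case using elim by simp
      qed
      show "(\<lambda>n. 1 - 2 * (1 / X n)) \<longlonglongrightarrow> 1"
        using tendsto_diff[OF tendsto_const tendsto_mult_right_zero[OF inv], of 1 2] by simp
    qed simp
    from tendsto_inverse[OF this] show ?thesis by simp
  qed
  have "(\<lambda>n. exp (- (X n / real (block_count T (h n)) * quad_var A) / 2)) \<longlonglongrightarrow> exp (- (1 * quad_var A) / 2)"
    by (intro tendsto_intros ratio) simp
  then have "(\<lambda>n. exp (- (X n / real (block_count T (h n)) * quad_var A) / 2) - exp (- quad_var A / 2)) \<longlonglongrightarrow> 0"
    using LIM_zero by simp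
  then have e: "(\<lambda>n. \<bar>exp (- (X n / real (block_count T (h n)) * quad_var A) / 2) - exp (- quad_var A / 2)\<bar>) \<longlonglongrightarrow> 0"
    by (rule tendsto_rabs_zero)
  define c where "c = (2 * (\<Sum>i\<in>UNIV. \<Sum>j\<in>UNIV. \<bar>A $ i $ j\<bar>) + sqrt T * b) ^ 3 * (27 * (8 + 30 * real CARD('d) ^ 4)) / 6"
  define c' where "c' = (4 * quad_var A + T * b\<^sup>2)\<^sup>2 / 8"
  show ?thesis
  proof (rule Lim_null_comparison)
    show "(\<lambda>n. (c * (1 / sqrt (X n)) + c' * (1 / X n))
        + \<bar>exp (- (X n / real (block_count T (h n)) * quad_var A) / 2) - exp (- quad_var A / 2)\<bar>) \<longlonglongrightarrow> 0"
      using tendsto_add[OF tendsto_add[OF tendsto_mult_right_zero[OF isq] tendsto_mult_right_zero[OF inv]] e, of c c'] by simp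
    show "\<forall>\<^sub>F n in sequentially. cmod ((\<integral>\<omega>. iexp (A \<bullet> fluctuation T (h n) \<omega> + \<Lambda> n \<omega>) \<partial>M)
      - of_real (exp (- quad_var A / 2)) * (\<integral>\<omega>. iexp (\<Lambda> n \<omega>) \<partial>M)) \<le> (c * (1 / sqrt (X n)) + c' * (1 / X n))
        + \<bar>exp (- (X n / real (block_count T (h n)) * quad_var A) / 2) - exp (- quad_var A / 2)\<bar>"
      using ev
    proof eventually_elim
      case (elim n)
      let ?E = "\<integral>\<omega>. iexp (A \<bullet> fluctuation T (h n) \<omega> + \<Lambda> n \<omega>) \<partial>M" and ?L = "\<integral>\<omega>. iexp (\<Lambda> n \<omega>) \<partial>M"
      let ?a = "exp (- (X n / real (block_count T (h n)) * quad_var A) / 2)" and ?b = "exp (- quad_var A / 2)"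
      have 1: "cmod (?E - of_real ?a * ?L) \<le> c * (1 / sqrt (X n)) + c' * (1 / X n)"
        using fluctuation_char_bound[OF T h(1)[of n], of "\<phi> n" b A] elim b
        unfolding X_def c_def c'_def \<Lambda>_def by simp
      have "cmod ?L \<le> 1" by (rule order_trans[OF integral_norm_bound]) (simp add: prob_space)
      then have 2: "cmod (of_real (?a - ?b) * ?L) \<le> \<bar>?a - ?b\<bar>"
        unfolding norm_mult norm_of_real by (rule mult_left_le) simp
      have eq: "?E - of_real ?b * ?L = (?E - of_real ?a * ?L) + of_real (?a - ?b) * ?L"
        unfolding of_real_diff left_diff_distrib by simp
      show ?case unfolding eq by (rule norm_triangle_mono[OF 1 2])
    qed
  qed
qed

end

section \<open>Mixing\<close>

text \<open>After \<open>block_count t h\<close> blocks the clock shows the left-hand time, the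
  initial h included. The floor and the omitted block keep it within 3 h of t, also when t is too
  short to contain a block.\<close>

lemma block_count_time:
  assumes "0 \<le> t" "0 < h"
  shows "\<bar>(2 * real (block_count t h) + 1) * h - t\<bar> \<le> 3 * h"
proof -
  define x where "x = t / (2 * h)"
  have x: "0 \<le> x" "t = 2 * h * x" using assms by (simp_all add: x_def)
  have "\<bar>2 * real (block_count t h) + 1 - 2 * x\<bar> \<le> 3"
  proof (cases "1 \<le> \<lfloor>x\<rfloor>")
    case True
    then have "real (block_count t h) = of_int \<lfloor>x\<rfloor> - 1" by (simp add: block_count_def x_def)
    then show ?thesis using floor_correct[of x] by linarith
  next
    case False
    then have "block_count t h = 0" "x < 1" by (auto simp: block_count_def x_def) 
    then show ?thesis using x by simp
  qed
  then have "\<bar>2 * real (block_count t h) + 1 - 2 * x\<bar> * h \<le> 3 * h"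
    using assms by (intro mult_right_mono) auto
  moreover have "\<bar>2 * real (block_count t h) + 1 - 2 * x\<bar> * h = \<bar>(2 * real (block_count t h) + 1 - 2 * x) * h\<bar>"
    using assms by (simp add: abs_mult)
  ultimately show ?thesis by (simp add: x(2) algebra_simps)
qed

lemma block_count_mono:
  assumes "t \<le> T" "0 < h"
  shows "block_count t h \<le> block_count T h"
proof -
  have "t / (2 * h) \<le> T / (2 * h)" using assms by (simp add: divide_right_mono)
  then have "\<lfloor>t / (2 * h)\<rfloor> \<le> \<lfloor>T / (2 * h)\<rfloor>" by (rule floor_mono)
  then show ?thesis by (simp add: block_count_def nat_mono)
qed

lemma tendsto_of_eventual_approx:
  fixes a :: "nat \<Rightarrow> 'a::real_normed_vector"
  assumes "\<And>k. b k \<longlonglongrightarrow> 0" "\<And>k. \<forall>\<^sub>F n in sequentially. norm (a n - b k n) \<le> e k" "e \<longlonglongrightarrow> (0::real)"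
  shows "a \<longlonglongrightarrow> 0"
proof (rule tendstoI)
  fix r :: real assume r: "0 < r"
  obtain k where k: "e k < r / 2"
    using order_tendstoD(2)[OF assms(3), of "r / 2"] r by (auto simp: eventually_sequentially)
  have "\<forall>\<^sub>F n in sequentially. norm (b k n) < r / 2"
    using tendstoD[OF assms(1)[of k], of "r / 2"] r by simp
  with assms(2)[of k] show "\<forall>\<^sub>F n in sequentially. dist (a n) 0 < r"
  proof eventually_elim
    case (elim n)
    then show ?case using norm_triangle_ineq[of "a n - b k n" "b k n"] k by simp
  qed
qed

lemma tendsto_of_uniform_approx:
  fixes a :: "nat \<Rightarrow> 'a::real_normed_vector"
  assumes "\<And>k. b k \<longlonglongrightarrow> 0" "\<And>k n. norm (a n - b k n) \<le> e k" "e \<longlonglongrightarrow> (0::real)"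
  shows "a \<longlonglongrightarrow> 0"
  using tendsto_of_eventual_approx[of b a e] assms by simp

locale brownian_sampling = brownian_motion M W for M :: "'w measure" and W :: "real \<Rightarrow> 'w \<Rightarrow> real^'d" +
  fixes T :: real and h :: "nat \<Rightarrow> real"
  assumes T: "0 < T" and h: "\<And>n. 0 < h n" "h \<longlonglongrightarrow> 0"
begin

lemma fluctuation_measurable [measurable]: "fluctuation T (h n) \<in> borel_measurable M"
proof -
  have [measurable]: "xi (h n) p \<in> borel_measurable M" for p using h(1)[of n] by auto
  have "(\<lambda>x :: real^'d. outer_prod x x) \<in> borel_measurable borel"
    unfolding outer_prod_def by (intro borel_measurable_continuous_onI continuous_intros)
  then have [measurable]: "(\<lambda>\<omega>. outer_prod (xi (h n) p \<omega>) (xi (h n) p \<omega>)) \<in> borel_measurable M" for p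
    by (rule measurable_compose[rotated]) measurable
  show ?thesis unfolding fluctuation_def[abs_def] by measurable
qed

text \<open>The exponent of a joint characteristic function of finitely many values of W. A list
  allows one more pair to be put in front when a half-line is resolved into characters.\<close>

definition pairing :: "((real^'d) \<times> real) list \<Rightarrow> 'w \<Rightarrow> real" where
  "pairing l \<omega> = (\<Sum>(u, t)\<leftarrow>l. u \<bullet> W t \<omega>)"

lemma pairing_measurable:
  "(\<And>u t. (u, t) \<in> set l \<Longrightarrow> 0 \<le> t) \<Longrightarrow> pairing l \<in> borel_measurable M"
proof (induction l)
  case (Cons x l)
  obtain u t where x: "x = (u, t)" by (cases x)
  have "0 \<le> t" using Cons.prems[of u t] x by simp
  then have [measurable]: "W t \<in> borel_measurable M" by (rule W_measurable)
  have [measurable]: "pairing l \<in> borel_measurable M"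
    by (rule Cons.IH) (use Cons.prems in auto)
  show ?case by (simp add: pairing_def[abs_def] x) (simp flip: pairing_def)
qed (simp add: pairing_def[abs_def])

text \<open>Asymptotic independence of the fluctuation from \<open>\<zeta>\<close>, tested on one character.\<close>

definition mixes :: "real^'d^'d \<Rightarrow> ('w \<Rightarrow> complex) \<Rightarrow> bool" where
  "mixes A \<zeta> \<longleftrightarrow> \<zeta> \<in> borel_measurable M \<and> (\<exists>B. \<forall>\<omega>\<in>space M. cmod (\<zeta> \<omega>) \<le> B) \<and>
     (\<lambda>n. (\<integral>\<omega>. iexp (A \<bullet> fluctuation T (h n) \<omega>) * \<zeta> \<omega> \<partial>M) - of_real (exp (- quad_var A / 2)) * (\<integral>\<omega>. \<zeta> \<omega> \<partial>M)) \<longlonglongrightarrow> 0"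

lemma integrable_of_bounded:
  fixes \<zeta> :: "'w \<Rightarrow> complex"
  assumes "\<zeta> \<in> borel_measurable M" "\<And>\<omega>. \<omega> \<in> space M \<Longrightarrow> cmod (\<zeta> \<omega>) \<le> B"
  shows "integrable M \<zeta>" "integrable M (\<lambda>\<omega>. iexp (A \<bullet> fluctuation T (h n) \<omega>) * \<zeta> \<omega>)"
proof -
  have [measurable]: "\<zeta> \<in> borel_measurable M" by fact
  show "integrable M \<zeta>" by (rule integrable_const_bound[of _ B]) (use assms in auto)
  show "integrable M (\<lambda>\<omega>. iexp (A \<bullet> fluctuation T (h n) \<omega>) * \<zeta> \<omega>)"
    by (rule integrable_const_bound[of _ B]) (use assms(2) in \<open>auto simp: norm_mult\<close>)
qed

lemma mixes_integrable:
  assumes "mixes A \<zeta>"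
  shows "integrable M \<zeta>" "integrable M (\<lambda>\<omega>. iexp (A \<bullet> fluctuation T (h n) \<omega>) * \<zeta> \<omega>)"
  using assms integrable_of_bounded[of \<zeta>] unfolding mixes_def by blast+

lemma mixes_cmult: "mixes A \<zeta> \<Longrightarrow> mixes A (\<lambda>\<omega>. k * \<zeta> \<omega>)"
proof -
  assume m: "mixes A \<zeta>"
  then obtain B where B: "\<forall>\<omega>\<in>space M. cmod (\<zeta> \<omega>) \<le> B" and [measurable]: "\<zeta> \<in> borel_measurable M"
    by (auto simp: mixes_def)
  have "\<exists>B. \<forall>\<omega>\<in>space M. cmod (k * \<zeta> \<omega>) \<le> B"
    using B by (intro exI[of _ "cmod k * B"]) (auto simp: norm_mult mult_left_mono)
  moreover have "(\<lambda>n. k * ((\<integral>\<omega>. iexp (A \<bullet> fluctuation T (h n) \<omega>) * \<zeta> \<omega> \<partial>M)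
      - of_real (exp (- quad_var A / 2)) * (\<integral>\<omega>. \<zeta> \<omega> \<partial>M))) \<longlonglongrightarrow> 0"
    using m by (intro tendsto_mult_right_zero) (simp add: mixes_def)
  ultimately show ?thesis
    unfolding mixes_def mult.left_commute[of _ k] integral_mult_right_zero right_diff_distrib by simp
qed

lemma mixes_add: "mixes A \<zeta> \<Longrightarrow> mixes A \<zeta>' \<Longrightarrow> mixes A (\<lambda>\<omega>. \<zeta> \<omega> + \<zeta>' \<omega>)"
proof -
  assume m: "mixes A \<zeta>" "mixes A \<zeta>'"
  obtain B B' where B: "\<forall>\<omega>\<in>space M. cmod (\<zeta> \<omega>) \<le> B" "\<forall>\<omega>\<in>space M. cmod (\<zeta>' \<omega>) \<le> B'"
    and [measurable]: "\<zeta> \<in> borel_measurable M" "\<zeta>' \<in> borel_measurable M"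
    using m by (auto simp: mixes_def)
  have "\<exists>B. \<forall>\<omega>\<in>space M. cmod (\<zeta> \<omega> + \<zeta>' \<omega>) \<le> B"
    using B by (intro exI[of _ "B + B'"]) (auto intro!: norm_triangle_mono)
  moreover have "(\<lambda>n. ((\<integral>\<omega>. iexp (A \<bullet> fluctuation T (h n) \<omega>) * \<zeta> \<omega> \<partial>M) - of_real (exp (- quad_var A / 2)) * (\<integral>\<omega>. \<zeta> \<omega> \<partial>M))
    + ((\<integral>\<omega>. iexp (A \<bullet> fluctuation T (h n) \<omega>) * \<zeta>' \<omega> \<partial>M) - of_real (exp (- quad_var A / 2)) * (\<integral>\<omega>. \<zeta>' \<omega> \<partial>M))) \<longlonglongrightarrow> 0"
    using m by (intro tendsto_add_zero) (simp_all add: mixes_def)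
  ultimately show ?thesis
    unfolding mixes_def distrib_left
      Bochner_Integration.integral_add[OF mixes_integrable(2)[OF m(1)] mixes_integrable(2)[OF m(2)]]
      Bochner_Integration.integral_add[OF mixes_integrable(1)[OF m(1)] mixes_integrable(1)[OF m(2)]]
      add_diff_add
    by (intro conjI borel_measurable_add \<open>\<zeta> \<in> borel_measurable M\<close> \<open>\<zeta>' \<in> borel_measurable M\<close>)
qed

lemma mixes_cong:
  assumes "\<And>\<omega>. \<omega> \<in> space M \<Longrightarrow> \<zeta> \<omega> = \<zeta>' \<omega>"
  shows "mixes A \<zeta> \<longleftrightarrow> mixes A \<zeta>'"
  unfolding mixes_def using assms
  by (intro conj_cong measurable_cong ex_cong1 ball_cong refl arg_cong[where f = "\<lambda>f. f \<longlonglongrightarrow> 0"] ext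
      arg_cong2[where f = "(-)"] arg_cong2[where f = "(*)"] Bochner_Integration.integral_cong) auto

text \<open>Replacing \<xi> by \<open>\<zeta> k\<close> changes the quantity in \<open>mixes\<close>
  by at most twice the L1 distance, uniformly in n, so the limits in k and n may be
  exchanged.\<close>

lemma mixes_lim:
  assumes m: "\<And>k. mixes A (\<zeta> k)" and B: "\<And>k \<omega>. \<omega> \<in> space M \<Longrightarrow> cmod (\<zeta> k \<omega>) \<le> B"
    and lim: "\<And>\<omega>. \<omega> \<in> space M \<Longrightarrow> (\<lambda>k. \<zeta> k \<omega>) \<longlonglongrightarrow> \<xi> \<omega>"
  shows "mixes A \<xi>"
proof -
  have [measurable]: "\<zeta> k \<in> borel_measurable M" for k using m[of k] by (simp add: mixes_def)
  have [measurable]: "\<xi> \<in> borel_measurable M" by (rule borel_measurable_LIMSEQ_metric[OF _ lim]) auto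
  have B': "cmod (\<xi> \<omega>) \<le> B" if "\<omega> \<in> space M" for \<omega>
    by (rule LIMSEQ_le_const2[OF tendsto_norm[OF lim[OF that]]]) (use B that in auto)
  have i: "integrable M \<xi>" "\<And>n. integrable M (\<lambda>\<omega>. iexp (A \<bullet> fluctuation T (h n) \<omega>) * \<xi> \<omega>)"
    by (rule integrable_of_bounded[OF \<open>\<xi> \<in> borel_measurable M\<close> B'], assumption)+
  define D where "D \<zeta> n = (\<integral>\<omega>. iexp (A \<bullet> fluctuation T (h n) \<omega>) * \<zeta> \<omega> \<partial>M) - of_real (exp (- quad_var A / 2)) * (\<integral>\<omega>. \<zeta> \<omega> \<partial>M)" for \<zeta> n
  define e where "e k = 2 * (\<integral>\<omega>. cmod (\<xi> \<omega> - \<zeta> k \<omega>) \<partial>M)" for k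
  have "(\<lambda>k. \<integral>\<omega>. cmod (\<xi> \<omega> - \<zeta> k \<omega>) \<partial>M) \<longlonglongrightarrow> (\<integral>\<omega>. 0 \<partial>M)"
  proof (rule integral_dominated_convergence[where w = "\<lambda>_. B + B"])
    show "AE \<omega> in M. (\<lambda>k. cmod (\<xi> \<omega> - \<zeta> k \<omega>)) \<longlonglongrightarrow> 0"
    proof (rule AE_I2)
      fix \<omega> assume "\<omega> \<in> space M"
      from tendsto_norm[OF tendsto_diff[OF tendsto_const lim[OF this]], of "\<xi> \<omega>"]
      show "(\<lambda>k. cmod (\<xi> \<omega> - \<zeta> k \<omega>)) \<longlonglongrightarrow> 0" by simp
    qed
    show "AE \<omega> in M. norm (cmod (\<xi> \<omega> - \<zeta> k \<omega>)) \<le> B + B" for k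
      by (rule AE_I2, unfold real_norm_def abs_norm_cancel)
        (rule order_trans[OF norm_triangle_ineq4 add_mono[OF B' B]])
  qed auto
  then have e: "e \<longlonglongrightarrow> 0" unfolding e_def by (intro tendsto_mult_right_zero) simp
  have "D \<xi> \<longlonglongrightarrow> 0"
  proof (rule tendsto_of_uniform_approx[OF _ _ e])
    show "D (\<zeta> k) \<longlonglongrightarrow> 0" for k using m[of k] by (simp add: mixes_def D_def[abs_def])
    show "cmod (D \<xi> n - D (\<zeta> k) n) \<le> e k" for n k
    proof -
      let ?I = "\<integral>\<omega>. cmod (\<xi> \<omega> - \<zeta> k \<omega>) \<partial>M"
      have ik: "integrable M (\<zeta> k)" "integrable M (\<lambda>\<omega>. iexp (A \<bullet> fluctuation T (h n) \<omega>) * \<zeta> k \<omega>)"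
        using mixes_integrable[OF m] by auto
      have "D \<xi> n - D (\<zeta> k) n = (\<integral>\<omega>. iexp (A \<bullet> fluctuation T (h n) \<omega>) * (\<xi> \<omega> - \<zeta> k \<omega>) \<partial>M)
          - of_real (exp (- quad_var A / 2)) * (\<integral>\<omega>. \<xi> \<omega> - \<zeta> k \<omega> \<partial>M)"
      proof -
        have "(\<integral>\<omega>. iexp (A \<bullet> fluctuation T (h n) \<omega>) * (\<xi> \<omega> - \<zeta> k \<omega>) \<partial>M)
            = (\<integral>\<omega>. iexp (A \<bullet> fluctuation T (h n) \<omega>) * \<xi> \<omega> \<partial>M) - (\<integral>\<omega>. iexp (A \<bullet> fluctuation T (h n) \<omega>) * \<zeta> k \<omega> \<partial>M)"
          unfolding right_diff_distrib by (rule Bochner_Integration.integral_diff[OF i(2) ik(2)])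
        moreover have "(\<integral>\<omega>. \<xi> \<omega> - \<zeta> k \<omega> \<partial>M) = (\<integral>\<omega>. \<xi> \<omega> \<partial>M) - (\<integral>\<omega>. \<zeta> k \<omega> \<partial>M)"
          by (rule Bochner_Integration.integral_diff[OF i(1) ik(1)])
        ultimately show ?thesis unfolding D_def by (simp only: right_diff_distrib) simp
      qed
      also have "cmod \<dots> \<le> ?I + ?I"
      proof (rule order_trans[OF norm_triangle_ineq4 add_mono])
        show "cmod (\<integral>\<omega>. iexp (A \<bullet> fluctuation T (h n) \<omega>) * (\<xi> \<omega> - \<zeta> k \<omega>) \<partial>M) \<le> ?I"
          by (rule order_trans[OF integral_norm_bound]) (simp add: norm_mult)
        have "cmod (of_real (exp (- quad_var A / 2)) * (\<integral>\<omega>. \<xi> \<omega> - \<zeta> k \<omega> \<partial>M)) \<le> 1 * cmod (\<integral>\<omega>. \<xi> \<omega> - \<zeta> k \<omega> \<partial>M)"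
          unfolding norm_mult using quad_var_nonneg[of A] by (intro mult_right_mono) auto
        also have "\<dots> \<le> ?I" using integral_norm_bound[of M "\<lambda>\<omega>. \<xi> \<omega> - \<zeta> k \<omega>"] by simp
        finally show "cmod (of_real (exp (- quad_var A / 2)) * (\<integral>\<omega>. \<xi> \<omega> - \<zeta> k \<omega> \<partial>M)) \<le> ?I" .
      qed
      finally show ?thesis by (simp add: e_def)
    qed
  qed
  then show ?thesis using B' unfolding mixes_def D_def[abs_def] by auto
qed

text \<open>Moving each time t to the end of a block makes the exponent a sum of block increments,
  to which the joint characteristic function applies. Path continuity makes the effect of the move
  on the exponentials vanish in L1.\<close>

lemma mixes_iexp_pairing:
  assumes l: "\<And>u t. (u, t) \<in> set l \<Longrightarrow> 0 \<le> t \<and> t \<le> T"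
  shows "mixes A (\<lambda>\<omega>. iexp (pairing l \<omega>))"
proof -
  have [measurable]: "pairing l \<in> borel_measurable M" using pairing_measurable l by blast
  \<comment> \<open>Block p receives the weight u of every pair (u, t) for which it is among the
    blocks counted up to t. The norm is at most the total of the norms of the u, uniformly in n and
    p.\<close>
  define \<phi> where "\<phi> n p = (\<Sum>(u, t)\<leftarrow>l. of_bool (p < block_count t (h n)) *\<^sub>R u)" for n p
  define \<Lambda> where "\<Lambda> n \<omega> = (\<Sum>p<block_count T (h n). \<phi> n p \<bullet> block_increment (h n) p \<omega>)" for n \<omega>
  have [measurable]: "\<Lambda> n \<in> borel_measurable M" for n
    unfolding \<Lambda>_def[abs_def] using h(1)[of n] by (intro borel_measurable_sum borel_measurable_inner) auto
  have b: "norm (\<phi> n p) \<le> (\<Sum>(u, t)\<leftarrow>l. norm u)" for n p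
    unfolding \<phi>_def by (induction l) (auto intro!: norm_triangle_mono)
  \<comment> \<open>The telescoping sum starts at W (h n), since the first block begins at time h n;
    that value tends to W 0 = 0.\<close>
  have sum: "(\<Sum>p<block_count t (h n). block_increment (h n) p \<omega>) = W ((2 * real (block_count t (h n)) + 1) * h n) \<omega> - W (h n) \<omega>" for t n \<omega>
    using sum_lessThan_telescope[of "\<lambda>p. W ((2 * real p + 1) * h n) \<omega>" "block_count t (h n)"]
    by (simp add: block_increment_def algebra_simps)
  have \<Lambda>: "\<Lambda> n \<omega> = (\<Sum>(u, t)\<leftarrow>l. u \<bullet> (W ((2 * real (block_count t (h n)) + 1) * h n) \<omega> - W (h n) \<omega>))" for n \<omega>
    using l unfolding \<Lambda>_def \<phi>_def
  proof (induction l)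
    case (Cons x l)
    obtain u t where x: "x = (u, t)" by (cases x)
    have "block_count t (h n) \<le> block_count T (h n)"
      using Cons.prems[of u t] x by (intro block_count_mono h) auto
    then have set: "{..<block_count T (h n)} \<inter> {p. p < block_count t (h n)} = {..<block_count t (h n)}" by auto
    have IH: "(\<Sum>p<block_count T (h n). (\<Sum>(u, t)\<leftarrow>l. of_bool (p < block_count t (h n)) *\<^sub>R u) \<bullet> block_increment (h n) p \<omega>)
        = (\<Sum>(u, t)\<leftarrow>l. u \<bullet> (W ((2 * real (block_count t (h n)) + 1) * h n) \<omega> - W (h n) \<omega>))"
      by (rule Cons.IH) (use Cons.prems in auto)
    have head: "(\<Sum>p<block_count T (h n). (of_bool (p < block_count t (h n)) *\<^sub>R u) \<bullet> block_increment (h n) p \<omega>)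
        = u \<bullet> (W ((2 * real (block_count t (h n)) + 1) * h n) \<omega> - W (h n) \<omega>)"
      unfolding sum[symmetric] inner_sum_right
      by (simp add: of_bool_def if_distrib[of "\<lambda>c. c * _"] sum.If_cases set cong: if_cong)
    show ?case
      by (simp only: x list.map sum_list.Cons prod.case inner_add_left sum.distrib head IH)
  qed simp
  have lim: "AE \<omega> in M. (\<lambda>n. \<Lambda> n \<omega>) \<longlonglongrightarrow> pairing l \<omega>"
    using AE_continuous
  proof eventually_elim
    case (elim \<omega>)
    have W: "(\<lambda>n. W (s n) \<omega>) \<longlonglongrightarrow> W t \<omega>" if "s \<longlonglongrightarrow> t" "\<And>n. 0 \<le> s n" "0 \<le> t" for s t
      using continuous_on_tendsto_compose[OF conjunct2[OF elim] that(1)] that(2,3) by simp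
    have s: "(\<lambda>n. (2 * real (block_count t (h n)) + 1) * h n) \<longlonglongrightarrow> t" if "0 \<le> t" for t
    proof (rule LIM_zero_cancel, rule Lim_null_comparison)
      show "\<forall>\<^sub>F n in sequentially. norm ((2 * real (block_count t (h n)) + 1) * h n - t) \<le> 3 * h n"
        using block_count_time[OF that h(1)] by simp
      show "(\<lambda>n. 3 * h n) \<longlonglongrightarrow> 0" by (rule tendsto_mult_right_zero[OF h(2)])
    qed
    show ?case unfolding \<Lambda> pairing_def using l
    proof (induction l)
      case (Cons x l)
      obtain u t where x: "x = (u, t)" by (cases x)
      have t: "0 \<le> t" using Cons.prems[of u t] x by auto
      have p: "0 \<le> (2 * real (block_count t (h n)) + 1) * h n" for n using h(1)[of n] by simp
      have "(\<lambda>n. W (h n) \<omega>) \<longlonglongrightarrow> W 0 \<omega>" using h less_imp_le by (intro W) auto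
      from tendsto_inner[OF tendsto_const tendsto_diff[OF W[OF s[OF t] p t] this], of u] elim
      have "(\<lambda>n. u \<bullet> (W ((2 * real (block_count t (h n)) + 1) * h n) \<omega> - W (h n) \<omega>)) \<longlonglongrightarrow> u \<bullet> W t \<omega>"
        by simp
      then show ?case using Cons by (simp add: x) (intro tendsto_add, auto)
    qed simp
  qed
  let ?E = "complex_of_real (exp (- quad_var A / 2))"
  have conv: "(\<lambda>n. \<integral>\<omega>. iexp (\<Lambda> n \<omega>) \<partial>M) \<longlonglongrightarrow> (\<integral>\<omega>. iexp (pairing l \<omega>) \<partial>M)"
  proof (rule integral_dominated_convergence[where w = "\<lambda>_. 1"])
    show "AE \<omega> in M. (\<lambda>n. iexp (\<Lambda> n \<omega>)) \<longlonglongrightarrow> iexp (pairing l \<omega>)"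
      using lim by eventually_elim (intro tendsto_intros)
  qed auto
  have L1: "(\<lambda>n. \<integral>\<omega>. cmod (iexp (pairing l \<omega>) - iexp (\<Lambda> n \<omega>)) \<partial>M) \<longlonglongrightarrow> (\<integral>\<omega>. 0 \<partial>M)"
  proof (rule integral_dominated_convergence[where w = "\<lambda>_. 1 + 1"])
    show "AE \<omega> in M. (\<lambda>n. cmod (iexp (pairing l \<omega>) - iexp (\<Lambda> n \<omega>))) \<longlonglongrightarrow> 0"
      using lim
    proof eventually_elim
      case (elim \<omega>)
      have "(\<lambda>n. iexp (\<Lambda> n \<omega>)) \<longlonglongrightarrow> iexp (pairing l \<omega>)" using elim by (intro tendsto_intros)
      from tendsto_norm[OF tendsto_diff[OF tendsto_const this], of "iexp (pairing l \<omega>)"] show ?case by simp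
    qed
    show "AE \<omega> in M. norm (cmod (iexp (pairing l \<omega>) - iexp (\<Lambda> n \<omega>))) \<le> 1 + 1" for n
      by (intro AE_I2) (auto intro!: order_trans[OF norm_triangle_ineq4])
  qed auto
  have diff: "(\<lambda>n. (\<integral>\<omega>. iexp (A \<bullet> fluctuation T (h n) \<omega>) * iexp (pairing l \<omega>) \<partial>M)
      - (\<integral>\<omega>. iexp (A \<bullet> fluctuation T (h n) \<omega> + \<Lambda> n \<omega>) \<partial>M)) \<longlonglongrightarrow> 0"
  proof (rule Lim_null_comparison)
    show "(\<lambda>n. \<integral>\<omega>. cmod (iexp (pairing l \<omega>) - iexp (\<Lambda> n \<omega>)) \<partial>M) \<longlonglongrightarrow> 0" using L1 by simp
    show "\<forall>\<^sub>F n in sequentially. cmod ((\<integral>\<omega>. iexp (A \<bullet> fluctuation T (h n) \<omega>) * iexp (pairing l \<omega>) \<partial>M)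
      - (\<integral>\<omega>. iexp (A \<bullet> fluctuation T (h n) \<omega> + \<Lambda> n \<omega>) \<partial>M)) \<le> (\<integral>\<omega>. cmod (iexp (pairing l \<omega>) - iexp (\<Lambda> n \<omega>)) \<partial>M)"
    proof (intro always_eventually allI)
      fix n
      have i: "integrable M (\<lambda>\<omega>. iexp (A \<bullet> fluctuation T (h n) \<omega>) * iexp (X \<omega>))" if [measurable]: "X \<in> borel_measurable M" for X
        by (rule integrable_of_bounded(2)[of _ 1]) auto
      have eq: "iexp (A \<bullet> fluctuation T (h n) \<omega> + \<Lambda> n \<omega>) = iexp (A \<bullet> fluctuation T (h n) \<omega>) * iexp (\<Lambda> n \<omega>)" for \<omega>
        by (simp add: exp_add[symmetric] distrib_left)
      have "(\<integral>\<omega>. iexp (A \<bullet> fluctuation T (h n) \<omega>) * iexp (pairing l \<omega>) \<partial>M)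
          - (\<integral>\<omega>. iexp (A \<bullet> fluctuation T (h n) \<omega> + \<Lambda> n \<omega>) \<partial>M)
        = (\<integral>\<omega>. iexp (A \<bullet> fluctuation T (h n) \<omega>) * (iexp (pairing l \<omega>) - iexp (\<Lambda> n \<omega>)) \<partial>M)"
        unfolding eq right_diff_distrib by (rule Bochner_Integration.integral_diff[symmetric]) (rule i, measurable)+
      also have "cmod \<dots> \<le> (\<integral>\<omega>. cmod (iexp (pairing l \<omega>) - iexp (\<Lambda> n \<omega>)) \<partial>M)"
        by (rule order_trans[OF integral_norm_bound]) (simp add: norm_mult)
      finally show "cmod ((\<integral>\<omega>. iexp (A \<bullet> fluctuation T (h n) \<omega>) * iexp (pairing l \<omega>) \<partial>M)
        - (\<integral>\<omega>. iexp (A \<bullet> fluctuation T (h n) \<omega> + \<Lambda> n \<omega>) \<partial>M)) \<le> (\<integral>\<omega>. cmod (iexp (pairing l \<omega>) - iexp (\<Lambda> n \<omega>)) \<partial>M)" .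
    qed
  qed
  have clt: "(\<lambda>n. (\<integral>\<omega>. iexp (A \<bullet> fluctuation T (h n) \<omega> + \<Lambda> n \<omega>) \<partial>M) - ?E * (\<integral>\<omega>. iexp (\<Lambda> n \<omega>) \<partial>M)) \<longlonglongrightarrow> 0"
    using fluctuation_char_tendsto[OF T h b, of A] by (simp only: \<Lambda>_def)
  have E: "(\<lambda>n. ?E * (\<integral>\<omega>. iexp (\<Lambda> n \<omega>) \<partial>M) - ?E * (\<integral>\<omega>. iexp (pairing l \<omega>) \<partial>M)) \<longlonglongrightarrow> 0"
    by (rule LIM_zero[OF tendsto_mult[OF tendsto_const conv]])
  have "(\<lambda>n. (\<integral>\<omega>. iexp (A \<bullet> fluctuation T (h n) \<omega>) * iexp (pairing l \<omega>) \<partial>M) - ?E * (\<integral>\<omega>. iexp (pairing l \<omega>) \<partial>M)) \<longlonglongrightarrow> 0"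
    using tendsto_add_zero[OF tendsto_add_zero[OF diff clt] E] by simp
  then show ?thesis unfolding mixes_def by (auto intro!: exI[of _ 1])
qed

end

section \<open>Passage to the augmented Brownian filtration\<close>

lemma space_sigma_gen_by [simp]: "space (sigma_gen_by M I Z) = space M"
  unfolding sigma_gen_by_def by (rule space_measure_of_conv)

lemma sets_sigma_gen_by:
  "sets (sigma_gen_by M I Z) = sigma_sets (space M) (\<Union>s\<in>I. {Z s -` B \<inter> space M | B. B \<in> sets borel})"
  unfolding sigma_gen_by_def by (rule sets_measure_of) blast

lemma sigma_gen_by_measurable: "s \<in> I \<Longrightarrow> Z s \<in> borel_measurable (sigma_gen_by M I Z)"
  by (rule measurableI) (auto simp: sets_sigma_gen_by intro!: sigma_sets.Basic)

lemma sets_sigma_gen_by_subset: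
  assumes "space N = space M" "\<And>s. s \<in> I \<Longrightarrow> Z s \<in> borel_measurable N"
  shows "sets (sigma_gen_by M I Z) \<subseteq> sets N"
proof -
  have "(\<Union>s\<in>I. {Z s -` B \<inter> space M | B. B \<in> sets borel}) \<subseteq> sets N"
    using measurable_sets[OF assms(2)] assms(1) by auto
  then show ?thesis
    unfolding sets_sigma_gen_by assms(1)[symmetric] by (rule sets.sigma_sets_subset)
qed

lemma space_augmented_filtration [simp]: "space (augmented_filtration M W t) = space M"
  unfolding augmented_filtration_def by (rule space_measure_of_conv)

lemma sets_augmented_filtration:
  "sets (augmented_filtration M W t) = sigma_sets (space M) (sets (sigma_gen_by M {0..t} W) \<union> null_sets M)"
  unfolding augmented_filtration_def
proof (rule sets_measure_of)
  show "sets (sigma_gen_by M {0..t} W) \<union> null_sets M \<subseteq> Pow (space M)"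
    using sets.space_closed[of "sigma_gen_by M {0..t} W"] sets.space_closed[of M] by auto
qed

context brownian_sampling
begin

definition halfline_prod :: "('d \<times> real \<times> real) list \<Rightarrow> 'w \<Rightarrow> complex" where
  "halfline_prod hs \<omega> = (\<Prod>(i, t, a)\<leftarrow>hs. indicator {..a} (W t \<omega> $ i))"

lemma halfline_prod_le: "cmod (halfline_prod hs \<omega>) \<le> 1"
proof (induction hs)
  case (Cons x hs)
  have "cmod (case x of (i, t, a) \<Rightarrow> indicator {..a} (W t \<omega> $ i)) \<le> 1"
    by (cases x) (simp add: indicator_def)
  then show ?case using Cons
    by (simp add: halfline_prod_def norm_mult mult_le_one)
qed (simp add: halfline_prod_def)

text \<open>Induction on the half-lines, for all pairings at once: if the first half-line is
  replaced by a character of the same coordinate of W t, the character is absorbed into the pairing,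
  and the class of admissible replacements contains the half-lines.\<close>

lemma mixes_halfline_prod:
  assumes "\<And>i t a. (i, t, a) \<in> set hs \<Longrightarrow> 0 \<le> t \<and> t \<le> T" "\<And>u t. (u, t) \<in> set l \<Longrightarrow> 0 \<le> t \<and> t \<le> T"
  shows "mixes A (\<lambda>\<omega>. halfline_prod hs \<omega> * iexp (pairing l \<omega>))"
  using assms
proof (induction hs arbitrary: l)
  case Nil
  then show ?case by (simp add: halfline_prod_def mixes_iexp_pairing)
next
  case (Cons x hs)
  obtain i t a where x: "x = (i, t, a)" by (cases x)
  have t: "0 \<le> t" "t \<le> T" using Cons.prems(1)[of i t a] x by auto
  define R where "R \<omega> = halfline_prod hs \<omega> * iexp (pairing l \<omega>)" for \<omega>
  have R: "cmod (R \<omega>) \<le> 1" for \<omega> using halfline_prod_le by (simp add: R_def norm_mult)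
  define K where "K f \<longleftrightarrow> (\<exists>B. \<forall>x. cmod (f x) \<le> B) \<and> mixes A (\<lambda>\<omega>. f (W t \<omega> $ i) * R \<omega>)" for f
  have "K (indicator {..a})"
  proof (rule trig_closed_class_contains_halflines)
    fix u
    have "mixes A (\<lambda>\<omega>. halfline_prod hs \<omega> * iexp (pairing ((axis i u, t) # l) \<omega>))"
    proof (rule Cons.IH)
      show "0 \<le> s \<and> s \<le> T" if "(j, s, b) \<in> set hs" for j s b using Cons.prems(1)[of j s b] that by simp
      show "0 \<le> s \<and> s \<le> T" if "(v, s) \<in> set ((axis i u, t) # l)" for v s
        using Cons.prems(2)[of v s] that t by auto
    qed
    moreover have "iexp (u * W t \<omega> $ i) * R \<omega> = halfline_prod hs \<omega> * iexp (pairing ((axis i u, t) # l) \<omega>)" for \<omega>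
      by (simp add: R_def pairing_def inner_axis' exp_add distrib_left)
    ultimately have "mixes A (\<lambda>\<omega>. iexp (u * W t \<omega> $ i) * R \<omega>)" by (simp only:)
    then show "K (\<lambda>x. iexp (u * x))" unfolding K_def by (intro conjI exI[of _ 1]) auto
  next
    fix f :: "real \<Rightarrow> complex" and k assume f: "K f"
    then obtain B where "\<forall>x. cmod (f x) \<le> B" by (auto simp: K_def)
    then have "\<exists>B. \<forall>x. cmod (k * f x) \<le> B"
      by (intro exI[of _ "cmod k * B"]) (auto simp: norm_mult mult_left_mono)
    then show "K (\<lambda>x. k * f x)" using f mixes_cmult[of A "\<lambda>\<omega>. f (W t \<omega> $ i) * R \<omega>" k]
      unfolding K_def by (simp add: mult.assoc)
  next
    fix f g :: "real \<Rightarrow> complex" assume fg: "K f" "K g"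
    then obtain B B' where "\<forall>x. cmod (f x) \<le> B" "\<forall>x. cmod (g x) \<le> B'" by (auto simp: K_def)
    then have "\<exists>B. \<forall>x. cmod (f x + g x) \<le> B"
      by (intro exI[of _ "B + B'"]) (auto intro!: norm_triangle_mono)
    then show "K (\<lambda>x. f x + g x)"
      using fg mixes_add[of A "\<lambda>\<omega>. f (W t \<omega> $ i) * R \<omega>" "\<lambda>\<omega>. g (W t \<omega> $ i) * R \<omega>"]
      unfolding K_def by (simp add: distrib_right)
  next
    fix f :: "nat \<Rightarrow> real \<Rightarrow> complex" and g B
    assume f: "\<And>n. K (f n)" "\<And>n x. cmod (f n x) \<le> B" "\<And>x. (\<lambda>n. f n x) \<longlonglongrightarrow> g x"
    have "cmod (g x) \<le> B" for x
      by (rule LIMSEQ_le_const2[OF tendsto_norm[OF f(3)]]) (use f(2) in auto)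
    moreover have "mixes A (\<lambda>\<omega>. g (W t \<omega> $ i) * R \<omega>)"
    proof (rule mixes_lim)
      show "mixes A (\<lambda>\<omega>. f k (W t \<omega> $ i) * R \<omega>)" for k using f(1)[of k] by (simp add: K_def)
      show "cmod (f k (W t \<omega> $ i) * R \<omega>) \<le> B * 1" for k \<omega>
        unfolding norm_mult using order_trans[OF norm_ge_zero f(2)] by (intro mult_mono f(2) R) auto
      show "(\<lambda>k. f k (W t \<omega> $ i) * R \<omega>) \<longlonglongrightarrow> g (W t \<omega> $ i) * R \<omega>" for \<omega>
        by (intro tendsto_mult f(3) tendsto_const)
    qed
    ultimately show "K g" unfolding K_def by blast
  qed
  then have "mixes A (\<lambda>\<omega>. indicator {..a} (W t \<omega> $ i) * R \<omega>)" by (simp add: K_def)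
  then show ?case by (simp add: R_def halfline_prod_def x mult.assoc)
qed

definition halfline_set :: "('d \<times> real \<times> real) list \<Rightarrow> 'w set" where
  "halfline_set hs = {\<omega> \<in> space M. \<forall>(i, t, a) \<in> set hs. W t \<omega> $ i \<le> a}"

text \<open>A system closed under intersection that generates the augmented filtration; the null
  sets of M belong to it because the augmentation adds exactly these.\<close>

definition test_sets :: "'w set set" where
  "test_sets = {halfline_set hs | hs. \<forall>(i, t, a) \<in> set hs. 0 \<le> t \<and> t \<le> T} \<union> null_sets M"

lemma halfline_set_measurable:
  assumes "\<forall>(i, t, a) \<in> set hs. 0 \<le> t \<and> t \<le> T"
  shows "halfline_set hs \<in> sets M"
  using assms
proof (induction hs)
  case (Cons x hs)
  obtain i t a where x: "x = (i, t, a)" by (cases x)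
  have [measurable]: "W t \<in> borel_measurable M" using Cons.prems x by auto
  have "(\<lambda>\<omega>. W t \<omega> $ i) \<in> borel_measurable M"
    by (rule measurable_compose[of "W t" M borel]) (auto intro!: borel_measurable_continuous_onI continuous_intros)
  then have "{\<omega> \<in> space M. W t \<omega> $ i \<le> a} \<in> sets M" by measurable
  moreover have "halfline_set (x # hs) = {\<omega> \<in> space M. W t \<omega> $ i \<le> a} \<inter> halfline_set hs"
    by (auto simp: halfline_set_def x)
  ultimately show ?case using Cons by auto
qed (simp add: halfline_set_def)

lemma Int_stable_test_sets: "Int_stable test_sets"
proof (rule Int_stableI)
  fix a b assume ab: "a \<in> test_sets" "b \<in> test_sets"
  have M: "a \<in> sets M" "b \<in> sets M"
    using ab halfline_set_measurable by (auto simp: test_sets_def)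
  show "a \<inter> b \<in> test_sets"
  proof (cases "a \<in> null_sets M \<or> b \<in> null_sets M")
    case True
    then have "a \<inter> b \<in> null_sets M" using M by (auto intro: null_set_Int1 null_set_Int2)
    then show ?thesis by (simp add: test_sets_def)
  next
    case False
    then obtain hs hs' where "a = halfline_set hs" "b = halfline_set hs'"
      "\<forall>(i, t, a) \<in> set hs. 0 \<le> t \<and> t \<le> T" "\<forall>(i, t, a) \<in> set hs'. 0 \<le> t \<and> t \<le> T"
      using ab by (auto simp: test_sets_def)
    moreover have "halfline_set hs \<inter> halfline_set hs' = halfline_set (hs @ hs')"
      by (auto simp: halfline_set_def ball_Un)
    ultimately show ?thesis unfolding test_sets_def by (intro UnI1 CollectI exI[of _ "hs @ hs'"]) auto
  qed
qed

lemma test_sets_subset: "test_sets \<subseteq> Pow (space M)"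
  using sets.sets_into_space by (auto simp: test_sets_def halfline_set_def)

lemma mixes_test_set:
  assumes "X \<in> test_sets"
  shows "mixes A (indicator X)"
proof (cases "X \<in> null_sets M")
  case True
  have AE: "AE \<omega> in M. \<omega> \<notin> X" by (rule AE_not_in[OF True])
  have [measurable]: "X \<in> sets M" using True by auto
  have z: "(\<integral>\<omega>. f \<omega> * indicator X \<omega> \<partial>M) = 0" for f :: "'w \<Rightarrow> complex"
    by (rule integral_eq_zero_AE) (use AE in eventually_elim, simp)
  have z1: "(\<integral>\<omega>. indicator X \<omega> \<partial>M) = (0::complex)" using z[of "\<lambda>_. 1"] by simp
  show ?thesis unfolding mixes_def z z1 by (intro conjI exI[of _ 1]) (auto simp: indicator_def)
next
  case False
  then obtain hs where X: "X = halfline_set hs" "\<forall>(i, t, a) \<in> set hs. 0 \<le> t \<and> t \<le> T"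
    using assms by (auto simp: test_sets_def)
  have "halfline_prod hs \<omega> = of_bool (\<forall>(i, t, a) \<in> set hs. W t \<omega> $ i \<le> a)" for \<omega>
    by (induction hs) (auto simp: halfline_prod_def split: prod.splits)
  then have eq: "indicator X \<omega> = halfline_prod hs \<omega> * iexp (pairing [] \<omega>)" if "\<omega> \<in> space M" for \<omega>
    using that by (simp add: X halfline_set_def pairing_def indicator_def)
  have "mixes A (\<lambda>\<omega>. halfline_prod hs \<omega> * iexp (pairing [] \<omega>))"
    by (rule mixes_halfline_prod) (use X(2) in auto)
  then show ?thesis by (subst mixes_cong[OF eq])
qed

text \<open>Dynkin's pi-lambda theorem. For a disjoint union the finite partial unions follow by
  additivity, and the bounded limit closes the argument.\<close>

lemma mixes_sigma_sets:
  assumes "X \<in> sigma_sets (space M) test_sets"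
  shows "mixes A (indicator X)"
  using Int_stable_test_sets test_sets_subset assms
proof (induction rule: sigma_sets_induct_disjoint)
  case (basic X)
  then show ?case by (rule mixes_test_set)
next
  case empty
  show ?case by (rule mixes_test_set) (simp add: test_sets_def)
next
  case (compl X)
  have sp: "mixes A (\<lambda>_. 1)"
    using mixes_halfline_prod[of "[]" "[]" A] by (simp add: halfline_prod_def pairing_def)
  have "mixes A (\<lambda>\<omega>. 1 + (- 1) * indicator X \<omega>)"
    by (rule mixes_add[OF sp mixes_cmult[OF compl(2)]])
  then show ?case
    by (rule mixes_cong[THEN iffD1, rotated]) (auto simp: indicator_def)
next
  case (union X)
  define Y where "Y n = (\<Union>i<n. X i)" for n
  have Y: "mixes A (indicator (Y n))" for n
  proof (induction n)
    case 0
    show ?case by (rule mixes_test_set) (simp add: test_sets_def Y_def)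
  next
    case (Suc n)
    have "indicator (Y (Suc n)) \<omega> = indicator (Y n) \<omega> + (indicator (X n) \<omega> :: complex)" for \<omega>
    proof -
      have "X i \<inter> X n = {}" if "i < n" for i
        using disjoint_family_onD[OF union(1), of i n] that by simp
      then have "Y n \<inter> X n = {}" unfolding Y_def by blast
      moreover have "Y (Suc n) = Y n \<union> X n" by (auto simp: Y_def lessThan_Suc)
      ultimately show ?thesis by (simp add: indicator_add)
    qed
    moreover have "mixes A (\<lambda>\<omega>. indicator (Y n) \<omega> + indicator (X n) \<omega>)"
      by (rule mixes_add[OF Suc union(3)])
    ultimately show ?case by presburger
  qed
  show ?case
  proof (rule mixes_lim[OF Y])
    show "cmod (indicator (Y k) \<omega>) \<le> 1" for k \<omega> by (simp add: indicator_def)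
    show "(\<lambda>k. indicator (Y k) \<omega>) \<longlonglongrightarrow> (indicator (\<Union>i. X i) \<omega> :: complex)" for \<omega>
      unfolding Y_def by (rule LIMSEQ_indicator_UN)
  qed
qed

lemma augmented_sets: "sets (augmented_filtration M W T) \<subseteq> sigma_sets (space M) test_sets"
proof -
  let ?S = "sigma (space M) test_sets"
  have setsS: "sets ?S = sigma_sets (space M) test_sets" "space ?S = space M"
    using test_sets_subset by simp_all
  have Wm: "W s \<in> borel_measurable ?S" if s: "0 \<le> s" "s \<le> T" for s
  proof -
    have "(\<lambda>\<omega>. W s \<omega> \<bullet> b) \<in> borel_measurable ?S" if bB: "b \<in> Basis" for b
    proof -
      obtain i where b: "b = axis i 1" using bB by (auto simp: Basis_vec_def)
      show ?thesis
        unfolding borel_measurable_iff_le setsS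
      proof
        fix a
        have "{\<omega> \<in> space M. W s \<omega> \<bullet> b \<le> a} = halfline_set [(i, s, a)]"
          by (auto simp: halfline_set_def b inner_axis)
        then show "{\<omega> \<in> space M. W s \<omega> \<bullet> b \<le> a} \<in> sigma_sets (space M) test_sets"
          using s by (auto simp: test_sets_def intro!: sigma_sets.Basic exI[of _ "[(i, s, a)]"])
      qed
    qed
    then show ?thesis by (simp add: borel_measurable_euclidean_space[of "W s"])
  qed
  have "sets (sigma_gen_by M {0..T} W) \<subseteq> sets ?S"
    by (rule sets_sigma_gen_by_subset[OF setsS(2)]) (auto intro: Wm)
  moreover have "null_sets M \<subseteq> sigma_sets (space M) test_sets"
    by (auto simp: test_sets_def)
  ultimately show ?thesis
    unfolding sets_augmented_filtration setsS by (intro sigma_sets_mono) blast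
qed

text \<open>Approximation by simple functions, starting from indicators. The shift by
  \<open>B\<close> makes the function nonnegative, as the induction over nonnegative measurable
  functions demands, and is removed at the end by linearity.\<close>

lemma mixing:
  fixes \<zeta> :: "'w \<Rightarrow> real"
  assumes \<zeta>: "\<zeta> \<in> borel_measurable (augmented_filtration M W T)" and B: "\<And>\<omega>. \<omega> \<in> space M \<Longrightarrow> \<bar>\<zeta> \<omega>\<bar> \<le> B"
  shows "mixes A (\<lambda>\<omega>. of_real (\<zeta> \<omega>))"
proof -
  let ?N = "augmented_filtration M W T"
  have sp: "space ?N = space M" by simp
  \<comment> \<open>Extended by zero outside the space, because nonnegativity is required at every
    point.\<close>
  define u where "u \<omega> = (if \<omega> \<in> space M then \<zeta> \<omega> + B else 0)" for \<omega>
  have u: "u \<in> borel_measurable ?N"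
    using \<zeta> by (subst measurable_cong[where g = "\<lambda>\<omega>. \<zeta> \<omega> + B"]) (auto simp: u_def sp)
  have u0: "0 \<le> u \<omega>" for \<omega> using B[of \<omega>] by (auto simp: u_def abs_le_iff)
  \<comment> \<open>Boundedness is part of the induction claim: every case has to hand a bound down
    to its components before \<open>mixes\<close> can be asserted of them.\<close>
  have "(\<exists>C. \<forall>\<omega>\<in>space M. u \<omega> \<le> C) \<longrightarrow> mixes A (\<lambda>\<omega>. of_real (u \<omega>))"
    using u u0
  proof (induction rule: borel_measurable_induct_real)
    case (set X)
    then have "mixes A (indicator X)" using augmented_sets mixes_sigma_sets by blast
    moreover have "(\<lambda>\<omega>. complex_of_real (indicator X \<omega>)) = indicator X"
      by (auto simp: indicator_def)
    ultimately show ?case by simp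
  next
    case (mult u c)
    show ?case
    proof
      assume bd: "\<exists>C. \<forall>\<omega>\<in>space M. c * u \<omega> \<le> C"
      show "mixes A (\<lambda>\<omega>. of_real (c * u \<omega>))"
      \<comment> \<open>For c = 0 a bound on the product says nothing about u.\<close>
      proof (cases "c = 0")
        case True
        then show ?thesis using mixes_test_set[of "{}" A] by (simp add: test_sets_def indicator_def[abs_def])
      next
        case False
        obtain C where C: "\<forall>\<omega>\<in>space M. c * u \<omega> \<le> C" using bd by blast
        have "\<forall>\<omega>\<in>space M. u \<omega> \<le> C / c" using C False mult(1) by (auto simp: field_simps)
        then have "mixes A (\<lambda>\<omega>. of_real (u \<omega>))" using mult by blast
        from mixes_cmult[OF this, of "of_real c"] show ?thesis by simp
      qed
    qed
  next
    case (add u v)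
    show ?case
    proof
      assume "\<exists>C. \<forall>\<omega>\<in>space M. v \<omega> + u \<omega> \<le> C"
      then obtain C where C: "\<forall>\<omega>\<in>space M. v \<omega> + u \<omega> \<le> C" by blast
      have nonneg: "0 \<le> u \<omega>" "0 \<le> v \<omega>" for \<omega> by (rule add)+
      have "u \<omega> \<le> C" "v \<omega> \<le> C" if "\<omega> \<in> space M" for \<omega>
        using bspec[OF C that] nonneg[of \<omega>] by linarith+
      then have "mixes A (\<lambda>\<omega>. of_real (u \<omega>))" "mixes A (\<lambda>\<omega>. of_real (v \<omega>))" using add by blast+
      from mixes_add[OF this(2,1)] show "mixes A (\<lambda>\<omega>. of_real (v \<omega> + u \<omega>))" by simp
    qed
  next
    case (seq U)
    show ?case
    proof
      assume "\<exists>C. \<forall>\<omega>\<in>space M. u \<omega> \<le> C"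
      then obtain C where C: "\<forall>\<omega>\<in>space M. u \<omega> \<le> C" by blast
      have le: "U k \<omega> \<le> C" if "\<omega> \<in> space M" for k \<omega>
      proof -
        have "incseq U" by (rule seq)
        then have "incseq (\<lambda>i. U i \<omega>)" by (simp add: incseq_def le_fun_def)
        moreover have "(\<lambda>i. U i \<omega>) \<longlonglongrightarrow> u \<omega>" by (rule seq) (simp add: sp that)
        ultimately have "U k \<omega> \<le> u \<omega>" by (rule incseq_le)
        then show ?thesis using bspec[OF C that] by linarith
      qed
      show "mixes A (\<lambda>\<omega>. of_real (u \<omega>))"
      proof (rule mixes_lim)
        show "mixes A (\<lambda>\<omega>. of_real (U k \<omega>))" for k using seq.IH[of k] le by blast
        have "0 \<le> U k \<omega>" for k \<omega> by (rule seq)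
        then show "cmod (of_real (U k \<omega>)) \<le> C" if "\<omega> \<in> space M" for k \<omega>
          using le[OF that, of k] by simp
        show "(\<lambda>k. complex_of_real (U k \<omega>)) \<longlonglongrightarrow> of_real (u \<omega>)" if "\<omega> \<in> space M" for \<omega>
          by (intro tendsto_of_real seq) (simp add: sp that)
      qed
    qed
  qed
  moreover have "\<forall>\<omega>\<in>space M. u \<omega> \<le> B + B" using B by (auto simp: u_def abs_le_iff)
  ultimately have "mixes A (\<lambda>\<omega>. of_real (u \<omega>))" by blast
  moreover have "mixes A (\<lambda>_. 1)"
    using mixes_halfline_prod[of "[]" "[]" A] by (simp add: halfline_prod_def pairing_def)
  then have "mixes A (\<lambda>_. of_real (- B) * 1)" by (rule mixes_cmult)
  ultimately have "mixes A (\<lambda>\<omega>. of_real (u \<omega>) + of_real (- B) * 1)" by (rule mixes_add)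
  then show ?thesis by (rule mixes_cong[THEN iffD1, rotated]) (simp add: u_def)
qed

end

section \<open>Removal of the drift\<close>

text \<open>Deterministic, for use on each path separately: x is a coordinate of \<open>xi\<close>,
  t the block midpoints and e the drift recovered from the data. Vanishing averages against
  monomials extend to continuous weights because the mean squares of x are bounded.\<close>

lemma weighted_average_tendsto_zero:
  fixes x t e :: "nat \<Rightarrow> nat \<Rightarrow> real" and m :: "nat \<Rightarrow> nat"
  assumes mono: "\<And>k. (\<lambda>n. (\<Sum>p<m n. x n p * t n p ^ k) / real (m n)) \<longlonglongrightarrow> 0"
    and K: "\<And>n. (\<Sum>p<m n. (x n p)\<^sup>2) / real (m n) \<le> K"
    and t: "\<And>n p. p < m n \<Longrightarrow> t n p \<in> {0..T}"
    and g: "continuous_on {0..T} g"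
    and e: "\<And>n p. p < m n \<Longrightarrow> \<bar>e n p - g (t n p)\<bar> \<le> \<epsilon> n" and \<epsilon>: "\<epsilon> \<longlonglongrightarrow> 0"
  shows "(\<lambda>n. (\<Sum>p<m n. x n p * e n p) / real (m n)) \<longlonglongrightarrow> 0"
proof -
  \<comment> \<open>From \<bar>x\<bar> \<le> 1 + x^2; the average of the ones is 1, or 0 when there
    is no block.\<close>
  have abs: "\<bar>(\<Sum>p<m n. x n p * f p) / real (m n)\<bar> \<le> (1 + K) * r" if f: "\<And>p. p < m n \<Longrightarrow> \<bar>f p\<bar> \<le> r" and "0 \<le> r" for n f r
  proof -
    have "\<bar>\<Sum>p<m n. x n p * f p\<bar> \<le> (\<Sum>p<m n. (1 + (x n p)\<^sup>2) * r)"
    proof (rule order_trans[OF sum_abs sum_mono])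
      fix p assume "p \<in> {..<m n}"
      then have fp: "\<bar>f p\<bar> \<le> r" using f by simp
      have "2 * \<bar>x n p\<bar> \<le> 1 + (x n p)\<^sup>2"
        using zero_le_power2[of "\<bar>x n p\<bar> - 1"] by (simp add: power2_diff)
      then have "\<bar>x n p\<bar> \<le> 1 + (x n p)\<^sup>2" by simp
      then show "\<bar>x n p * f p\<bar> \<le> (1 + (x n p)\<^sup>2) * r"
        unfolding abs_mult using fp by (intro mult_mono) auto
    qed
    also have "\<dots> = (real (m n) + (\<Sum>p<m n. (x n p)\<^sup>2)) * r"
      by (simp add: sum.distrib sum_distrib_right[symmetric])
    finally have "\<bar>\<Sum>p<m n. x n p * f p\<bar> / real (m n) \<le> (real (m n) + (\<Sum>p<m n. (x n p)\<^sup>2)) * r / real (m n)"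
      by (rule divide_right_mono) simp
    also have "\<dots> = (real (m n) / real (m n) + (\<Sum>p<m n. (x n p)\<^sup>2) / real (m n)) * r"
      by (cases "m n = 0") (simp_all add: field_simps)
    also have "\<dots> \<le> (1 + K) * r"
      using K[of n] \<open>0 \<le> r\<close> by (intro mult_right_mono add_mono) auto
    finally show ?thesis by simp
  qed
  have poly: "(\<lambda>n. (\<Sum>p<m n. x n p * q (t n p)) / real (m n)) \<longlonglongrightarrow> 0" if q: "real_polynomial_function q" for q
  proof -
    obtain a N where q: "q = (\<lambda>s. \<Sum>i\<le>N. a i * s ^ i)"
      using q unfolding real_polynomial_function_iff_sum by blast
    have "(\<Sum>p<m n. x n p * q (t n p)) / real (m n) = (\<Sum>i\<le>N. a i * ((\<Sum>p<m n. x n p * t n p ^ i) / real (m n)))" for n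
    proof -
      have "(\<Sum>p<m n. x n p * q (t n p)) = (\<Sum>p<m n. \<Sum>i\<le>N. a i * (x n p * t n p ^ i))"
        unfolding q by (simp add: sum_distrib_left ac_simps)
      also have "\<dots> = (\<Sum>i\<le>N. a i * (\<Sum>p<m n. x n p * t n p ^ i))"
        by (subst sum.swap) (simp add: sum_distrib_left)
      finally show ?thesis by (simp only: sum_divide_distrib[of _ "{..N}"] times_divide_eq_right)
    qed
    moreover have "(\<lambda>n. \<Sum>i\<le>N. a i * ((\<Sum>p<m n. x n p * t n p ^ i) / real (m n))) \<longlonglongrightarrow> (\<Sum>i\<le>N. a i * 0)"
      by (intro tendsto_sum tendsto_mult tendsto_const mono)
    ultimately show ?thesis by simp
  qed
  have "\<forall>j. \<exists>q. real_polynomial_function q \<and> (\<forall>s\<in>{0..T}. \<bar>g s - q s\<bar> < 1 / real (Suc j))"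
  proof
    fix j
    show "\<exists>q. real_polynomial_function q \<and> (\<forall>s\<in>{0..T}. \<bar>g s - q s\<bar> < 1 / real (Suc j))"
      by (rule Stone_Weierstrass_real_polynomial_function[OF compact_Icc g, of "1 / real (Suc j)"]) auto
  qed
  from choice[OF this] obtain q where q: "\<And>j. real_polynomial_function (q j)"
    "\<And>j s. s \<in> {0..T} \<Longrightarrow> \<bar>g s - q j s\<bar> < 1 / real (Suc j)" by blast
  have 1: "(\<lambda>n. (\<Sum>p<m n. x n p * g (t n p)) / real (m n)) \<longlonglongrightarrow> 0"
  proof (rule tendsto_of_uniform_approx[OF poly[OF q(1)]])
    show "(\<lambda>j. (1 + K) * (1 / real (Suc j))) \<longlonglongrightarrow> 0"
      by (intro tendsto_mult_right_zero lim_1_over_n[THEN LIMSEQ_Suc])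
    fix j n
    have "(\<Sum>p<m n. x n p * g (t n p)) / real (m n) - (\<Sum>p<m n. x n p * q j (t n p)) / real (m n)
        = (\<Sum>p<m n. x n p * (g (t n p) - q j (t n p))) / real (m n)"
      by (simp add: right_diff_distrib sum_subtractf diff_divide_distrib)
    then show "norm ((\<Sum>p<m n. x n p * g (t n p)) / real (m n) - (\<Sum>p<m n. x n p * q j (t n p)) / real (m n)) \<le> (1 + K) * (1 / real (Suc j))"
      using abs[of n "\<lambda>p. g (t n p) - q j (t n p)" "1 / real (Suc j)"] less_imp_le[OF q(2)[OF t]] by simp
  qed
  have 2: "(\<lambda>n. (\<Sum>p<m n. x n p * (e n p - g (t n p))) / real (m n)) \<longlonglongrightarrow> 0"
  proof (rule Lim_null_comparison)
    show "(\<lambda>n. (1 + K) * \<bar>\<epsilon> n\<bar>) \<longlonglongrightarrow> 0" by (intro tendsto_mult_right_zero tendsto_rabs_zero \<epsilon>)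
    have "\<bar>e n p - g (t n p)\<bar> \<le> \<bar>\<epsilon> n\<bar>" if "p < m n" for n p using e[OF that] by linarith
    then show "\<forall>\<^sub>F n in sequentially. norm ((\<Sum>p<m n. x n p * (e n p - g (t n p))) / real (m n)) \<le> (1 + K) * \<bar>\<epsilon> n\<bar>"
      using abs by (intro always_eventually allI) (simp only: real_norm_def abs_ge_zero)
  qed
  have eq: "(\<Sum>p<m n. x n p * e n p) / real (m n)
      = (\<Sum>p<m n. x n p * g (t n p)) / real (m n) + (\<Sum>p<m n. x n p * (e n p - g (t n p))) / real (m n)" for n
    by (simp add: right_diff_distrib sum_subtractf diff_divide_distrib)
  show ?thesis unfolding eq by (rule tendsto_add_zero[OF 1 2])
qed

text \<open>The drift contributes to the second difference of the position only through \<open>h\<^sup>2\<close> times its value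
  in the middle of the block.\<close>

lemma second_diff_expansion:
  fixes X Y w b :: "real \<Rightarrow> real^'d" and \<sigma> :: "real^'d^'d"
  assumes w: "continuous_on {0..} w" and b: "continuous_on {0..} b"
    and X: "\<And>t. 0 \<le> t \<Longrightarrow> X t = x0 + integral {0..t} Y"
    and Y: "\<And>t. 0 \<le> t \<Longrightarrow> Y t = y0 + \<sigma> *v w t - integral {0..t} b"
    and h: "0 < h" and c: "c = (2 * real p + 2) * h"
    and \<epsilon>: "\<And>s. s \<in> {c - h..c + h} \<Longrightarrow> norm (b s - b c) \<le> \<epsilon>"
  shows "norm (second_diff X h (Suc p) - (\<sigma> *v (integral {c..c + h} w - integral {c - h..c} w) - h\<^sup>2 *\<^sub>R b c)) \<le> 2 * h\<^sup>2 * \<epsilon>"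
proof -
  define B where "B t = integral {0..t} b" for t
  have ch: "0 \<le> c - h" using h by (simp add: c algebra_simps)
  have int_b: "b integrable_on {s..t}" and int_w: "w integrable_on {s..t}" if "0 \<le> s" for s t
    using that by (auto intro!: integrable_continuous_interval continuous_on_subset[OF b] continuous_on_subset[OF w])
  have B_diff: "B t - B s = integral {s..t} b" if "0 \<le> s" "s \<le> t" for s t
    using Henstock_Kurzweil_Integration.integral_combine[OF that int_b] by (simp add: B_def algebra_simps)
  have contB: "continuous_on {s..t} B" if "0 \<le> s" for s t
  proof -
    have "continuous_on {0..max 0 t} B" unfolding B_def by (rule indefinite_integral_continuous_1[OF int_b]) simp
    then show ?thesis by (rule continuous_on_subset) (use that in auto)
  qed
  have int_B: "B integrable_on {s..t}" if "0 \<le> s" for s t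
    by (rule integrable_continuous_interval[OF contB[OF that]])
  have int_sw: "(\<lambda>s. \<sigma> *v w s) integrable_on {s..t}" and sw: "integral {s..t} (\<lambda>s. \<sigma> *v w s) = \<sigma> *v integral {s..t} w" if "0 \<le> s" for s t
  proof -
    have bl: "bounded_linear ((*v) \<sigma>)" by (rule matrix_vector_mul_bounded_linear)
    show "(\<lambda>s. \<sigma> *v w s) integrable_on {s..t}" using integrable_linear[OF int_w[OF that] bl] by (simp add: o_def)
    show "integral {s..t} (\<lambda>s. \<sigma> *v w s) = \<sigma> *v integral {s..t} w"
      using integral_linear[OF int_w[OF that] bl] by (simp add: o_def)
  qed
  have Y_int: "integral {s..t} Y = (t - s) *\<^sub>R y0 + \<sigma> *v integral {s..t} w - integral {s..t} B"
    and Y_on: "Y integrable_on {s..t}" if "0 \<le> s" "s \<le> t" for s t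
  proof -
    have eq: "Y u = y0 + \<sigma> *v w u - B u" if "u \<in> {s..t}" for u using that \<open>0 \<le> s\<close> by (simp add: Y B_def)
    have "((\<lambda>u. y0 + \<sigma> *v w u - B u) has_integral ((t - s) *\<^sub>R y0 + \<sigma> *v integral {s..t} w - integral {s..t} B)) {s..t}"
      using that int_sw[OF that(1), of t] int_B[OF that(1), of t] unfolding sw[OF that(1), symmetric]
      by (intro has_integral_diff has_integral_add integrable_integral)
        (use has_integral_const_real[of y0 s t] that in auto)
    then have "(Y has_integral ((t - s) *\<^sub>R y0 + \<sigma> *v integral {s..t} w - integral {s..t} B)) {s..t}"
      by (rule has_integral_eq[rotated]) (simp add: eq)
    then show "integral {s..t} Y = (t - s) *\<^sub>R y0 + \<sigma> *v integral {s..t} w - integral {s..t} B" "Y integrable_on {s..t}"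
      by (auto simp: integral_unique has_integral_integrable)
  qed
  have X_diff: "X t - X s = integral {s..t} Y" if "0 \<le> s" "s \<le> t" for s t
    using Henstock_Kurzweil_Integration.integral_combine[OF that Y_on] that by (simp add: X algebra_simps)
  \<comment> \<open>The index \<open>Suc p\<close> centres the difference at c = 2 (p + 1) h.
    Forming increments removes x0, and subtracting the two halves removes y0.\<close>
  have "second_diff X h (Suc p) = (X (c + h) - X c) - (X c - X (c - h))"
    by (simp add: second_diff_def c algebra_simps scaleR_2)
  also have "\<dots> = integral {c..c + h} Y - integral {c - h..c} Y"
    using X_diff[of c "c + h"] X_diff[of "c - h" c] ch h by simp
  also have "\<dots> = \<sigma> *v (integral {c..c + h} w - integral {c - h..c} w) - (integral {c..c + h} B - integral {c - h..c} B)"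
    using Y_int[of c "c + h"] Y_int[of "c - h" c] ch h by (simp add: matrix_vector_mult_diff_distrib)
  finally have *: "second_diff X h (Suc p) - (\<sigma> *v (integral {c..c + h} w - integral {c - h..c} w) - h\<^sup>2 *\<^sub>R b c)
      = h\<^sup>2 *\<^sub>R b c - (integral {c..c + h} B - integral {c - h..c} B)" by simp
  \<comment> \<open>The first-order expansion of B at c. Its integrals over the two halves differ by
    exactly h^2 \<open>b c\<close>: the constant parts cancel and the linear parts contribute h^2 /
    2 each. The remainder is at most h \<epsilon> pointwise, hence h^2 \<epsilon> per half.\<close>
  define L where "L t = B c + (t - c) *\<^sub>R b c" for t
  have BL: "norm (B t - L t) \<le> h * \<epsilon>" if "t \<in> {c - h..c + h}" for t
  proof -
    have \<epsilon>0: "0 \<le> \<epsilon>" using \<epsilon>[of c] h by (simp add: order_trans[OF norm_ge_zero])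
    have seg: "norm (integral {u..v} b - (v - u) *\<^sub>R b c) \<le> h * \<epsilon>" if uv: "c - h \<le> u" "u \<le> v" "v \<le> c + h" "v - u \<le> h" for u v
    proof -
      have i: "b integrable_on {u..v}" using uv ch by (intro int_b) simp
      have "norm (integral {u..v} (\<lambda>s. b s - b c)) \<le> \<epsilon> * (v - u)"
        by (rule integral_bound) (use uv ch \<epsilon> in \<open>auto intro!: continuous_intros continuous_on_subset[OF b]\<close>)
      also have "\<dots> \<le> h * \<epsilon>" unfolding mult.commute[of h] using uv \<epsilon>0 by (intro mult_left_mono)
      finally have "norm (integral {u..v} (\<lambda>s. b s - b c)) \<le> h * \<epsilon>" .
      moreover have "integral {u..v} (\<lambda>s. b s - b c) = integral {u..v} b - (v - u) *\<^sub>R b c"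
        using i uv by (subst Henstock_Kurzweil_Integration.integral_diff) auto
      ultimately show ?thesis by simp
    qed
    show ?thesis
    proof (cases "c \<le> t")
      case True
      have "B t - L t = integral {c..t} b - (t - c) *\<^sub>R b c" using B_diff[of c t] True ch h by (simp add: L_def algebra_simps)
      then show ?thesis using seg[of c t] True that h by simp
    next
      case False
      have "B t - L t = - (integral {t..c} b - (c - t) *\<^sub>R b c)"
        using B_diff[of t c] False ch that by (simp add: L_def algebra_simps)
      then show ?thesis using seg[of t c] False that h by (simp only: norm_minus_cancel) simp
    qed
  qed
  have L_int: "integral {c..c + h} L - integral {c - h..c} L = h\<^sup>2 *\<^sub>R b c"
  proof -
    have prim: "((\<lambda>s. (s - c)\<^sup>2 / 2) has_vector_derivative (t - c)) (at t within S)" for t S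
      by (auto intro!: derivative_eq_intros simp: has_real_derivative_iff_has_vector_derivative[symmetric])
    have "((\<lambda>t. t - c) has_integral ((v - c)\<^sup>2 / 2 - (u - c)\<^sup>2 / 2)) {u..v}" if "u \<le> v" for u v
      by (rule fundamental_theorem_of_calculus[OF that prim])
    then have "(L has_integral ((v - u) *\<^sub>R B c + ((v - c)\<^sup>2 / 2 - (u - c)\<^sup>2 / 2) *\<^sub>R b c)) {u..v}" if "u \<le> v" for u v
      unfolding L_def using that has_integral_const_real[of "B c" u v]
      by (intro has_integral_add has_integral_scaleR_left) auto
    then have "integral {u..v} L = (v - u) *\<^sub>R B c + ((v - c)\<^sup>2 / 2 - (u - c)\<^sup>2 / 2) *\<^sub>R b c" if "u \<le> v" for u v
      using that by (blast intro: integral_unique)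
    from this[of c "c + h"] this[of "c - h" c] h show ?thesis
      by (simp add: scaleR_left_distrib[symmetric])
  qed
  have bound: "norm (integral {u..v} B - integral {u..v} L) \<le> h * (h * \<epsilon>)" if uv: "c - h \<le> u" "u \<le> v" "v \<le> c + h" "v - u = h" for u v
  proof -
    have contL: "continuous_on {u..v} L" unfolding L_def by (intro continuous_intros)
    have "norm (integral {u..v} (\<lambda>s. B s - L s)) \<le> h * \<epsilon> * (v - u)"
      by (rule integral_bound) (use uv ch BL contL in \<open>auto intro!: continuous_intros contB\<close>)
    moreover have "integral {u..v} (\<lambda>s. B s - L s) = integral {u..v} B - integral {u..v} L"
      using uv ch contL by (intro Henstock_Kurzweil_Integration.integral_diff int_B integrable_continuous_interval) auto
    ultimately show ?thesis using uv by (simp add: mult.commute)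
  qed
  have "norm (h\<^sup>2 *\<^sub>R b c - (integral {c..c + h} B - integral {c - h..c} B))
      = norm ((integral {c - h..c} B - integral {c - h..c} L) - (integral {c..c + h} B - integral {c..c + h} L))"
    unfolding L_int[symmetric] by (simp add: algebra_simps)
  also have "\<dots> \<le> h * (h * \<epsilon>) + h * (h * \<epsilon>)"
    by (rule order_trans[OF norm_triangle_ineq4 add_mono[OF bound bound]]) (use h in auto)
  also have "\<dots> = 2 * h\<^sup>2 * \<epsilon>" by (simp add: power2_eq_square)
  finally show ?thesis unfolding * .
qed

text \<open>Valid for every step, so that a summable h gives summable second moments from the first
  index on: if there are few or no blocks, the right side exceeds 1, while the left side is at most
  1 and is 0 for an empty count.\<close>

lemma inverse_block_count_le:
  assumes "0 < T" "0 < h"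
  shows "1 / real (block_count T h) \<le> 8 * h / T"
proof (cases "4 \<le> T / (2 * h)")
  case True
  then have "0 < T / (2 * h) / 2" "T / (2 * h) / 2 \<le> real (block_count T h)"
    using block_count_bounds(1)[OF assms(2)] by auto
  then have "1 / real (block_count T h) \<le> 1 / (T / (2 * h) / 2)"
    by (intro divide_left_mono mult_pos_pos) (auto intro: less_le_trans)
  also have "\<dots> = 4 * h / T" by simp
  also have "\<dots> \<le> 8 * h / T" using assms by (simp add: divide_right_mono)
  finally show ?thesis .
next
  case False
  then have "T < 8 * h" using assms by (simp add: field_simps)
  then have "1 \<le> 8 * h / T" using assms by simp
  moreover have "1 / real n \<le> 1" for n by (cases n) auto
  ultimately show ?thesis using order_trans by blast
qed

text \<open>Only the diagonal terms survive. Used with Y a coordinate of \<open>xi\<close>, its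
  centered square, and a quadratic form in \<open>xi\<close>.\<close>

lemma (in prob_space) orthogonal_average:
  fixes Y :: "nat \<Rightarrow> 'a \<Rightarrow> real"
  assumes int: "\<And>p q. integrable M (\<lambda>\<omega>. Y p \<omega> * Y q \<omega>)"
    and orth: "\<And>p q. expectation (\<lambda>\<omega>. Y p \<omega> * Y q \<omega>) = of_bool (p = q) * v"
    and \<tau>: "\<And>p. p < m \<Longrightarrow> \<bar>\<tau> p\<bar> \<le> C"
  shows "integrable M (\<lambda>\<omega>. ((\<Sum>p<m. Y p \<omega> * \<tau> p) / real m)\<^sup>2)"
    "expectation (\<lambda>\<omega>. ((\<Sum>p<m. Y p \<omega> * \<tau> p) / real m)\<^sup>2) \<le> C\<^sup>2 * v * (1 / real m)"
proof -
  have eq: "((\<Sum>p<m. Y p \<omega> * \<tau> p) / real m)\<^sup>2 = (\<Sum>p<m. \<Sum>q<m. \<tau> p * \<tau> q * (Y p \<omega> * Y q \<omega>)) / (real m)\<^sup>2" for \<omega>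
    unfolding power_divide power2_eq_square[of "\<Sum>p<m. Y p \<omega> * \<tau> p"] sum_product by (simp add: ac_simps)
  show "integrable M (\<lambda>\<omega>. ((\<Sum>p<m. Y p \<omega> * \<tau> p) / real m)\<^sup>2)"
    unfolding eq using int by simp
  have v: "0 \<le> v"
    using orth[of 0 0] Bochner_Integration.integral_nonneg[of M "\<lambda>\<omega>. Y 0 \<omega> * Y 0 \<omega>"] by simp
  have "expectation (\<lambda>\<omega>. ((\<Sum>p<m. Y p \<omega> * \<tau> p) / real m)\<^sup>2) = (\<Sum>p<m. \<Sum>q<m. \<tau> p * \<tau> q * (of_bool (p = q) * v)) / (real m)\<^sup>2"
    unfolding eq using int by (simp add: orth)
  also have "(\<Sum>p<m. \<Sum>q<m. \<tau> p * \<tau> q * (of_bool (p = q) * v)) = (\<Sum>p<m. (\<tau> p)\<^sup>2 * v)"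
  proof (rule sum.cong[OF refl])
    fix p assume "p \<in> {..<m}"
    have "\<tau> p * \<tau> q * (of_bool (p = q) * v) = (if p = q then (\<tau> p)\<^sup>2 * v else 0)" for q
      by (simp add: power2_eq_square)
    then show "(\<Sum>q<m. \<tau> p * \<tau> q * (of_bool (p = q) * v)) = (\<tau> p)\<^sup>2 * v"
      using \<open>p \<in> {..<m}\<close> by simp
  qed
  also have "\<dots> \<le> (\<Sum>p<m. C\<^sup>2 * v)"
  proof (rule sum_mono)
    fix p assume "p \<in> {..<m}"
    then have "\<bar>\<tau> p\<bar>\<^sup>2 \<le> C\<^sup>2" using \<tau> by (intro power_mono) auto
    then show "(\<tau> p)\<^sup>2 * v \<le> C\<^sup>2 * v" using v by (simp add: mult_right_mono)
  qed
  also have "(\<Sum>p<m. C\<^sup>2 * v) / (real m)\<^sup>2 = C\<^sup>2 * v * (1 / real m)"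
    by (simp add: power2_eq_square)
  finally show "expectation (\<lambda>\<omega>. ((\<Sum>p<m. Y p \<omega> * \<tau> p) / real m)\<^sup>2) \<le> C\<^sup>2 * v * (1 / real m)"
    by (simp add: divide_right_mono)
qed

text \<open>The estimator omits one block, so even one step beyond the end (2 p + 3) h of block p
  stays within the observation window.\<close>

lemma block_time_le:
  assumes "0 < h" "p < block_count T h"
  shows "(2 * real p + 4) * h \<le> T"
proof -
  have "real (block_count T h) \<le> T / (2 * h) - 1"
    using assms(2) of_int_floor_le[of "T / (2 * h)"] unfolding block_count_def by linarith
  moreover have "real p + 1 \<le> real (block_count T h)" using assms(2) by linarith
  ultimately have "(real p + 2) * (2 * h) \<le> T / (2 * h) * (2 * h)" using assms(1) by (intro mult_right_mono) auto
  then show ?thesis using assms(1) by (simp add: algebra_simps)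
qed

text \<open>The summation index is shifted to start at zero. For a negative integer count the
  prefactors of the two sides differ, but both sums are empty.\<close>

lemma sigma2_hat_eq:
  fixes x :: "real \<Rightarrow> real^'d"
  shows "sigma2_hat T h x = (1 / real (block_count T h) * (3 / (2 * h ^ 3))) *\<^sub>R
    (\<Sum>p<block_count T h. outer_prod (second_diff x h (Suc p)) (second_diff x h (Suc p)))"
proof -
  define m where "m = \<lfloor>T / (2 * h)\<rfloor> - 1"
  have "(\<Sum>p = 1..nat m. f p) = (\<Sum>p<nat m. f (Suc p))" for f :: "nat \<Rightarrow> real^'d^'d"
    by (rule sum.reindex_bij_witness[of _ Suc "\<lambda>p. p - 1"]) auto
  then show ?thesis
    by (cases "0 \<le> m") (simp_all add: sigma2_hat_def block_count_def m_def[symmetric] Let_def)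
qed

lemma modulus_of_continuity:
  fixes b :: "real \<Rightarrow> 'a::real_normed_vector"
  assumes b: "continuous_on {0..T} b" and h: "h \<longlonglongrightarrow> 0" "\<And>n. 0 < h n" and T: "0 \<le> T"
  obtains \<epsilon> where "\<epsilon> \<longlonglongrightarrow> (0::real)"
    "\<And>n s c. s \<in> {0..T} \<Longrightarrow> c \<in> {0..T} \<Longrightarrow> \<bar>s - c\<bar> \<le> h n \<Longrightarrow> norm (b s - b c) \<le> \<epsilon> n"
proof -
  define A where "A n = {norm (b s - b c) | s c. s \<in> {0..T} \<and> c \<in> {0..T} \<and> \<bar>s - c\<bar> \<le> h n}" for n
  have "compact (b ` {0..T})" by (rule compact_continuous_image[OF b]) simp
  then obtain C where C: "\<And>s. s \<in> {0..T} \<Longrightarrow> norm (b s) \<le> C"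
    by (meson bounded_iff compact_imp_bounded imageI)
  have bdd: "bdd_above (A n)" for n
  proof (rule bdd_aboveI)
    fix x assume "x \<in> A n"
    then obtain s c where "x = norm (b s - b c)" "s \<in> {0..T}" "c \<in> {0..T}" by (auto simp: A_def)
    then show "x \<le> C + C" using order_trans[OF norm_triangle_ineq4 add_mono[OF C C]] by blast
  qed
  have ne: "norm (b 0 - b 0) \<in> A n" for n
    unfolding A_def using T h(2)[of n] by (intro CollectI exI[of _ 0]) auto
  have le: "norm (b s - b c) \<le> Sup (A n)" if "s \<in> {0..T}" "c \<in> {0..T}" "\<bar>s - c\<bar> \<le> h n" for s c n
    by (rule cSup_upper[OF _ bdd]) (use that in \<open>auto simp: A_def\<close>)
  have "(\<lambda>n. Sup (A n)) \<longlonglongrightarrow> 0"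
  proof (rule LIMSEQ_I)
    fix r :: real assume r: "0 < r"
    have "uniformly_continuous_on {0..T} b" by (rule compact_uniformly_continuous[OF b]) simp
    then obtain d where d: "0 < d" "\<And>s c. c \<in> {0..T} \<Longrightarrow> s \<in> {0..T} \<Longrightarrow> dist s c < d \<Longrightarrow> dist (b s) (b c) < r / 2"
      using r unfolding uniformly_continuous_on_def by (meson half_gt_zero)
    obtain N where N: "\<And>n. n \<ge> N \<Longrightarrow> h n < d"
      using order_tendstoD(2)[OF h(1) d(1)] by (auto simp: eventually_sequentially)
    have "norm (Sup (A n) - 0) < r" if "n \<ge> N" for n
    proof -
      have "Sup (A n) \<le> r / 2"
      proof (rule cSup_least)
        show "A n \<noteq> {}" using ne by blast
        fix x assume "x \<in> A n"
        then obtain s c where x: "x = norm (b s - b c)" "s \<in> {0..T}" "c \<in> {0..T}" "\<bar>s - c\<bar> \<le> h n"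
          by (auto simp: A_def)
        then have "dist s c < d" using N[OF that] by (simp add: dist_real_def)
        from d(2)[OF x(3,2) this] show "x \<le> r / 2" by (simp add: x dist_norm)
      qed
      moreover have "0 \<le> Sup (A n)" using cSup_upper[OF ne bdd] by simp
      ultimately show ?thesis using r by simp
    qed
    then show "\<exists>no. \<forall>n\<ge>no. norm (Sup (A n) - 0) < r" by blast
  qed
  then show ?thesis using le that by blast
qed

text \<open>Coercivity makes the kernel trivial, hence \<sigma> invertible; transposing the inverse
  relation and using the symmetry of \<sigma> identifies the transposed inverse with the
  inverse.\<close>

lemma matrix_inv_H0:
  assumes "hyp_H0 (\<sigma> :: real^'d^'d)"
  shows "matrix_inv \<sigma> ** \<sigma> = mat 1" "transpose (matrix_inv \<sigma>) = matrix_inv \<sigma>"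
proof -
  obtain s where s: "0 < s" "\<And>v. s * (v \<bullet> v) \<le> v \<bullet> (\<sigma> *v v)"
    using assms by (auto simp: hyp_H0_def qform_ge_def scaleR_matrix_vector_assoc[symmetric])
  have "v = 0" if "\<sigma> *v v = 0" for v
  proof -
    have "s * (v \<bullet> v) \<le> 0" using s(2)[of v] that by simp
    then have "v \<bullet> v \<le> 0" using s(1) by (simp add: mult_le_0_iff)
    then show ?thesis by (metis inner_gt_zero_iff not_le)
  qed
  then have "\<exists>B. B ** \<sigma> = mat 1" using matrix_left_invertible_ker by blast
  then have inv: "invertible \<sigma>"
    by (metis invertible_def matrix_left_right_inverse)
  then have "\<sigma> ** matrix_inv \<sigma> = mat 1 \<and> matrix_inv \<sigma> ** \<sigma> = mat 1"
    unfolding matrix_inv_def invertible_def by (rule someI_ex)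
  then show 1: "matrix_inv \<sigma> ** \<sigma> = mat 1" by simp
  have "transpose \<sigma> ** transpose (matrix_inv \<sigma>) = mat 1"
    using arg_cong[OF 1, of transpose] by (simp add: matrix_transpose_mul transpose_mat)
  then have "\<sigma> ** transpose (matrix_inv \<sigma>) = mat 1" using assms by (simp add: hyp_H0_def)
  then have "matrix_inv \<sigma> ** (\<sigma> ** transpose (matrix_inv \<sigma>)) = matrix_inv \<sigma>" by simp
  then show "transpose (matrix_inv \<sigma>) = matrix_inv \<sigma>"
    unfolding matrix_mul_assoc 1 by simp
qed

lemma sandwich_outer_prod:
  fixes S :: "real^'d^'d"
  assumes "transpose S = S"
  shows "S ** outer_prod a b ** S = outer_prod (S *v a) (S *v b)"
proof -
  have S: "S $ i $ j = S $ j $ i" for i j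
    using arg_cong[OF assms, of "\<lambda>A. A $ j $ i"] by (simp add: transpose_def)
  show ?thesis
    by (simp add: vec_eq_iff outer_prod_def matrix_matrix_mult_def matrix_vector_mult_def S[of _ "_ :: 'd"]
        sum_distrib_left sum_distrib_right) 
      (simp add: ac_simps)
qed

section \<open>Almost sure vanishing of the drift contribution\<close>

context brownian_sampling
begin

text \<open>Orthogonality of the blocks bounds the second moments by a multiple of h n, which is
  summable. There are countably many exponents and finitely many coordinates, so one null set serves
  them all.\<close>

lemma AE_averages:
  assumes sm: "summable h"
  shows "AE \<omega> in M. \<forall>i. (\<forall>k. (\<lambda>n. (\<Sum>p<block_count T (h n). xi (h n) p \<omega> $ i * ((2 * real p + 2) * h n) ^ k) / real (block_count T (h n))) \<longlonglongrightarrow> 0)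
    \<and> (\<exists>K. \<forall>n. (\<Sum>p<block_count T (h n). (xi (h n) p \<omega> $ i)\<^sup>2) / real (block_count T (h n)) \<le> K)"
proof -
  have le: "\<bar>((2 * real p + 2) * h n) ^ k\<bar> \<le> T ^ k" if "p < block_count T (h n)" for p n k
  proof -
    have "(2 * real p + 2) * h n \<le> (2 * real p + 4) * h n" using h(1)[of n] by (intro mult_right_mono) auto
    then have "(2 * real p + 2) * h n \<le> T" using block_time_le[OF h(1) that] by linarith
    moreover have "0 \<le> (2 * real p + 2) * h n" using h(1)[of n] by simp
    ultimately show ?thesis by (simp add: power_abs power_mono)
  qed
  have avg: "AE \<omega> in M. (\<lambda>n. (\<Sum>p<block_count T (h n). Y n p \<omega> * \<tau> n p) / real (block_count T (h n))) \<longlonglongrightarrow> 0"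
    if Y: "\<And>n p q. integrable M (\<lambda>\<omega>. Y n p \<omega> * Y n q \<omega>)"
      "\<And>n p q. expectation (\<lambda>\<omega>. Y n p \<omega> * Y n q \<omega>) = of_bool (p = q) * v"
      "\<And>n p. Y n p \<in> borel_measurable M" "0 \<le> v"
      and \<tau>: "\<And>n p. p < block_count T (h n) \<Longrightarrow> \<bar>\<tau> n p\<bar> \<le> C" for Y \<tau> v C
  proof (rule AE_tendsto_zero_of_summable_second_moments)
    note [measurable] = Y(3)
    show "(\<lambda>\<omega>. (\<Sum>p<block_count T (h n). Y n p \<omega> * \<tau> n p) / real (block_count T (h n))) \<in> borel_measurable M" for n
      by measurable
    show "integrable M (\<lambda>\<omega>. ((\<Sum>p<block_count T (h n). Y n p \<omega> * \<tau> n p) / real (block_count T (h n)))\<^sup>2)" for n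
      by (rule orthogonal_average(1)[OF Y(1,2) \<tau>])
    show "expectation (\<lambda>\<omega>. ((\<Sum>p<block_count T (h n). Y n p \<omega> * \<tau> n p) / real (block_count T (h n)))\<^sup>2) \<le> C\<^sup>2 * v * (8 * h n / T)" for n
      by (rule order_trans[OF orthogonal_average(2)[OF Y(1,2) \<tau>]
            mult_left_mono[OF inverse_block_count_le[OF T h(1)]]]) (use Y(4) in auto)
    show "summable (\<lambda>n. C\<^sup>2 * v * (8 * h n / T))"
      by (intro summable_mult summable_divide sm)
  qed
  have [measurable]: "(\<lambda>\<omega>. xi (h n) p \<omega> $ i) \<in> borel_measurable M" for n p i
    using xi_moments(1)[OF h(1)[of n], of p i 1] by simp
  have 1: "AE \<omega> in M. (\<lambda>n. (\<Sum>p<block_count T (h n). xi (h n) p \<omega> $ i * ((2 * real p + 2) * h n) ^ k) / real (block_count T (h n))) \<longlonglongrightarrow> 0" for i k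
    by (rule avg[of "\<lambda>n p \<omega>. xi (h n) p \<omega> $ i" 1 "\<lambda>n p. ((2 * real p + 2) * h n) ^ k" "T ^ k"]) (use xi_covariance[OF h(1)] le in auto)
  \<comment> \<open>The squares are treated in the same way after centering; 2 is the variance of
    the square of a standard normal variable.\<close>
  have 2: "AE \<omega> in M. (\<lambda>n. (\<Sum>p<block_count T (h n). (xi (h n) p \<omega> $ i * xi (h n) p \<omega> $ i - 1) * 1) / real (block_count T (h n))) \<longlonglongrightarrow> 0" for i
    by (rule avg[of "\<lambda>n p \<omega>. xi (h n) p \<omega> $ i * xi (h n) p \<omega> $ i - 1" 2 "\<lambda>_ _. 1" 1])
      (use xi_wick[OF h(1), of _ _ i i _ i i] in auto)
  have "AE \<omega> in M. \<forall>i k. (\<lambda>n. (\<Sum>p<block_count T (h n). xi (h n) p \<omega> $ i * ((2 * real p + 2) * h n) ^ k) / real (block_count T (h n))) \<longlonglongrightarrow> 0"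
    using 1 by (simp add: AE_all_countable)
  moreover have "AE \<omega> in M. \<forall>i. (\<lambda>n. (\<Sum>p<block_count T (h n). (xi (h n) p \<omega> $ i * xi (h n) p \<omega> $ i - 1) * 1) / real (block_count T (h n))) \<longlonglongrightarrow> 0"
    using 2 by (simp add: AE_all_countable)
  ultimately show ?thesis
  proof eventually_elim
    case (elim \<omega>)
    have "\<exists>K. \<forall>n. (\<Sum>p<block_count T (h n). (xi (h n) p \<omega> $ i)\<^sup>2) / real (block_count T (h n)) \<le> K" for i
    proof -
      let ?a = "\<lambda>n. (\<Sum>p<block_count T (h n). (xi (h n) p \<omega> $ i * xi (h n) p \<omega> $ i - 1) * 1) / real (block_count T (h n))"
      have "Bseq ?a" using elim(2) by (blast intro: convergent_imp_Bseq convergentI)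
      then obtain K where K: "\<And>n. norm (?a n) \<le> K" by (auto simp: Bseq_def)
      \<comment> \<open>The count divided by itself is 1, or 0 when there is no block; in either
        case the bound is K + 1.\<close>
      have "(\<Sum>p<block_count T (h n). (xi (h n) p \<omega> $ i)\<^sup>2) / real (block_count T (h n)) = ?a n + real (block_count T (h n)) / real (block_count T (h n))" for n
        by (simp add: sum_subtractf power2_eq_square diff_divide_distrib)
      moreover have "?a n + real (block_count T (h n)) / real (block_count T (h n)) \<le> K + 1" for n
      proof (rule add_mono)
        show "?a n \<le> K" using K[of n] unfolding real_norm_def by linarith
      qed simp
      ultimately show ?thesis by metis
    qed
    then show ?case using elim(1) by blast
  qed
qed

end

lemma linear_sandwich: "linear (\<lambda>A. S ** A ** (S :: real^'d^'d))"
  by (rule linearI)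
    (simp_all add: vec_eq_iff matrix_matrix_mult_def sum.distrib[symmetric] sum_distrib_left sum_distrib_right algebra_simps)

context brownian_sampling
begin

lemma eventually_block_count_pos: "\<forall>\<^sub>F n in sequentially. 0 < block_count T (h n)"
proof -
  have "\<forall>\<^sub>F n in sequentially. 4 \<le> T / (2 * h n)"
    using divide_at_top[OF T h] by (simp add: filterlim_at_top)
  then show ?thesis
  proof eventually_elim
    case (elim n)
    have "0 < T / (2 * h n)" by (rule less_le_trans[OF _ elim]) simp
    from less_le_trans[OF half_gt_zero[OF this] block_count_bounds(1)[OF h(1) elim]]
    show ?case by simp
  qed
qed

text \<open>After normalisation each second difference is x - \<rho> e, where e tends to the drift
  seen through the inverse of \<sigma>. Expanding the product, x x is the fluctuation, the cross
  terms have the constant prefactor r \<rho> and vanish by averaging, and the square of e carries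
  one more factor \<rho>, which tends to zero.\<close>

lemma AE_estimator:
  fixes X Y b :: "'w \<Rightarrow> real \<Rightarrow> real^'d"
  assumes sm: "summable h" and \<sigma>: "hyp_H0 \<sigma>"
    and path: "AE \<omega> in M. continuous_on {0..} (b \<omega>) \<and> (\<forall>t\<ge>0. X \<omega> t = x0 + integral {0..t} (Y \<omega>)) \<and>
      (\<forall>t\<ge>0. Y \<omega> t = y0 + \<sigma> *v W t \<omega> - integral {0..t} (b \<omega>))"
  shows "AE \<omega> in M. (\<lambda>n. sqrt (T / (2 * h n)) *\<^sub>R (matrix_inv \<sigma> ** sigma2_hat T (h n) (X \<omega>) ** matrix_inv \<sigma> - mat 1)
      - fluctuation T (h n) \<omega>) \<longlonglongrightarrow> 0"
proof -
  have "AE \<omega> in M. \<forall>n p. block_diff (h n) p \<omega> = integral {(2 * real p + 2) * h n..(2 * real p + 3) * h n} (\<lambda>t. W t \<omega>)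
      - integral {(2 * real p + 1) * h n..(2 * real p + 2) * h n} (\<lambda>t. W t \<omega>)"
    unfolding AE_all_countable using AE_block_diff[OF h(1)] by fast
  with AE_averages[OF sm] AE_continuous path show ?thesis
  proof eventually_elim
    case (elim \<omega>)
    define S where "S = matrix_inv \<sigma>"
    note S = matrix_inv_H0[OF \<sigma>, folded S_def]
    define m where "m n = block_count T (h n)" for n
    define c where "c n p = (2 * real p + 2) * h n" for n p
    define G where "G n p = block_diff (h n) p \<omega>" for n p
    define sd where "sd n p = second_diff (X \<omega>) (h n) (Suc p)" for n p
    \<comment> \<open>Defined as the exact residual of the data, so that the decomposition below is
      an identity; that it is close to the drift at the midpoint is shown afterwards.\<close>
    define \<beta> where "\<beta> n p = (1 / (h n)\<^sup>2) *\<^sub>R (\<sigma> *v G n p - sd n p)" for n p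
    define e where "e n p = S *v \<beta> n p" for n p
    define x where "x n p = xi (h n) p \<omega>" for n p
    have hn: "0 < h n" "h n \<noteq> 0" for n using h(1)[of n] by auto
    have bcont: "continuous_on {0..T} (b \<omega>)" using elim(3) continuous_on_subset by fastforce
    obtain K where K: "0 < K" "\<And>v. norm (S *v v) \<le> norm v * K"
      using bounded_linear.pos_bounded[OF matrix_vector_mul_bounded_linear[of S]] by blast
    obtain \<epsilon> where \<epsilon>: "\<epsilon> \<longlonglongrightarrow> 0"
      "\<And>n s c. s \<in> {0..T} \<Longrightarrow> c \<in> {0..T} \<Longrightarrow> \<bar>s - c\<bar> \<le> h n \<Longrightarrow> norm (b \<omega> s - b \<omega> c) \<le> \<epsilon> n"
      using modulus_of_continuity[OF bcont h(2,1) less_imp_le[OF T]] by blast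
    have cT: "0 \<le> c n p - h n" "c n p + h n \<le> T" if "p < m n" for n p
    proof -
      show "0 \<le> c n p - h n" using hn(1)[of n] by (simp add: c_def algebra_simps)
      have "c n p + h n \<le> (2 * real p + 4) * h n" using hn(1)[of n] by (simp add: c_def algebra_simps)
      then show "c n p + h n \<le> T" using block_time_le[OF h(1) that[unfolded m_def]] by linarith
    qed
    have cin: "c n p \<in> {0..T}" if "p < m n" for n p using cT[OF that] hn(1)[of n] by auto
    have \<beta>: "norm (\<beta> n p - b \<omega> (c n p)) \<le> 2 * \<epsilon> n" if p: "p < m n" for n p
    proof -
      have G: "G n p = integral {c n p..c n p + h n} (\<lambda>t. W t \<omega>) - integral {c n p - h n..c n p} (\<lambda>t. W t \<omega>)"
        using elim(4) by (simp add: G_def c_def algebra_simps)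
      have "norm (sd n p - (\<sigma> *v G n p - (h n)\<^sup>2 *\<^sub>R b \<omega> (c n p))) \<le> 2 * (h n)\<^sup>2 * \<epsilon> n"
        unfolding sd_def G
      proof (rule second_diff_expansion)
        show "continuous_on {0..} (\<lambda>t. W t \<omega>)" using elim(2) by blast
        show "continuous_on {0..} (b \<omega>)" using elim(3) by blast
        show "X \<omega> t = x0 + integral {0..t} (Y \<omega>)" "Y \<omega> t = y0 + \<sigma> *v W t \<omega> - integral {0..t} (b \<omega>)" if "0 \<le> t" for t
          using elim(3) that by blast+
        show "norm (b \<omega> s - b \<omega> (c n p)) \<le> \<epsilon> n" if "s \<in> {c n p - h n..c n p + h n}" for s
          by (rule \<epsilon>(2)[OF _ cin[OF p]]) (use that cT[OF p] in \<open>auto simp: abs_le_iff\<close>)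
      qed (simp_all add: hn c_def)
      moreover have "\<beta> n p - b \<omega> (c n p) = (1 / (h n)\<^sup>2) *\<^sub>R (- (sd n p - (\<sigma> *v G n p - (h n)\<^sup>2 *\<^sub>R b \<omega> (c n p))))"
        using hn(2)[of n] by (simp add: \<beta>_def scaleR_diff_right scaleR_add_right)
      ultimately have "norm (\<beta> n p - b \<omega> (c n p)) \<le> (1 / (h n)\<^sup>2) * (2 * (h n)\<^sup>2 * \<epsilon> n)"
        by (simp only: norm_scaleR norm_minus_cancel) (intro mult_mono, auto)
      then show ?thesis using hn(2)[of n] by simp
    qed
    have e: "\<bar>e n p $ j - (S *v b \<omega> (c n p)) $ j\<bar> \<le> 2 * \<epsilon> n * K" if "p < m n" for n p j
    proof -
      have "\<bar>(e n p - S *v b \<omega> (c n p)) $ j\<bar> \<le> norm (e n p - S *v b \<omega> (c n p))" by (rule component_le_norm_cart)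
      also have "norm (e n p - S *v b \<omega> (c n p)) = norm (S *v (\<beta> n p - b \<omega> (c n p)))"
        by (simp add: e_def matrix_vector_mult_diff_distrib)
      also have "\<dots> \<le> norm (\<beta> n p - b \<omega> (c n p)) * K" by (rule K(2))
      also have "\<dots> \<le> 2 * \<epsilon> n * K" using \<beta>[OF that] K(1) by (intro mult_right_mono) auto
      finally show ?thesis by simp
    qed
    have gcont: "continuous_on {0..T} (\<lambda>s. (S *v b \<omega> s) $ j)" for j
      using continuous_on_compose2[OF linear_continuous_on[OF matrix_vector_mul_bounded_linear[of S], of UNIV] bcont]
      by (intro continuous_on_component) auto
    have avg: "(\<lambda>n. (\<Sum>p<m n. x n p $ i * e n p $ j) / real (m n)) \<longlonglongrightarrow> 0" for i j
    proof -
      obtain C where C: "\<And>n. (\<Sum>p<m n. (x n p $ i)\<^sup>2) / real (m n) \<le> C"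
        using elim(1) unfolding x_def m_def by blast
      show ?thesis
      proof (rule weighted_average_tendsto_zero[OF _ C cin gcont e])
        show "(\<lambda>n. (\<Sum>p<m n. x n p $ i * c n p ^ k) / real (m n)) \<longlonglongrightarrow> 0" for k
          using elim(1) unfolding x_def m_def c_def by blast
        show "(\<lambda>n. 2 * \<epsilon> n * K) \<longlonglongrightarrow> 0"
          using tendsto_mult_left_zero[OF tendsto_mult_right_zero[OF \<epsilon>(1)], of 2 K] by simp
      qed
    qed
    have ebound: "\<exists>C. \<forall>n p. p < m n \<longrightarrow> \<bar>e n p $ j\<bar> \<le> C" for j
    proof -
      have "compact ((\<lambda>s. (S *v b \<omega> s) $ j) ` {0..T})" by (rule compact_continuous_image[OF gcont]) simp
      then have "bounded ((\<lambda>s. (S *v b \<omega> s) $ j) ` {0..T})" by (rule compact_imp_bounded)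
      then obtain C where C: "\<And>s. s \<in> {0..T} \<Longrightarrow> \<bar>(S *v b \<omega> s) $ j\<bar> \<le> C"
        unfolding bounded_iff real_norm_def by (metis imageI)
      have "Bseq \<epsilon>" using \<epsilon>(1) by (blast intro: convergent_imp_Bseq convergentI)
      then obtain E where E: "\<And>n. norm (\<epsilon> n) \<le> E" by (auto simp: Bseq_def)
      have "\<bar>e n p $ j\<bar> \<le> C + 2 * E * K" if "p < m n" for n p
      proof -
        have "2 * \<epsilon> n * K \<le> 2 * E * K" using E[of n] K(1) by (intro mult_right_mono) auto
        then show ?thesis using C[OF cin[OF that]] e[OF that, of j] by linarith
      qed
      then show ?thesis by blast
    qed
    \<comment> \<open>Size of the drift relative to the noise: h^2 multiplied by sqrt (3 / (2
      h^3)).\<close>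
    define \<rho> where "\<rho> n = sqrt (3 / 2 * h n)" for n
    define r where "r n = sqrt (T / (2 * h n))" for n
    \<comment> \<open>The rate of the theorem and the relative size of the drift compensate exactly,
      which is why the cross terms need an averaging argument.\<close>
    have r\<rho>: "r n * \<rho> n = sqrt (3 * T / 4)" for n
    proof -
      have "r n * \<rho> n = sqrt (T / (2 * h n) * (3 / 2 * h n))" by (simp only: r_def \<rho>_def real_sqrt_mult)
      also have "T / (2 * h n) * (3 / 2 * h n) = 3 * T / 4" using hn(2)[of n] by simp
      finally show ?thesis .
    qed
    have \<rho>0: "\<rho> \<longlonglongrightarrow> 0"
      using tendsto_real_sqrt[OF tendsto_mult_right_zero[OF h(2), of "3 / 2"]] by (simp add: \<rho>_def[abs_def])
    have sq: "(\<lambda>n. \<rho> n * ((\<Sum>p<m n. e n p $ i * e n p $ j) / real (m n))) \<longlonglongrightarrow> 0" for i j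
    proof -
      obtain C C' where C: "\<And>n p. p < m n \<Longrightarrow> \<bar>e n p $ i\<bar> \<le> C" "\<And>n p. p < m n \<Longrightarrow> \<bar>e n p $ j\<bar> \<le> C'"
        using ebound[of i] ebound[of j] by blast
      have "norm ((\<Sum>p<m n. e n p $ i * e n p $ j) / real (m n)) \<le> \<bar>C * C'\<bar>" for n
      proof (cases "m n = 0")
        case False
        have "\<bar>\<Sum>p<m n. e n p $ i * e n p $ j\<bar> \<le> (\<Sum>p<m n. \<bar>C * C'\<bar>)"
        proof (rule order_trans[OF sum_abs sum_mono])
          fix p assume "p \<in> {..<m n}"
          then show "\<bar>e n p $ i * e n p $ j\<bar> \<le> \<bar>C * C'\<bar>"
            unfolding abs_mult using C[of p n] by (intro mult_mono) auto
        qed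
        then show ?thesis using False by (simp add: divide_le_eq mult.commute)
      qed simp
      then show ?thesis by (intro lim_null_mult_right_bounded[OF \<rho>0] always_eventually allI)
    qed
    \<comment> \<open>An exact identity as soon as there is a block; a nonempty average is needed to
      write the identity matrix as an average over blocks.\<close>
    have entry: "(r n *\<^sub>R (S ** sigma2_hat T (h n) (X \<omega>) ** S - mat 1) - fluctuation T (h n) \<omega>) $ i $ j
      = sqrt (3 * T / 4) * (\<rho> n * ((\<Sum>p<m n. e n p $ i * e n p $ j) / real (m n))
          - (\<Sum>p<m n. x n p $ i * e n p $ j) / real (m n) - (\<Sum>p<m n. x n p $ j * e n p $ i) / real (m n))"
      if m0: "0 < m n" for n i j
    proof -
      define \<gamma> where "\<gamma> = sqrt (3 / (2 * h n ^ 3))"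
      have \<gamma>: "\<gamma>\<^sup>2 = 3 / (2 * h n ^ 3)" using hn(1)[of n] by (simp add: \<gamma>_def)
      have \<gamma>\<rho>: "\<gamma> * (h n)\<^sup>2 = \<rho> n"
      proof -
        have "\<gamma> * (h n)\<^sup>2 = sqrt (3 / (2 * h n ^ 3) * ((h n)\<^sup>2)\<^sup>2)"
          unfolding real_sqrt_mult real_sqrt_abs \<gamma>_def by simp
        also have "3 / (2 * h n ^ 3) * ((h n)\<^sup>2)\<^sup>2 = 3 / 2 * h n"
          using hn(2)[of n] by (simp add: power2_eq_square power3_eq_cube)
        finally show ?thesis by (simp add: \<rho>_def)
      qed
      have Ssd: "S *v sd n p = G n p - (h n)\<^sup>2 *\<^sub>R e n p" for p
      proof -
        have "sd n p = \<sigma> *v G n p - (h n)\<^sup>2 *\<^sub>R \<beta> n p" using hn(2)[of n] by (simp add: \<beta>_def)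
        then show ?thesis
          by (simp add: matrix_vector_mult_diff_distrib matrix_vector_mul_assoc S(1) e_def matrix_vector_mult_scaleR)
      qed
      have resid: "\<gamma> * (S *v sd n p) $ i = x n p $ i - \<rho> n * e n p $ i" for p i
        unfolding Ssd x_def xi_def \<gamma>_def[symmetric] G_def[symmetric] \<gamma>\<rho>[symmetric] by (simp add: algebra_simps)
      have "(S ** sigma2_hat T (h n) (X \<omega>) ** S) $ i $ j
          = (1 / real (m n) * \<gamma>\<^sup>2) * (\<Sum>p<m n. (S *v sd n p) $ i * (S *v sd n p) $ j)"
        unfolding sigma2_hat_eq linear_scale[OF linear_sandwich] linear_sum[OF linear_sandwich]
          sandwich_outer_prod[OF S(2)] m_def[symmetric] sd_def[symmetric] \<gamma>
        by (simp add: outer_prod_def)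
      also have "\<dots> = (1 / real (m n)) * (\<Sum>p<m n. (\<gamma> * (S *v sd n p) $ i) * (\<gamma> * (S *v sd n p) $ j))"
        by (simp add: sum_distrib_left power2_eq_square ac_simps)
      also have "\<dots> = (1 / real (m n)) * (\<Sum>p<m n. (x n p $ i - \<rho> n * e n p $ i) * (x n p $ j - \<rho> n * e n p $ j))"
        unfolding resid ..
      finally have 1: "(S ** sigma2_hat T (h n) (X \<omega>) ** S) $ i $ j = \<dots>" .
      have 2: "fluctuation T (h n) \<omega> $ i $ j = r n / real (m n) * (\<Sum>p<m n. x n p $ i * x n p $ j - mat 1 $ i $ j)"
        by (simp add: fluctuation_def r_def m_def x_def outer_prod_def)
      have 3: "mat 1 $ i $ j = (1 / real (m n)) * (\<Sum>p<m n. mat 1 $ i $ j :: real)" using m0 by simp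
      have "(r n *\<^sub>R (S ** sigma2_hat T (h n) (X \<omega>) ** S - mat 1) - fluctuation T (h n) \<omega>) $ i $ j
          = r n * ((1 / real (m n)) * (\<Sum>p<m n. (x n p $ i - \<rho> n * e n p $ i) * (x n p $ j - \<rho> n * e n p $ j)) - (1 / real (m n)) * (\<Sum>p<m n. mat 1 $ i $ j))
            - r n / real (m n) * (\<Sum>p<m n. x n p $ i * x n p $ j - mat 1 $ i $ j)"
        unfolding 2[symmetric] 1[symmetric] 3[symmetric] by simp
      also have "\<dots> = (r n / real (m n)) * ((\<Sum>p<m n. (x n p $ i - \<rho> n * e n p $ i) * (x n p $ j - \<rho> n * e n p $ j))
          - (\<Sum>p<m n. mat 1 $ i $ j) - (\<Sum>p<m n. x n p $ i * x n p $ j - mat 1 $ i $ j))"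
        by (simp only: right_diff_distrib) simp
      also have "\<dots> = (r n / real (m n)) * (\<Sum>p<m n. \<rho> n * (\<rho> n * (e n p $ i * e n p $ j) - x n p $ i * e n p $ j - x n p $ j * e n p $ i))"
        unfolding sum_subtractf[symmetric] by (rule arg_cong[where f = "(*) _"], rule sum.cong[OF refl]) (simp add: algebra_simps)
      also have "\<dots> = (r n * \<rho> n) * ((\<rho> n * (\<Sum>p<m n. e n p $ i * e n p $ j)
          - (\<Sum>p<m n. x n p $ i * e n p $ j) - (\<Sum>p<m n. x n p $ j * e n p $ i)) / real (m n))"
        unfolding sum_distrib_left[symmetric] sum_subtractf by simp
      finally show ?thesis unfolding r\<rho> by (simp add: diff_divide_distrib)
    qed
    have "(\<lambda>n. r n *\<^sub>R (S ** sigma2_hat T (h n) (X \<omega>) ** S - mat 1) - fluctuation T (h n) \<omega>) \<longlonglongrightarrow> 0"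
    proof (intro vec_tendstoI)
      fix i j
      have "(\<lambda>n. sqrt (3 * T / 4) * (\<rho> n * ((\<Sum>p<m n. e n p $ i * e n p $ j) / real (m n))
          - (\<Sum>p<m n. x n p $ i * e n p $ j) / real (m n) - (\<Sum>p<m n. x n p $ j * e n p $ i) / real (m n))) \<longlonglongrightarrow> sqrt (3 * T / 4) * (0 - 0 - 0)"
        by (intro tendsto_mult tendsto_const tendsto_diff sq avg)
      moreover have "\<forall>\<^sub>F n in sequentially. sqrt (3 * T / 4) * (\<rho> n * ((\<Sum>p<m n. e n p $ i * e n p $ j) / real (m n))
          - (\<Sum>p<m n. x n p $ i * e n p $ j) / real (m n) - (\<Sum>p<m n. x n p $ j * e n p $ i) / real (m n))
          = (r n *\<^sub>R (S ** sigma2_hat T (h n) (X \<omega>) ** S - mat 1) - fluctuation T (h n) \<omega>) $ i $ j"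
        using eventually_block_count_pos by eventually_elim (subst entry, simp_all add: m_def)
      ultimately show "(\<lambda>n. (r n *\<^sub>R (S ** sigma2_hat T (h n) (X \<omega>) ** S - mat 1) - fluctuation T (h n) \<omega>) $ i $ j) \<longlonglongrightarrow> 0 $ i $ j"
        by (simp add: Lim_transform_eventually)
    qed
    then show ?case by (simp only: r_def S_def)
  qed
qed

end

section \<open>From characteristic functions to stable convergence\<close>

lemma sine_wrap_uniform_on_ball:
  fixes g :: "'a::euclidean_space \<Rightarrow> real"
  assumes g: "continuous_on UNIV g" and R: "0 < R" and \<epsilon>: "0 < \<epsilon>"
  obtains L where "R \<le> L" "\<And>x. norm x \<le> R \<Longrightarrow> \<bar>g x - g (sine_wrap L x)\<bar> \<le> \<epsilon>"
proof -
  have "uniformly_continuous_on (cball 0 (R + 1)) g"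
    by (rule compact_uniformly_continuous[OF continuous_on_subset[OF g]]) auto
  then obtain d where d: "0 < d" "\<And>x y. x \<in> cball 0 (R + 1) \<Longrightarrow> y \<in> cball 0 (R + 1) \<Longrightarrow> dist y x < d \<Longrightarrow> dist (g y) (g x) < \<epsilon>"
    using \<epsilon> unfolding uniformly_continuous_on_def by meson
  define D where "D = real DIM('a) * R ^ 2"
  \<comment> \<open>On the ball of radius R the wrap moves points by at most D / L. This is made
    smaller than the modulus d of uniform continuity, and smaller than 1 so that wrapped points stay
    in the ball of radius R + 1.\<close>
  define L where "L = max R ((D + 1) / min d 1)"
  have L: "R \<le> L" "0 < L" "(D + 1) / min d 1 \<le> L" using R by (auto simp: L_def)
  have D0: "0 \<le> D" by (simp add: D_def)
  have near: "norm (sine_wrap L x - x) < min d 1" if "norm x \<le> R" for x :: 'a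
  proof -
    have "norm (sine_wrap L x - x) \<le> real DIM('a) * (norm x ^ 2 / L)" by (rule sine_wrap_dist[OF L(2)])
    also have "\<dots> \<le> D / L"
      using that L(2) by (simp add: D_def divide_right_mono mult_left_mono power_mono)
    also have "\<dots> < (D + 1) / L" using L(2) by (simp add: divide_strict_right_mono)
    also have "\<dots> \<le> min d 1"
    proof -
      have "0 < min d 1" using d(1) by simp
      then have "D + 1 \<le> L * min d 1" using L(3) by (simp only: pos_divide_le_eq)
      then show ?thesis using L(2) by (simp only: pos_divide_le_eq mult.commute)
    qed
    finally show ?thesis .
  qed
  have "\<bar>g x - g (sine_wrap L x)\<bar> \<le> \<epsilon>" if x: "norm x \<le> R" for x
  proof -
    have "norm (sine_wrap L x) \<le> norm x + norm (sine_wrap L x - x)" by (metis norm_triangle_sub add.commute)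
    then have "norm (sine_wrap L x) \<le> R + 1" using near[OF x] x by linarith
    then have "dist (g (sine_wrap L x)) (g x) < \<epsilon>"
      using near[OF x] x by (intro d(2)) (auto simp: dist_norm)
    then show ?thesis by (simp add: dist_real_def abs_minus_commute)
  qed
  with L(1) show ?thesis by (rule that)
qed

lemma sine_wrap_continuous: "continuous_on S (sine_wrap L)"
  unfolding sine_wrap_def[abs_def] divide_inverse by (intro continuous_intros)

section \<open>Tightness and general test functions\<close>

context brownian_sampling
begin

text \<open>Tightness of the fluctuations. The blocks are orthogonal, so the second moment of each
  pairing with a matrix A is X / m times \<open>quad_var A\<close>, and X / m \<le> 2 once there are
  enough blocks; the norm is at most one plus its square.\<close>

lemma fluctuation_second_moment:
  "\<exists>K. \<forall>\<^sub>F n in sequentially. integrable M (\<lambda>\<omega>. norm (fluctuation T (h n) \<omega>)) \<and>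
     expectation (\<lambda>\<omega>. norm (fluctuation T (h n) \<omega>)) \<le> K"
proof -
  \<comment> \<open>Matrix units, which write the entries as pairings and the squared norm as a sum
    of squared pairings.\<close>
  define E :: "'d \<Rightarrow> 'd \<Rightarrow> real^'d^'d" where "E i j = axis i (axis j 1)" for i j
  define K where "K = (\<Sum>i\<in>UNIV. \<Sum>j\<in>UNIV. 2 * quad_var (E i j))"
  have E: "A $ i $ j = E i j \<bullet> A" for A :: "real^'d^'d" and i j by (simp add: E_def inner_axis')
  have nE: "(norm A)\<^sup>2 = (\<Sum>i\<in>UNIV. \<Sum>j\<in>UNIV. (E i j \<bullet> A)\<^sup>2)" for A :: "real^'d^'d"
    unfolding power2_norm_eq_inner E[symmetric] by (simp add: inner_vec_def power2_eq_square)
  have ev: "\<forall>\<^sub>F n in sequentially. 4 \<le> T / (2 * h n)"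
    using divide_at_top[OF T h] by (simp add: filterlim_at_top)
  have "\<forall>\<^sub>F n in sequentially. integrable M (\<lambda>\<omega>. norm (fluctuation T (h n) \<omega>)) \<and>
     expectation (\<lambda>\<omega>. norm (fluctuation T (h n) \<omega>)) \<le> 1 + K"
    using ev
  proof eventually_elim
    case (elim n)
    define X where "X = T / (2 * h n)"
    define m where "m = block_count T (h n)"
    have X: "0 < X" "X / 2 \<le> real m"
      using elim block_count_bounds(1)[OF h(1) elim] by (auto simp: X_def m_def)
    have i: "integrable M (\<lambda>\<omega>. (A \<bullet> fluctuation T (h n) \<omega>)\<^sup>2)"
      and le: "expectation (\<lambda>\<omega>. (A \<bullet> fluctuation T (h n) \<omega>)\<^sup>2) \<le> 2 * quad_var A" for A
    proof -
      note q = quad_moments(3,4)[OF h(1)[of n], of A _ A]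
      have orth: "expectation (\<lambda>\<omega>. quad A (xi (h n) p \<omega>) * quad A (xi (h n) q \<omega>)) = of_bool (p = q) * quad_var A" for p q
        unfolding q(2) quad_var_def ..
      note o = orthogonal_average[OF q(1) orth, of m "\<lambda>_. 1" 1]
      have eq: "(A \<bullet> fluctuation T (h n) \<omega>)\<^sup>2 = X * ((\<Sum>p<m. quad A (xi (h n) p \<omega>) * 1) / real m)\<^sup>2" for \<omega>
        unfolding inner_fluctuation using X(1) by (simp add: X_def[symmetric] m_def[symmetric] power_mult_distrib power_divide)
      show "integrable M (\<lambda>\<omega>. (A \<bullet> fluctuation T (h n) \<omega>)\<^sup>2)" unfolding eq using o(1) by simp
      have "expectation (\<lambda>\<omega>. (A \<bullet> fluctuation T (h n) \<omega>)\<^sup>2) \<le> X * (1\<^sup>2 * quad_var A * (1 / real m))"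
        unfolding eq integral_mult_right_zero using o(2) X(1) by (intro mult_left_mono) auto
      also have "\<dots> = quad_var A * (X / real m)" by simp
      also have "\<dots> \<le> quad_var A * 2"
        using X by (intro mult_left_mono quad_var_nonneg) (simp add: divide_le_eq)
      finally show "expectation (\<lambda>\<omega>. (A \<bullet> fluctuation T (h n) \<omega>)\<^sup>2) \<le> 2 * quad_var A" by simp
    qed
    have i2: "integrable M (\<lambda>\<omega>. 1 + (norm (fluctuation T (h n) \<omega>))\<^sup>2)" unfolding nE using i by simp
    have "expectation (\<lambda>\<omega>. 1 + (norm (fluctuation T (h n) \<omega>))\<^sup>2) = 1 + (\<Sum>i\<in>UNIV. \<Sum>j\<in>UNIV. expectation (\<lambda>\<omega>. (E i j \<bullet> fluctuation T (h n) \<omega>)\<^sup>2))"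
      unfolding nE using i by (simp add: prob_space)
    also have "\<dots> \<le> 1 + K" unfolding K_def using le by (intro add_left_mono sum_mono)
    finally have e2: "expectation (\<lambda>\<omega>. 1 + (norm (fluctuation T (h n) \<omega>))\<^sup>2) \<le> 1 + K" .
    have b: "norm x \<le> 1 + (norm x)\<^sup>2" for x :: "real^'d^'d"
    proof -
      have "2 * norm x \<le> 1 + (norm x)\<^sup>2" using zero_le_power2[of "norm x - 1"] by (simp add: power2_diff)
      then show ?thesis using norm_ge_zero[of x] by linarith
    qed
    have i1: "integrable M (\<lambda>\<omega>. norm (fluctuation T (h n) \<omega>))"
    proof (rule Bochner_Integration.integrable_bound[OF i2])
      show "AE \<omega> in M. norm (norm (fluctuation T (h n) \<omega>)) \<le> norm (1 + (norm (fluctuation T (h n) \<omega>))\<^sup>2)"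
      proof (rule AE_I2)
        fix \<omega>
        show "norm (norm (fluctuation T (h n) \<omega>)) \<le> norm (1 + (norm (fluctuation T (h n) \<omega>))\<^sup>2)"
          using b[of "fluctuation T (h n) \<omega>"] by simp
      qed
    qed measurable
    have "expectation (\<lambda>\<omega>. norm (fluctuation T (h n) \<omega>)) \<le> 1 + K"
      by (rule order_trans[OF integral_mono[OF i1 i2 b] e2])
    with i1 show ?case by blast
  qed
  then show ?thesis by blast
qed

text \<open>Characters are handled by \<open>mixing\<close>, the fluctuation being exchanged for Y
  under a Lipschitz function. Linear combinations approximate wrapped test functions uniformly. The
  wrap is then removed: on the Y side by tightness of the fluctuations, on the limit side by
  dominated convergence under the fixed law \<nu>.\<close>

lemma stable_limit:
  fixes Y :: "nat \<Rightarrow> 'w \<Rightarrow> real^'d^'d" and g :: "real^'d^'d \<Rightarrow> real"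
  assumes Y: "\<And>n. Y n \<in> borel_measurable M"
    and YU: "AE \<omega> in M. (\<lambda>n. Y n \<omega> - fluctuation T (h n) \<omega>) \<longlonglongrightarrow> 0"
    and \<nu>: "prob_space \<nu>" "sets \<nu> = sets borel"
      "\<And>A. (\<integral>x. iexp (A \<bullet> x) \<partial>\<nu>) = of_real (exp (- quad_var A / 2))"
    and g: "continuous_on UNIV g" "\<And>x. \<bar>g x\<bar> \<le> C"
    and \<zeta>: "\<zeta> \<in> borel_measurable (augmented_filtration M W T)" "\<zeta> \<in> borel_measurable M"
      "\<And>\<omega>. \<omega> \<in> space M \<Longrightarrow> \<bar>\<zeta> \<omega>\<bar> \<le> B"
  shows "(\<lambda>n. \<integral>\<omega>. g (Y n \<omega>) * \<zeta> \<omega> \<partial>M) \<longlonglongrightarrow> (\<integral>x. g x \<partial>\<nu>) * (\<integral>\<omega>. \<zeta> \<omega> \<partial>M)"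
proof -
  interpret \<nu>: prob_space \<nu> by fact
  note [measurable] = Y \<zeta>(2)
  have [measurable_cong]: "sets \<nu> = sets borel" by fact
  obtain \<omega>0 where "\<omega>0 \<in> space M" using not_empty by blast
  then have B0: "0 \<le> B" using \<zeta>(3) by (meson abs_ge_zero order_trans)
  have C0: "0 \<le> C" using g(2)[of 0] by (rule order_trans[rotated]) simp
  have [measurable]: "g \<in> borel_measurable borel" by (rule borel_measurable_continuous_onI[OF g(1)])
  have [measurable]: "sine_wrap L \<in> borel_measurable (borel :: (real^'d^'d) measure)" for L
    by (rule borel_measurable_continuous_onI[OF sine_wrap_continuous])
  have i\<zeta>: "integrable M (\<lambda>\<omega>. f \<omega> * of_real (\<zeta> \<omega>))"
    if f: "f \<in> borel_measurable M" "\<And>\<omega>. cmod (f \<omega>) \<le> r" for f r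
  proof (rule integrable_const_bound[of _ "r * B"])
    show "AE \<omega> in M. norm (f \<omega> * of_real (\<zeta> \<omega>)) \<le> r * B"
      by (rule AE_I2, unfold norm_mult norm_of_real)
        (intro mult_mono f \<zeta>(3) order_trans[OF norm_ge_zero f(2)] abs_ge_zero)
    note [measurable] = f(1)
    show "(\<lambda>\<omega>. f \<omega> * of_real (\<zeta> \<omega>)) \<in> borel_measurable M" by measurable
  qed
  have i\<zeta>': "integrable M (\<lambda>\<omega>. f \<omega> * \<zeta> \<omega>)"
    if f: "f \<in> borel_measurable M" "\<And>\<omega>. \<bar>f \<omega>\<bar> \<le> r" for f r
  proof (rule integrable_const_bound[of _ "r * B"])
    show "AE \<omega> in M. norm (f \<omega> * \<zeta> \<omega>) \<le> r * B"
      by (rule AE_I2, unfold real_norm_def abs_mult)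
        (intro mult_mono f \<zeta>(3) order_trans[OF abs_ge_zero f(2)] abs_ge_zero)
    note [measurable] = f(1)
    show "(\<lambda>\<omega>. f \<omega> * \<zeta> \<omega>) \<in> borel_measurable M" by measurable
  qed
  have trig: "(\<lambda>n. (\<integral>\<omega>. f (Y n \<omega>) * of_real (\<zeta> \<omega>) \<partial>M) - (\<integral>x. f x \<partial>\<nu>) * (\<integral>\<omega>. of_real (\<zeta> \<omega>) \<partial>M)) \<longlonglongrightarrow> 0"
    if "trig_poly f" for f
    using that
  proof (induction rule: trig_poly.induct)
    case (iexp A)
    have i: "integrable M (\<lambda>\<omega>. iexp (A \<bullet> X \<omega>) * of_real (\<zeta> \<omega>))" if [measurable]: "X \<in> borel_measurable M" for X
      by (rule i\<zeta>[of _ 1]) auto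
    have "(\<lambda>n. \<integral>\<omega>. (iexp (A \<bullet> Y n \<omega>) - iexp (A \<bullet> fluctuation T (h n) \<omega>)) * of_real (\<zeta> \<omega>) \<partial>M) \<longlonglongrightarrow> (\<integral>\<omega>. 0 \<partial>M)"
    proof (rule integral_dominated_convergence[where w = "\<lambda>_. (1 + 1) * B"])
      show "AE \<omega> in M. (\<lambda>n. (iexp (A \<bullet> Y n \<omega>) - iexp (A \<bullet> fluctuation T (h n) \<omega>)) * of_real (\<zeta> \<omega>)) \<longlonglongrightarrow> 0"
        using YU
      proof eventually_elim
        case (elim \<omega>)
        have "(\<lambda>n. A \<bullet> (Y n \<omega> - fluctuation T (h n) \<omega>)) \<longlonglongrightarrow> A \<bullet> 0" by (intro tendsto_intros elim)
        then have "(\<lambda>n. \<bar>A \<bullet> Y n \<omega> - A \<bullet> fluctuation T (h n) \<omega>\<bar>) \<longlonglongrightarrow> 0"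
          by (intro tendsto_rabs_zero) (simp add: inner_diff_right)
        then have "(\<lambda>n. iexp (A \<bullet> Y n \<omega>) - iexp (A \<bullet> fluctuation T (h n) \<omega>)) \<longlonglongrightarrow> 0"
          by (rule Lim_null_comparison[rotated]) (intro always_eventually allI norm_iexp_diff_le)
        then show ?case by (rule tendsto_mult_left_zero)
      qed
      show "AE \<omega> in M. norm ((iexp (A \<bullet> Y n \<omega>) - iexp (A \<bullet> fluctuation T (h n) \<omega>)) * of_real (\<zeta> \<omega>)) \<le> (1 + 1) * B" for n
      proof (rule AE_I2, unfold norm_mult norm_of_real, rule mult_mono[OF _ \<zeta>(3)])
        show "cmod (iexp (A \<bullet> Y n \<omega>) - iexp (A \<bullet> fluctuation T (h n) \<omega>)) \<le> 1 + 1" for \<omega>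
          by (rule order_trans[OF norm_triangle_ineq4]) simp
      qed auto
    qed auto
    moreover have "(\<integral>\<omega>. (iexp (A \<bullet> Y n \<omega>) - iexp (A \<bullet> fluctuation T (h n) \<omega>)) * of_real (\<zeta> \<omega>) \<partial>M)
        = (\<integral>\<omega>. iexp (A \<bullet> Y n \<omega>) * of_real (\<zeta> \<omega>) \<partial>M) - (\<integral>\<omega>. iexp (A \<bullet> fluctuation T (h n) \<omega>) * of_real (\<zeta> \<omega>) \<partial>M)" for n
      unfolding left_diff_distrib by (rule Bochner_Integration.integral_diff[OF i[OF Y] i[OF fluctuation_measurable]])
    moreover have "(\<lambda>n. (\<integral>\<omega>. iexp (A \<bullet> fluctuation T (h n) \<omega>) * of_real (\<zeta> \<omega>) \<partial>M)
        - of_real (exp (- quad_var A / 2)) * (\<integral>\<omega>. of_real (\<zeta> \<omega>) \<partial>M)) \<longlonglongrightarrow> 0"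
      using mixing[OF \<zeta>(1,3), of A] unfolding mixes_def by blast
    ultimately show ?case unfolding \<nu>(3) using tendsto_add_zero by fastforce
  next
    case (cmult f k)
    have "(\<lambda>n. k * ((\<integral>\<omega>. f (Y n \<omega>) * of_real (\<zeta> \<omega>) \<partial>M) - (\<integral>x. f x \<partial>\<nu>) * (\<integral>\<omega>. of_real (\<zeta> \<omega>) \<partial>M))) \<longlonglongrightarrow> 0"
      by (rule tendsto_mult_right_zero[OF cmult.IH])
    then show ?case by (simp only: mult.assoc integral_mult_right_zero right_diff_distrib)
  next
    case (add f f')
    obtain r r' where r: "\<And>x. cmod (f x) \<le> r" "\<And>x. cmod (f' x) \<le> r'"
      using trig_poly_bounded add.hyps by metis
    have [measurable]: "f \<in> borel_measurable borel" "f' \<in> borel_measurable borel"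
      using add.hyps trig_poly_borel by auto
    have 1: "integrable M (\<lambda>\<omega>. f (Y n \<omega>) * of_real (\<zeta> \<omega>))" "integrable M (\<lambda>\<omega>. f' (Y n \<omega>) * of_real (\<zeta> \<omega>))" for n
      by (rule i\<zeta>[of _ r], measurable, rule r) (rule i\<zeta>[of _ r'], measurable, rule r)
    have 2: "integrable \<nu> f" "integrable \<nu> f'"
      by (rule \<nu>.integrable_const_bound[of _ r], simp add: r, measurable) (rule \<nu>.integrable_const_bound[of _ r'], simp add: r, measurable)
    show ?case
      using tendsto_add_zero[OF add.IH]
      unfolding distrib_right Bochner_Integration.integral_add[OF 1] Bochner_Integration.integral_add[OF 2] add_diff_add .
  qed
  have wrap: "(\<lambda>n. (\<integral>\<omega>. g (sine_wrap L (Y n \<omega>)) * \<zeta> \<omega> \<partial>M) - (\<integral>x. g (sine_wrap L x) \<partial>\<nu>) * (\<integral>\<omega>. \<zeta> \<omega> \<partial>M)) \<longlonglongrightarrow> 0"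
    if L: "0 < L" for L
  proof -
    have "\<forall>k. \<exists>f. trig_poly f \<and> (\<forall>x. cmod (f x - of_real (g (sine_wrap L x))) < 1 / real (Suc k))"
    proof
      fix k
      show "\<exists>f. trig_poly f \<and> (\<forall>x. cmod (f x - of_real (g (sine_wrap L x))) < 1 / real (Suc k))"
        by (rule trig_poly_approx[OF g(1), of "1 / real (Suc k)" L]) (use L in auto)
    qed
    from choice[OF this] obtain f where f: "\<And>k. trig_poly (f k)"
      "\<And>k x. cmod (f k x - of_real (g (sine_wrap L x))) < 1 / real (Suc k)" by blast
    have [measurable]: "f k \<in> borel_measurable borel" for k by (rule trig_poly_borel[OF f(1)])
    \<comment> \<open>Trigonometric polynomials are complex-valued, so the approximation is carried
      out in the complex numbers and the real part is taken at the end.\<close>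
    define a where "a n = (\<integral>\<omega>. complex_of_real (g (sine_wrap L (Y n \<omega>))) * of_real (\<zeta> \<omega>) \<partial>M)
        - (\<integral>x. complex_of_real (g (sine_wrap L x)) \<partial>\<nu>) * (\<integral>\<omega>. of_real (\<zeta> \<omega>) \<partial>M)" for n
    have lim: "a \<longlonglongrightarrow> 0"
    proof (rule tendsto_of_uniform_approx[OF trig[OF f(1)]])
      show "(\<lambda>k. (B + B) * (1 / real (Suc k))) \<longlonglongrightarrow> 0"
        by (intro tendsto_mult_right_zero lim_1_over_n[THEN LIMSEQ_Suc])
      fix k n
      let ?d = "\<lambda>x. complex_of_real (g (sine_wrap L x)) - f k x"
      have d: "cmod (?d x) \<le> 1 / real (Suc k)" for x using f(2)[of k x] by (simp add: norm_minus_commute)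
      obtain r where r: "\<And>x. cmod (f k x) \<le> r" using trig_poly_bounded[OF f(1)] by blast
      have gC: "cmod (complex_of_real (g x)) \<le> C" for x using g(2) by simp
      have iM: "integrable M (\<lambda>\<omega>. complex_of_real (g (sine_wrap L (Y n \<omega>))) * of_real (\<zeta> \<omega>))"
        "integrable M (\<lambda>\<omega>. f k (Y n \<omega>) * of_real (\<zeta> \<omega>))"
        by (rule i\<zeta>[of _ C], measurable, rule gC) (rule i\<zeta>[of _ r], measurable, rule r)
      have iN: "integrable \<nu> (\<lambda>x. complex_of_real (g (sine_wrap L x)))" "integrable \<nu> (f k)"
        by (rule \<nu>.integrable_const_bound[of _ C], simp add: g, measurable) (rule \<nu>.integrable_const_bound[of _ r], simp add: r, measurable)
      have zB: "cmod (\<integral>\<omega>. of_real (\<zeta> \<omega>) \<partial>M) \<le> B"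
      proof -
        have "cmod (\<integral>\<omega>. of_real (\<zeta> \<omega>) \<partial>M) \<le> (\<integral>\<omega>. B \<partial>M)"
          by (rule order_trans[OF integral_norm_bound integral_mono']) (use \<zeta>(3) B0 in auto)
        then show ?thesis by (simp add: prob_space)
      qed
      have "a n - ((\<integral>\<omega>. f k (Y n \<omega>) * of_real (\<zeta> \<omega>) \<partial>M) - (\<integral>x. f k x \<partial>\<nu>) * (\<integral>\<omega>. of_real (\<zeta> \<omega>) \<partial>M))
          = (\<integral>\<omega>. ?d (Y n \<omega>) * of_real (\<zeta> \<omega>) \<partial>M) - (\<integral>x. ?d x \<partial>\<nu>) * (\<integral>\<omega>. of_real (\<zeta> \<omega>) \<partial>M)"
        unfolding a_def left_diff_distrib Bochner_Integration.integral_diff[OF iM] Bochner_Integration.integral_diff[OF iN] by simp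
      also have "cmod \<dots> \<le> 1 / real (Suc k) * B + 1 / real (Suc k) * B"
      proof (rule order_trans[OF norm_triangle_ineq4 add_mono])
        have "cmod (\<integral>\<omega>. ?d (Y n \<omega>) * of_real (\<zeta> \<omega>) \<partial>M) \<le> (\<integral>\<omega>. 1 / real (Suc k) * B \<partial>M)"
        proof (rule order_trans[OF integral_norm_bound integral_mono'])
          show "norm (?d (Y n \<omega>) * of_real (\<zeta> \<omega>)) \<le> 1 / real (Suc k) * B" if "\<omega> \<in> space M" for \<omega>
            unfolding norm_mult norm_of_real by (intro mult_mono d \<zeta>(3) that) auto
        qed (use B0 in auto)
        then show "cmod (\<integral>\<omega>. ?d (Y n \<omega>) * of_real (\<zeta> \<omega>) \<partial>M) \<le> 1 / real (Suc k) * B" by (simp add: prob_space)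
        have "cmod (\<integral>x. ?d x \<partial>\<nu>) \<le> (\<integral>x. 1 / real (Suc k) \<partial>\<nu>)"
          by (rule order_trans[OF integral_norm_bound integral_mono']) (use d in auto)
        then have "cmod (\<integral>x. ?d x \<partial>\<nu>) \<le> 1 / real (Suc k)" by (simp add: \<nu>.prob_space)
        then show "cmod ((\<integral>x. ?d x \<partial>\<nu>) * (\<integral>\<omega>. of_real (\<zeta> \<omega>) \<partial>M)) \<le> 1 / real (Suc k) * B"
          unfolding norm_mult by (intro mult_mono zB) auto
      qed
      also have "\<dots> = (B + B) * (1 / real (Suc k))" by (simp add: distrib_right)
      finally show "cmod (a n - ((\<integral>\<omega>. f k (Y n \<omega>) * of_real (\<zeta> \<omega>) \<partial>M) - (\<integral>x. f k x \<partial>\<nu>) * (\<integral>\<omega>. of_real (\<zeta> \<omega>) \<partial>M))) \<le> (B + B) * (1 / real (Suc k))" .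
    qed
    have "a n = complex_of_real ((\<integral>\<omega>. g (sine_wrap L (Y n \<omega>)) * \<zeta> \<omega> \<partial>M) - (\<integral>x. g (sine_wrap L x) \<partial>\<nu>) * (\<integral>\<omega>. \<zeta> \<omega> \<partial>M))" for n
      unfolding a_def of_real_mult[symmetric] integral_complex_of_real of_real_diff ..
    then have "Re (a n) = (\<integral>\<omega>. g (sine_wrap L (Y n \<omega>)) * \<zeta> \<omega> \<partial>M) - (\<integral>x. g (sine_wrap L x) \<partial>\<nu>) * (\<integral>\<omega>. \<zeta> \<omega> \<partial>M)" for n
      by (simp only: Re_complex_of_real)
    with tendsto_Re[OF lim] show ?thesis by simp
  qed
  obtain K where K: "\<forall>\<^sub>F n in sequentially. integrable M (\<lambda>\<omega>. norm (fluctuation T (h n) \<omega>)) \<and>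
     expectation (\<lambda>\<omega>. norm (fluctuation T (h n) \<omega>)) \<le> K"
    using fluctuation_second_moment by blast
  have "\<forall>k. \<exists>L. real (Suc k) \<le> L \<and> (\<forall>x. norm x \<le> real (Suc k) \<longrightarrow> \<bar>g x - g (sine_wrap L x)\<bar> \<le> 1 / real (Suc k))"
  proof
    fix k
    show "\<exists>L. real (Suc k) \<le> L \<and> (\<forall>x. norm x \<le> real (Suc k) \<longrightarrow> \<bar>g x - g (sine_wrap L x)\<bar> \<le> 1 / real (Suc k))"
      by (rule sine_wrap_uniform_on_ball[OF g(1), of "real (Suc k)" "1 / real (Suc k)"]) auto
  qed
  from choice[OF this] obtain L where L: "\<And>k. real (Suc k) \<le> L k"
    "\<And>k x. norm x \<le> real (Suc k) \<Longrightarrow> \<bar>g x - g (sine_wrap (L k) x)\<bar> \<le> 1 / real (Suc k)" by blast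
  define I where "I k = (\<integral>x. \<bar>g x - g (sine_wrap (L k) x)\<bar> \<partial>\<nu>)" for k
  have Linf: "filterlim L at_top sequentially"
    by (rule filterlim_at_top_mono[OF filterlim_compose[OF filterlim_real_sequentially filterlim_Suc]])
      (use L(1) in simp)
  have gd: "\<bar>g x - g y\<bar> \<le> 2 * C" for x y using g(2)[of x] g(2)[of y] by linarith
  have I: "I \<longlonglongrightarrow> 0"
  proof -
    have "I \<longlonglongrightarrow> (\<integral>x. 0 \<partial>\<nu>)" unfolding I_def
    proof (rule integral_dominated_convergence[where w = "\<lambda>_. 2 * C"])
      show "AE x in \<nu>. (\<lambda>k. \<bar>g x - g (sine_wrap (L k) x)\<bar>) \<longlonglongrightarrow> 0"
      proof (rule AE_I2)
        fix x :: "real^'d^'d"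
        have "(\<lambda>k. sine_wrap (L k) x) \<longlonglongrightarrow> x" by (rule filterlim_compose[OF sine_wrap_tendsto Linf])
        moreover have "isCont g x" using g(1) by (simp add: continuous_on_eq_continuous_at)
        ultimately have "(\<lambda>k. g (sine_wrap (L k) x)) \<longlonglongrightarrow> g x" by (rule isCont_tendsto_compose[rotated])
        from tendsto_rabs[OF tendsto_diff[OF tendsto_const this], of "g x"]
        show "(\<lambda>k. \<bar>g x - g (sine_wrap (L k) x)\<bar>) \<longlonglongrightarrow> 0" by simp
      qed
    qed (use gd in auto)
    then show ?thesis by simp
  qed
  define a where "a n = (\<integral>\<omega>. g (Y n \<omega>) * \<zeta> \<omega> \<partial>M) - (\<integral>x. g x \<partial>\<nu>) * (\<integral>\<omega>. \<zeta> \<omega> \<partial>M)" for n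
  define b where "b k n = (\<integral>\<omega>. g (sine_wrap (L k) (Y n \<omega>)) * \<zeta> \<omega> \<partial>M) - (\<integral>x. g (sine_wrap (L k) x) \<partial>\<nu>) * (\<integral>\<omega>. \<zeta> \<omega> \<partial>M)" for k n
  have "a \<longlonglongrightarrow> 0"
  proof (rule tendsto_of_eventual_approx)
    show "b k \<longlonglongrightarrow> 0" for k
      unfolding b_def using L(1)[of k] by (intro wrap) simp
    show "(\<lambda>k. B * (1 / real (Suc k) + 2 * C * ((K + 1) * (1 / real (Suc k)))) + B * I k) \<longlonglongrightarrow> 0"
      by (intro tendsto_add_zero tendsto_mult_right_zero lim_1_over_n[THEN LIMSEQ_Suc] I)
    fix k
    let ?R = "real (Suc k)"
    \<comment> \<open>Truncated because Y comes without moment bounds; almost sure convergence then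
      suffices.\<close>
    have D0: "(\<lambda>n. \<integral>\<omega>. min 1 (norm (Y n \<omega> - fluctuation T (h n) \<omega>)) \<partial>M) \<longlonglongrightarrow> (\<integral>\<omega>. 0 \<partial>M)"
    proof (rule integral_dominated_convergence[where w = "\<lambda>_. 1"])
      show "AE \<omega> in M. (\<lambda>n. min 1 (norm (Y n \<omega> - fluctuation T (h n) \<omega>))) \<longlonglongrightarrow> 0"
        using YU
      proof eventually_elim
        case (elim \<omega>)
        from tendsto_min[OF tendsto_const tendsto_norm_zero[OF this], of 1] show ?case by simp
      qed
    qed auto
    have ev: "\<forall>\<^sub>F n in sequentially. (\<integral>\<omega>. min 1 (norm (Y n \<omega> - fluctuation T (h n) \<omega>)) \<partial>M) < 1 / ?R"
      by (rule order_tendstoD(2)[OF D0]) simp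
    show "\<forall>\<^sub>F n in sequentially. norm (a n - b k n) \<le> B * (1 / ?R + 2 * C * ((K + 1) * (1 / ?R))) + B * I k"
      using ev K
    proof eventually_elim
      case (elim n)
      let ?U = "\<lambda>\<omega>. fluctuation T (h n) \<omega>"
      let ?s = "sine_wrap (L k)"
      \<comment> \<open>A pointwise form of Markov's inequality. Inside the ball of radius R the
        wrapping error is at most 1 / R. Outside, it is at most 2 C, and the bracket is at least 1:
        either Y is at distance at least 1 from the fluctuation, or the norm of the fluctuation over
        R makes up the difference.\<close>
      define q where "q \<omega> = 1 / ?R + 2 * C * (norm (?U \<omega>) * (1 / ?R) + min 1 (norm (Y n \<omega> - ?U \<omega>)))" for \<omega>
      have iq: "integrable M q" unfolding q_def[abs_def]
        using elim(2) by (intro Bochner_Integration.integrable_add integrable_mult_right integrable_mult_left)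
          (auto intro!: integrable_const_bound[of _ 1])
      have Eq: "expectation q \<le> 1 / ?R + 2 * C * ((K + 1) * (1 / ?R))"
      proof -
        have im: "integrable M (\<lambda>\<omega>. min 1 (norm (Y n \<omega> - ?U \<omega>)))" by (rule integrable_const_bound[of _ 1]) auto
        have "expectation q = 1 / ?R + 2 * C * (expectation (\<lambda>\<omega>. norm (?U \<omega>)) * (1 / ?R) + expectation (\<lambda>\<omega>. min 1 (norm (Y n \<omega> - ?U \<omega>))))"
          unfolding q_def[abs_def] using elim(2) im by (simp add: prob_space)
        also have "\<dots> \<le> 1 / ?R + 2 * C * (K * (1 / ?R) + 1 / ?R)"
          using elim C0 by (intro add_left_mono mult_left_mono add_mono mult_right_mono) auto
        also have "K * (1 / ?R) + 1 / ?R = (K + 1) * (1 / ?R)" by (simp only: distrib_right mult_1_left)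
        finally show ?thesis .
      qed
      have pt: "\<bar>g (Y n \<omega>) - g (?s (Y n \<omega>))\<bar> \<le> q \<omega>" for \<omega>
      proof (cases "norm (Y n \<omega>) \<le> ?R")
        case True
        have "0 \<le> 2 * C * (norm (?U \<omega>) * (1 / ?R) + min 1 (norm (Y n \<omega> - ?U \<omega>)))"
          using C0 by (intro mult_nonneg_nonneg add_nonneg_nonneg) auto
        then show ?thesis using L(2)[OF True] unfolding q_def by linarith
      next
        case False
        have "1 \<le> norm (?U \<omega>) * (1 / ?R) + min 1 (norm (Y n \<omega> - ?U \<omega>))"
        proof (cases "1 \<le> norm (Y n \<omega> - ?U \<omega>)")
          case True
          then show ?thesis by simp
        next
          case small: False
          have "norm (Y n \<omega>) \<le> norm (?U \<omega>) + norm (Y n \<omega> - ?U \<omega>)" by (metis norm_triangle_sub)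
          then have "?R \<le> norm (?U \<omega>) + norm (Y n \<omega> - ?U \<omega>)" using False by linarith
          then have "?R * (1 / ?R) \<le> (norm (?U \<omega>) + norm (Y n \<omega> - ?U \<omega>)) * (1 / ?R)" by (rule mult_right_mono) simp
          also have "\<dots> \<le> norm (?U \<omega>) * (1 / ?R) + norm (Y n \<omega> - ?U \<omega>)"
            unfolding distrib_right by (intro add_left_mono mult_left_le) auto
          finally show ?thesis using small by simp
        qed
        then have "2 * C * 1 \<le> 2 * C * (norm (?U \<omega>) * (1 / ?R) + min 1 (norm (Y n \<omega> - ?U \<omega>)))"
          using C0 by (intro mult_left_mono) auto
        moreover have "0 \<le> 1 / ?R" by simp
        ultimately show ?thesis using gd[of "Y n \<omega>" "?s (Y n \<omega>)"] unfolding q_def by linarith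
      qed
      have iM: "integrable M (\<lambda>\<omega>. g (Y n \<omega>) * \<zeta> \<omega>)" "integrable M (\<lambda>\<omega>. g (?s (Y n \<omega>)) * \<zeta> \<omega>)"
        by (rule i\<zeta>'[of _ C], measurable, rule g(2))+
      have iN: "integrable \<nu> g" "integrable \<nu> (\<lambda>x. g (?s x))"
        by (rule \<nu>.integrable_const_bound[of _ C], simp add: g, measurable)+
      have "a n - b k n = (\<integral>\<omega>. (g (Y n \<omega>) - g (?s (Y n \<omega>))) * \<zeta> \<omega> \<partial>M) - (\<integral>x. g x - g (?s x) \<partial>\<nu>) * (\<integral>\<omega>. \<zeta> \<omega> \<partial>M)"
        unfolding a_def b_def left_diff_distrib Bochner_Integration.integral_diff[OF iM] Bochner_Integration.integral_diff[OF iN] by simp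
      also have "norm \<dots> \<le> B * (1 / ?R + 2 * C * ((K + 1) * (1 / ?R))) + B * I k"
      proof (rule order_trans[OF norm_triangle_ineq4 add_mono])
        have "norm (\<integral>\<omega>. (g (Y n \<omega>) - g (?s (Y n \<omega>))) * \<zeta> \<omega> \<partial>M) \<le> (\<integral>\<omega>. q \<omega> * B \<partial>M)"
        proof (rule order_trans[OF integral_norm_bound integral_mono'])
          show "integrable M (\<lambda>\<omega>. q \<omega> * B)" using iq by simp
          show "norm ((g (Y n \<omega>) - g (?s (Y n \<omega>))) * \<zeta> \<omega>) \<le> q \<omega> * B" if "\<omega> \<in> space M" for \<omega>
            unfolding real_norm_def abs_mult using order_trans[OF abs_ge_zero pt] by (intro mult_mono pt \<zeta>(3) that) auto
          show "0 \<le> q \<omega> * B" for \<omega> using order_trans[OF abs_ge_zero pt] B0 by (rule mult_nonneg_nonneg)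
        qed
        also have "\<dots> = B * expectation q" by simp
        also have "\<dots> \<le> B * (1 / ?R + 2 * C * ((K + 1) * (1 / ?R)))" by (rule mult_left_mono[OF Eq B0])
        finally show "norm (\<integral>\<omega>. (g (Y n \<omega>) - g (?s (Y n \<omega>))) * \<zeta> \<omega> \<partial>M) \<le> B * (1 / ?R + 2 * C * ((K + 1) * (1 / ?R)))" .
        have 1: "\<bar>\<integral>x. g x - g (?s x) \<partial>\<nu>\<bar> \<le> I k"
          unfolding I_def using integral_norm_bound[of \<nu> "\<lambda>x. g x - g (?s x)"] by simp
        have "\<bar>\<integral>\<omega>. \<zeta> \<omega> \<partial>M\<bar> \<le> (\<integral>\<omega>. B \<partial>M)"
          unfolding real_norm_def[symmetric]
          by (rule order_trans[OF integral_norm_bound integral_mono']) (use \<zeta>(3) B0 in auto)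
        then have 2: "\<bar>\<integral>\<omega>. \<zeta> \<omega> \<partial>M\<bar> \<le> B" by (simp add: prob_space)
        show "norm ((\<integral>x. g x - g (?s x) \<partial>\<nu>) * (\<integral>\<omega>. \<zeta> \<omega> \<partial>M)) \<le> B * I k"
          unfolding real_norm_def abs_mult mult.commute[of B]
            by (rule mult_mono[OF 1 2 order_trans[OF abs_ge_zero 1] abs_ge_zero])
      qed
      finally show ?case .
    qed
  qed
  then show ?thesis unfolding a_def by (rule LIM_zero_cancel)
qed

end

section \<open>The limit law\<close>

definition entry_law :: "'d \<times> 'd \<Rightarrow> real measure" where
  "entry_law = (\<lambda>(i, j). density lborel (normal_density 0 (sqrt (1 + (if i = j then 1 else 0)))))"

text \<open>Of the coordinates, one for each ordered pair, only those on or below the diagonal are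
  read.\<close>

definition symmetric_matrix :: "('d \<times> 'd \<Rightarrow> real) \<Rightarrow> ((real, 'd::{finite,linorder}) vec, 'd) vec" where
  "symmetric_matrix x = (\<chi> i j. x (max i j, min i j))"

definition limit_law :: "(((real, 'd::{finite,linorder}) vec, 'd) vec) measure" where
  "limit_law = distr (PiM UNIV entry_law) borel symmetric_matrix"

text \<open>The identity on the range of \<open>symmetric_matrix\<close>. The limit law charges only
  symmetric matrices, but its space contains all matrices, whereas
  \<open>sym_gaussian_matrix\<close> demands symmetry at every point of the extension.\<close>

definition symmetrize :: "((real, 'd::{finite,linorder}) vec, 'd) vec \<Rightarrow> ((real, 'd) vec, 'd) vec" where
  "symmetrize A = (\<chi> i j. A $ max i j $ min i j)"

lemma symmetrize_symmetric_matrix: "symmetrize (symmetric_matrix x) = symmetric_matrix x"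
  by (simp add: symmetrize_def symmetric_matrix_def vec_eq_iff max_def min_def)

lemma continuous_on_symmetrize: "continuous_on S symmetrize"
  unfolding symmetrize_def[abs_def] by (intro continuous_intros)

lemma prob_space_entry_law: "prob_space (entry_law k)"
  by (cases k) (auto simp: entry_law_def intro!: prob_space_normal_density)

lemma sets_entry_law [measurable_cong]: "sets (entry_law k) = sets borel"
  by (cases k) (simp add: entry_law_def)

interpretation entry_law: product_prob_space entry_law UNIV
  by (simp add: product_prob_space_def product_prob_space_axioms_def product_sigma_finite_def
      prob_space_entry_law prob_space_imp_sigma_finite)

lemma symmetric_matrix_measurable [measurable]: "symmetric_matrix \<in> borel_measurable (PiM UNIV entry_law)"
  unfolding symmetric_matrix_def[abs_def]
proof (rule borel_measurable_euclidean_space[THEN iffD2], intro ballI)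
  fix b :: "((real, 'a) vec, 'a) vec" assume "b \<in> Basis"
  then obtain i j where b: "b = axis i (axis j 1)" by (auto simp: Basis_vec_def)
  have "(\<lambda>x. x (max i j, min i j)) \<in> borel_measurable (PiM UNIV entry_law)"
    by (rule measurable_compose[OF measurable_component_singleton[of _ UNIV entry_law]]) auto
  then show "(\<lambda>x. (\<chi> i j. x (max i j, min i j)) \<bullet> b) \<in> borel_measurable (PiM UNIV entry_law)"
    by (simp add: b inner_axis)
qed

lemma prob_space_limit_law: "prob_space limit_law"
  unfolding limit_law_def
  by (rule prob_space.prob_space_distr[OF prob_space_PiM[OF prob_space_entry_law] symmetric_matrix_measurable])

lemma sets_limit_law [measurable_cong]: "sets limit_law = sets borel"
  by (simp add: limit_law_def)

lemma space_limit_law [simp]: "space limit_law = UNIV"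
  by (simp add: limit_law_def)

lemma sum_fold_triangle:
  fixes f :: "'d::{finite,linorder} \<Rightarrow> 'd \<Rightarrow> real"
  shows "(\<Sum>i\<in>UNIV. \<Sum>j\<in>UNIV. f i j) = (\<Sum>i\<in>UNIV. \<Sum>j\<in>UNIV. if i = j then f i j else if j < i then f i j + f j i else 0)"
proof -
  have "(\<Sum>i\<in>UNIV. \<Sum>j\<in>UNIV. f i j) = (\<Sum>i\<in>UNIV. \<Sum>j\<in>UNIV. (if j \<le> i then f i j else 0) + (if i < j then f i j else 0))"
    by (intro sum.cong refl) auto
  also have "\<dots> = (\<Sum>i\<in>UNIV. \<Sum>j\<in>UNIV. if j \<le> i then f i j else 0) + (\<Sum>i\<in>UNIV. \<Sum>j\<in>UNIV. if j < i then f j i else 0)"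
    unfolding sum.distrib by (rule arg_cong[where f = "(+) _"], rule sum.swap)
  also have "\<dots> = (\<Sum>i\<in>UNIV. \<Sum>j\<in>UNIV. if i = j then f i j else if j < i then f i j + f j i else 0)"
    unfolding sum.distrib[symmetric] by (intro sum.cong refl) auto
  finally show ?thesis .
qed

lemma sum_UNIV_pair:
  fixes f :: "'d::finite \<times> 'd \<Rightarrow> real"
  shows "(\<Sum>k\<in>UNIV. f k) = (\<Sum>i\<in>UNIV. \<Sum>j\<in>UNIV. f (i, j))"
  by (simp add: sum.cartesian_product' flip: UNIV_Times_UNIV)

text \<open>Folding A onto the lower triangle gives the coefficients A_ii and A_ij + A_ji. With the
  variances 2 and 1 the exponent becomes \<open>quad_var A\<close>; this matches the prescribed 1 +
  \<delta>_ij with the covariance of the squares of Gaussian coordinates.\<close>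

lemma limit_law_char:
  fixes A :: "((real, 'd::{finite,linorder}) vec, 'd) vec"
  shows "(\<integral>x. iexp (A \<bullet> x) \<partial>limit_law) = of_real (exp (- quad_var A / 2))"
proof -
  define a where "a = (\<lambda>(i, j). if i = j then A $ i $ j else if j < i then A $ i $ j + A $ j $ i else 0)"
  define s :: "'d \<times> 'd \<Rightarrow> real" where "s = (\<lambda>(i, j). sqrt (1 + (if i = j then 1 else 0)))"
  have lin: "A \<bullet> symmetric_matrix x = (\<Sum>k\<in>UNIV. a k * x k)" for x
  proof -
    have "A \<bullet> symmetric_matrix x = (\<Sum>i\<in>UNIV. \<Sum>j\<in>UNIV. A $ i $ j * x (max i j, min i j))"
      by (simp add: inner_vec_def symmetric_matrix_def)
    also have "\<dots> = (\<Sum>i\<in>UNIV. \<Sum>j\<in>UNIV. a (i, j) * x (i, j))"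
      by (subst sum_fold_triangle, intro sum.cong refl)
        (auto simp: a_def max_def min_def algebra_simps)
    finally show ?thesis by (simp only: sum_UNIV_pair)
  qed
  have var: "(\<Sum>k\<in>UNIV. (a k)\<^sup>2 * (s k)\<^sup>2) = quad_var A"
  proof -
    have "quad_var A = (\<Sum>i\<in>UNIV. \<Sum>j\<in>UNIV. (a (i, j))\<^sup>2 * (s (i, j))\<^sup>2)"
      unfolding quad_var_def
      by (subst sum_fold_triangle, intro sum.cong refl)
        (auto simp: a_def s_def power2_eq_square algebra_simps)
    then show ?thesis by (simp only: sum_UNIV_pair)
  qed
  have one: "(\<integral>x. iexp (a k * x) \<partial>entry_law k) = of_real (exp (- ((a k)\<^sup>2 * (s k)\<^sup>2 / 2)))" for k
  proof (rule distributed_normal_iexp[OF prob_space_entry_law])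
    obtain i j where k: "k = (i, j)" by (cases k)
    show "0 < s k" by (simp add: s_def k)
    have "distr (entry_law k) lborel (\<lambda>x. x) = entry_law k"
      by (rule distr_id2) (simp add: sets_entry_law)
    then show "distributed (entry_law k) lborel (\<lambda>x. x) (normal_density 0 (s k))"
      by (simp add: distributed_def k s_def entry_law_def)
  qed
  have "(\<integral>x. iexp (A \<bullet> x) \<partial>limit_law) = (\<integral>x. iexp (A \<bullet> symmetric_matrix x) \<partial>PiM UNIV entry_law)"
    unfolding limit_law_def by (rule integral_distr) auto
  also have "\<dots> = (\<integral>x. (\<Prod>k\<in>UNIV. iexp (a k * x k)) \<partial>PiM UNIV entry_law)"
    unfolding lin by (simp add: exp_sum[symmetric] sum_distrib_left)
  also have "\<dots> = (\<Prod>k\<in>UNIV. \<integral>x. iexp (a k * x) \<partial>entry_law k)"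
  proof (rule entry_law.product_integral_prod[OF finite])
    fix k :: "'d \<times> 'd"
    show "integrable (entry_law k) (\<lambda>x. iexp (a k * x))"
      by (rule finite_measure.integrable_const_bound[OF prob_space.finite_measure[OF prob_space_entry_law], of _ 1]) auto
  qed
  also have "\<dots> = of_real (exp (\<Sum>k\<in>UNIV. - ((a k)\<^sup>2 * (s k)\<^sup>2 / 2)))"
    unfolding one by (simp add: exp_sum)
  also have "(\<Sum>k\<in>UNIV. - ((a k)\<^sup>2 * (s k)\<^sup>2 / 2)) = - quad_var A / 2"
    by (simp add: sum_negf sum_divide_distrib[symmetric] var)
  finally show ?thesis .
qed

definition limit_matrix :: "'w \<times> ((real, 'd::{finite,linorder}) vec, 'd) vec \<Rightarrow> ((real, 'd) vec, 'd) vec" where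
  "limit_matrix \<omega> = symmetrize (snd \<omega>)"

lemma symmetrize_measurable [measurable]: "symmetrize \<in> borel_measurable borel"
  by (rule borel_measurable_continuous_onI[OF continuous_on_symmetrize])

section \<open>The product extension\<close>

context
  fixes P :: "'w measure" and D :: "'d::{finite,linorder} itself"
  assumes P: "prob_space P"
begin

interpretation base: prob_space P by (rule P)

interpretation limit: prob_space "limit_law :: ((real, 'd) vec, 'd) vec measure"
  by (rule prob_space_limit_law)

interpretation pair: pair_prob_space P "limit_law :: ((real, 'd) vec, 'd) vec measure" ..

abbreviation extension :: "('w \<times> ((real, 'd) vec, 'd) vec) measure" where
  "extension \<equiv> P \<Otimes>\<^sub>M limit_law"

lemma limit_matrix_measurable [measurable]: "limit_matrix \<in> borel_measurable extension"
  unfolding limit_matrix_def[abs_def] by measurable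

lemma distr_extension_snd: "distr extension limit_law snd = limit_law"
proof (intro measure_eqI)
  fix A assume A: "A \<in> sets (distr extension limit_law snd)"
  have "emeasure (distr extension limit_law snd) A = emeasure extension (space P \<times> A)"
    using A by (auto simp: emeasure_distr space_pair_measure dest: sets.sets_into_space intro!: arg_cong2[where f = emeasure])
  with A show "emeasure (distr extension limit_law snd) A = emeasure limit_law A"
    by (simp add: limit.emeasure_pair_measure_Times base.emeasure_space_1)
qed simp

lemma distr_limit_matrix:
  assumes "f \<in> measurable borel N"
  shows "distr extension N (\<lambda>\<omega>. f (limit_matrix \<omega>)) = distr (PiM UNIV entry_law) N (\<lambda>x. f (symmetric_matrix x))"
proof -
  note [measurable] = assms
  have "distr extension N (\<lambda>\<omega>. f (limit_matrix \<omega>)) = distr (distr extension limit_law snd) N (\<lambda>A. f (symmetrize A))"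
    by (subst distr_distr) (auto simp: limit_matrix_def o_def)
  also have "\<dots> = distr (distr (PiM UNIV entry_law) borel symmetric_matrix) N (\<lambda>A. f (symmetrize A))"
    unfolding distr_extension_snd by (simp only: limit_law_def)
  also have "\<dots> = distr (PiM UNIV entry_law) N (\<lambda>x. f (symmetric_matrix x))"
    by (subst distr_distr) (auto simp: o_def symmetrize_symmetric_matrix)
  finally show ?thesis .
qed

lemma distr_limit_matrix_entry:
  "distr extension borel (\<lambda>\<omega>. limit_matrix \<omega> $ i $ j) = entry_law (i, j)"
proof -
  have "distr extension borel (\<lambda>\<omega>. limit_matrix \<omega> $ i $ j) = distr (PiM UNIV entry_law) borel (\<lambda>x. symmetric_matrix x $ i $ j)"
    by (rule distr_limit_matrix[of "\<lambda>A. A $ i $ j"]) (auto intro!: borel_measurable_continuous_onI continuous_intros)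
  also have "\<dots> = distr (PiM UNIV entry_law) (entry_law (max i j, min i j)) (\<lambda>x. x (max i j, min i j))"
    by (rule distr_cong) (auto simp: symmetric_matrix_def sets_entry_law)
  also have "\<dots> = entry_law (max i j, min i j)"
    by (rule distr_PiM_component) (auto simp: prob_space_entry_law)
  also have "\<dots> = entry_law (i, j)"
    by (auto simp: entry_law_def max_def min_def)
  finally show ?thesis .
qed

lemma limit_matrix_entry_measurable [measurable]: "(\<lambda>\<omega>. limit_matrix \<omega> $ i $ j) \<in> borel_measurable extension"
  by (rule measurable_compose[OF limit_matrix_measurable])
    (auto intro!: borel_measurable_continuous_onI continuous_intros)

text \<open>On the lower triangle \<open>symmetric_matrix\<close> returns the coordinates
  themselves, so the joint law there is a marginal of the product measure, which is the product of
  the laws of the entries; this is independence.\<close>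

lemma sym_gaussian_limit_matrix: "sym_gaussian_matrix extension limit_matrix"
  unfolding sym_gaussian_matrix_def
proof (intro conjI ballI allI)
  show "transpose (limit_matrix \<omega>) = limit_matrix \<omega>" for \<omega>
    by (simp add: limit_matrix_def symmetrize_def transpose_def vec_eq_iff max.commute min.commute)
  show "distributed extension lborel (\<lambda>\<omega>. limit_matrix \<omega> $ i $ j) (normal_density 0 (sqrt (1 + (if i = j then 1 else 0))))" for i j
  proof -
    have "distr extension lborel (\<lambda>\<omega>. limit_matrix \<omega> $ i $ j) = distr extension borel (\<lambda>\<omega>. limit_matrix \<omega> $ i $ j)"
      by (rule distr_cong) auto
    then show ?thesis unfolding distributed_def by (auto simp: distr_limit_matrix_entry entry_law_def)
  qed
  let ?I = "{(i, j). j \<le> i} :: ('d \<times> 'd) set"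
  let ?X = "\<lambda>k \<omega>. limit_matrix \<omega> $ fst k $ snd k :: real"
  have "distr extension (PiM ?I (\<lambda>_. borel)) (\<lambda>\<omega>. \<lambda>k\<in>?I. ?X k \<omega>)
      = distr (PiM UNIV entry_law) (PiM ?I (\<lambda>_. borel)) (\<lambda>x. \<lambda>k\<in>?I. symmetric_matrix x $ fst k $ snd k)"
  proof (rule distr_limit_matrix[of "\<lambda>A. \<lambda>k\<in>?I. A $ fst k $ snd k"], rule measurable_restrict)
    show "(\<lambda>A. A $ fst k $ snd k) \<in> borel_measurable (borel :: ((real, 'd) vec, 'd) vec measure)" for k :: "'d \<times> 'd"
      by (intro borel_measurable_continuous_onI continuous_intros)
  qed
  also have "\<dots> = distr (PiM UNIV entry_law) (PiM ?I entry_law) (\<lambda>x. restrict x ?I)"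
    by (rule distr_cong)
      (auto simp: symmetric_matrix_def max_def min_def sets_entry_law intro!: sets_PiM_cong restrict_ext)
  also have "\<dots> = PiM ?I entry_law"
    by (rule entry_law.distr_restrict[symmetric]) auto
  also have "\<dots> = PiM ?I (\<lambda>k. distr extension borel (?X k))"
    by (rule PiM_cong) (auto simp: distr_limit_matrix_entry)
  finally have *: "distr extension (PiM ?I (\<lambda>_. borel)) (\<lambda>\<omega>. \<lambda>k\<in>?I. ?X k \<omega>) = \<dots>" .
  have "prob_space.indep_vars extension (\<lambda>_. borel) ?X ?I"
  proof (rule pair.P.indep_vars_iff_distr_eq_PiM'[THEN iffD2, OF _ _ *])
    show "?I \<noteq> {}" by auto
    show "?X k \<in> borel_measurable extension" for k by simp
  qed
  then show "prob_space.indep_vars extension (\<lambda>_. borel) (\<lambda>(i, j) \<omega>. limit_matrix \<omega> $ i $ j) ?I"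
    by (simp add: case_prod_beta')
qed

lemma independent_of_base_limit_matrix: "independent_of_base P extension fst limit_matrix"
  unfolding independent_of_base_def
proof (rule pair.P.indep_setI)
  show "{fst -` A \<inter> space extension | A. A \<in> sets P} \<subseteq> sets extension"
    by (auto intro: measurable_sets[OF measurable_fst])
  show "{limit_matrix -` B \<inter> space extension | B. B \<in> sets borel} \<subseteq> sets extension"
    using measurable_sets[OF limit_matrix_measurable] by blast
  fix a b assume "a \<in> {fst -` A \<inter> space extension | A. A \<in> sets P}" "b \<in> {limit_matrix -` B \<inter> space extension | B. B \<in> sets borel}"
  then obtain A B where A: "A \<in> sets P" and B: "B \<in> sets borel"
    and ab: "a = fst -` A \<inter> space extension" "b = limit_matrix -` B \<inter> space extension" by blast
  define B' where "B' = symmetrize -` B"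
  have B': "B' \<in> sets limit_law"
    using measurable_sets[OF symmetrize_measurable B] by (simp add: B'_def sets_limit_law)
  have eq: "a = A \<times> space limit_law" "b = space P \<times> B'" "a \<inter> b = A \<times> B'"
    using sets.sets_into_space[OF A] by (auto simp: ab space_pair_measure limit_matrix_def B'_def)
  show "measure extension (a \<inter> b) = measure extension a * measure extension b"
    unfolding eq(3) unfolding eq(1,2)
    by (simp add: measure_def limit.emeasure_pair_measure_Times A B' enn2real_mult base.emeasure_space_1
        limit.emeasure_space_1[simplified])
qed

text \<open>Fubini, and the symmetrization is invisible under the limit law. The product on the
  right is the limit that \<open>stable_limit\<close> provides.\<close>

lemma integral_extension:
  assumes g: "continuous_on UNIV (g :: ((real, 'd) vec, 'd) vec \<Rightarrow> real)" "\<And>x. \<bar>g x\<bar> \<le> C"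
    and \<zeta>: "\<zeta> \<in> borel_measurable P" "\<And>\<omega>. \<omega> \<in> space P \<Longrightarrow> \<bar>\<zeta> \<omega>\<bar> \<le> B"
  shows "(\<integral>\<omega>. g (limit_matrix \<omega>) * \<zeta> (fst \<omega>) \<partial>extension) = (\<integral>x. g x \<partial>limit_law) * (\<integral>\<omega>. \<zeta> \<omega> \<partial>P)"
proof -
  have [measurable]: "g \<in> borel_measurable borel" by (rule borel_measurable_continuous_onI[OF g(1)])
  note [measurable] = \<zeta>(1)
  have C0: "0 \<le> C" using g(2)[of 0] by (rule order_trans[rotated]) simp
  have int: "integrable extension (\<lambda>(\<omega>, A). g (symmetrize A) * \<zeta> \<omega>)"
  proof (rule pair.P.integrable_const_bound[of _ "C * B"])
    show "AE x in extension. norm (case x of (\<omega>, A) \<Rightarrow> g (symmetrize A) * \<zeta> \<omega>) \<le> C * B"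
      by (rule AE_I2) (auto simp: space_pair_measure abs_mult intro!: mult_mono g(2) \<zeta>(2) C0)
  qed measurable
  have "(\<integral>\<omega>. g (limit_matrix \<omega>) * \<zeta> (fst \<omega>) \<partial>extension) = (\<integral>x. (case x of (\<omega>, A) \<Rightarrow> g (symmetrize A) * \<zeta> \<omega>) \<partial>extension)"
    by (simp add: limit_matrix_def case_prod_beta')
  also have "\<dots> = (\<integral>\<omega>. (\<integral>A. g (symmetrize A) * \<zeta> \<omega> \<partial>limit_law) \<partial>P)"
    by (rule pair.integral_fst[OF int, symmetric])
  also have "\<dots> = (\<integral>A. g (symmetrize A) \<partial>limit_law) * (\<integral>\<omega>. \<zeta> \<omega> \<partial>P)" by simp
  also have "(\<integral>A. g (symmetrize A) \<partial>limit_law) = (\<integral>x. g x \<partial>limit_law)"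
    unfolding limit_law_def by (simp add: integral_distr symmetrize_symmetric_matrix)
  finally show ?thesis .
qed

lemma prob_extension_extension: "prob_extension P (extension :: ('w \<times> ((real, 'd) vec, 'd) vec) measure) fst"
  unfolding prob_extension_def using limit.distr_pair_fst
  by (auto intro: P pair.P.prob_space_axioms)

end

section \<open>The diffusion\<close>

lemma augmented_filtration_mono:
  assumes "s \<le> t"
  shows "sets (augmented_filtration M W s) \<subseteq> sets (augmented_filtration M W t)"
proof -
  have "sets (sigma_gen_by M {0..s} W) \<subseteq> sets (sigma_gen_by M {0..t} W)"
    by (rule sets_sigma_gen_by_subset) (use assms in \<open>auto intro!: sigma_gen_by_measurable\<close>)
  then show ?thesis unfolding sets_augmented_filtration by (intro sigma_sets_mono') blast
qed

lemma augmented_filtration_subset: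
  assumes "\<And>s. 0 \<le> s \<Longrightarrow> W s \<in> borel_measurable M"
  shows "sets (augmented_filtration M W t) \<subseteq> sets M"
proof -
  have "sets (sigma_gen_by M {0..t} W) \<subseteq> sets M"
    by (rule sets_sigma_gen_by_subset) (use assms in auto)
  then show ?thesis unfolding sets_augmented_filtration by (intro sets.sigma_sets_subset) auto
qed

lemma borel_measurable_mono:
  assumes "sets N \<subseteq> sets N'" "space N = space N'" "f \<in> borel_measurable N"
  shows "f \<in> borel_measurable N'"
  using assms by (auto simp: measurable_def)

text \<open>The Riesz vector of the derivative, written in the standard basis, depends continuously
  on the point; uniqueness of the derivative identifies it with the description in
  \<open>gradient\<close>.\<close>

lemma continuous_on_gradient:
  fixes V :: "'a::euclidean_space \<Rightarrow> real"
  assumes "continuously_differentiable V"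
  shows "continuous_on UNIV (gradient V)"
proof -
  obtain f' where f': "\<And>x. (V has_derivative blinfun_apply (f' x)) (at x)" "continuous_on UNIV f'"
    using assms by (auto simp: continuously_differentiable_def)
  define D where "D x = (\<Sum>b\<in>Basis. blinfun_apply (f' x) b *\<^sub>R b)" for x
  have D: "GDERIV V x :> D x" for x
  proof -
    have "blinfun_apply (f' x) k = k \<bullet> D x" for k
    proof -
      have "blinfun_apply (f' x) k = blinfun_apply (f' x) (\<Sum>b\<in>Basis. (k \<bullet> b) *\<^sub>R b)" by (simp add: euclidean_representation)
      also have "\<dots> = (\<Sum>b\<in>Basis. (k \<bullet> b) * blinfun_apply (f' x) b)" by (simp add: blinfun.sum_right blinfun.scaleR_right)
      also have "\<dots> = k \<bullet> D x" by (simp add: D_def inner_sum_right mult.commute)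
      finally show ?thesis .
    qed
    then have "blinfun_apply (f' x) = (\<lambda>k. k \<bullet> D x)" by auto
    with f'(1)[of x] show ?thesis by (simp add: gderiv_def)
  qed
  have "gradient V x = D x" for x
    unfolding gradient_def
  proof (rule the_equality)
    show "GDERIV V x :> D x" by (rule D)
    fix E assume "GDERIV V x :> E"
    then have "(\<lambda>k. k \<bullet> E) = (\<lambda>k. k \<bullet> D x)"
      using D[of x] unfolding gderiv_def by (rule has_derivative_unique)
    then have "k \<bullet> E = k \<bullet> D x" for k by meson
    then show "E = D x" by (intro vector_eq_ldot[THEN iffD1]) simp
  qed
  then have "gradient V = D" by auto
  then show ?thesis unfolding D_def[abs_def] using f'(2) by (auto intro!: continuous_intros)
qed

lemma continuously_differentiable_continuous:
  "continuously_differentiable f \<Longrightarrow> continuous_on UNIV f"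
  unfolding continuously_differentiable_def
  by (metis continuous_at_imp_continuous_on has_derivative_continuous)

lemma continuous_on_matrix_vector_mult:
  fixes A :: "'s::topological_space \<Rightarrow> real^'d^'d"
  shows "continuous_on S A \<Longrightarrow> continuous_on S v \<Longrightarrow> continuous_on S (\<lambda>s. A s *v v s)"
  unfolding matrix_vector_mult_def by (intro continuous_intros)

text \<open>Were the claim false, there would be steps below (1 / 2)^j for every j at which
  \<open>F\<close> keeps a fixed distance from l; these steps are summable. Their indices come in no
  particular order, which is harmless because \<open>F\<close> sees only the step.\<close>

lemma tendsto_via_summable:
  fixes h :: "nat \<Rightarrow> real" and F :: "real \<Rightarrow> real"
  assumes h: "\<And>n. 0 < h n" "h \<longlonglongrightarrow> 0"
    and F: "\<And>k. (\<And>n. 0 < k n) \<Longrightarrow> k \<longlonglongrightarrow> 0 \<Longrightarrow> summable k \<Longrightarrow> (\<lambda>n. F (k n)) \<longlonglongrightarrow> l"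
  shows "(\<lambda>n. F (h n)) \<longlonglongrightarrow> l"
proof (rule ccontr)
  assume "\<not> (\<lambda>n. F (h n)) \<longlonglongrightarrow> l"
  then obtain e where e: "0 < e" "\<not> (\<forall>\<^sub>F n in sequentially. dist (F (h n)) l < e)"
    unfolding tendsto_iff by blast
  have "\<forall>j. \<exists>n. h n < (1 / 2) ^ j \<and> e \<le> dist (F (h n)) l"
  proof
    fix j :: nat
    have "\<forall>\<^sub>F n in sequentially. h n < (1 / 2) ^ j" by (rule order_tendstoD(2)[OF h(2)]) simp
    then obtain N where N: "\<And>n. n \<ge> N \<Longrightarrow> h n < (1 / 2) ^ j" by (auto simp: eventually_sequentially)
    obtain n where "n \<ge> N" "\<not> dist (F (h n)) l < e"
      using e(2) unfolding eventually_sequentially by blast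
    then show "\<exists>n. h n < (1 / 2) ^ j \<and> e \<le> dist (F (h n)) l"
      by (intro exI[of _ n] conjI N) auto
  qed
  from choice[OF this] obtain r where r: "\<And>j. h (r j) < (1 / 2) ^ j" "\<And>j. e \<le> dist (F (h (r j))) l" by blast
  have sm: "summable (\<lambda>j. h (r j))"
  proof (rule summable_comparison_test')
    show "summable (\<lambda>j. (1 / 2 :: real) ^ j)" by (rule summable_geometric) simp
    show "norm (h (r j)) \<le> (1 / 2) ^ j" for j using r(1)[of j] h(1)[of "r j"] by simp
  qed
  have "(\<lambda>j. F (h (r j))) \<longlonglongrightarrow> l"
    by (rule F[OF h(1) summable_LIMSEQ_zero[OF sm] sm])
  then have "\<forall>\<^sub>F j in sequentially. dist (F (h (r j))) l < e" using e(1) by (rule tendstoD)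
  moreover have "\<not> dist (F (h (r j))) l < e" for j using r(2)[of j] by simp
  ultimately show False by simp
qed

lemma estimator_measurable:
  fixes X :: "real \<Rightarrow> 'w \<Rightarrow> real^'d"
  assumes h: "0 < h" and X: "\<And>t. 0 \<le> t \<Longrightarrow> t \<le> T \<Longrightarrow> X t \<in> borel_measurable N"
  shows "(\<lambda>\<omega>. r *\<^sub>R (S ** sigma2_hat T h (\<lambda>t. X t \<omega>) ** S - mat 1)) \<in> borel_measurable N"
proof -
  have sd: "(\<lambda>\<omega>. second_diff (\<lambda>t. X t \<omega>) h (Suc p)) \<in> borel_measurable N" if p: "p < block_count T h" for p
  proof -
    have "real p * h \<ge> 0" using h by simp
    then have "0 \<le> (2 * real (Suc p) - 1) * h" "0 \<le> 2 * real (Suc p) * h" "(2 * real (Suc p) + 1) * h \<le> T"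
      "2 * real (Suc p) * h \<le> T" "(2 * real (Suc p) - 1) * h \<le> T" "0 \<le> (2 * real (Suc p) + 1) * h"
      using block_time_le[OF h p] h by (simp_all add: algebra_simps)
    then show ?thesis
      unfolding second_diff_def
      by (intro borel_measurable_add borel_measurable_diff borel_measurable_scaleR borel_measurable_const X)
  qed
  have "(\<lambda>x :: real^'d. outer_prod x x) \<in> borel_measurable borel"
    unfolding outer_prod_def by (intro borel_measurable_continuous_onI continuous_intros)
  from measurable_compose[OF sd this]
  have "(\<lambda>\<omega>. outer_prod (second_diff (\<lambda>t. X t \<omega>) h (Suc p)) (second_diff (\<lambda>t. X t \<omega>) h (Suc p))) \<in> borel_measurable N"
    if "p < block_count T h" for p using that .
  then have "(\<lambda>\<omega>. sigma2_hat T h (\<lambda>t. X t \<omega>)) \<in> borel_measurable N"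
    unfolding sigma2_hat_eq by (intro borel_measurable_scaleR borel_measurable_const borel_measurable_sum) auto
  moreover have "(\<lambda>A. r *\<^sub>R (S ** A ** S - mat 1)) \<in> borel_measurable borel"
    by (intro borel_measurable_continuous_onI continuous_intros linear_continuous_on linear_sandwich
        linear_conv_bounded_linear[THEN iffD1])
  ultimately show ?thesis by (rule measurable_compose)
qed

theorem corollary3p3:
  fixes M :: "'w measure"
    and W :: "real \<Rightarrow> 'w \<Rightarrow> real^('d::{finite,linorder})"
    and \<sigma> :: "((real, 'd) vec, 'd) vec"
    and c :: "(real, 'd) vec \<Rightarrow> (real, 'd) vec \<Rightarrow> ((real, 'd) vec, 'd) vec"
    and V :: "(real, 'd) vec \<Rightarrow> real"
    and z :: "(real, 'd) vec \<times> (real, 'd) vec"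
    and Z :: "real \<Rightarrow> 'w \<Rightarrow> (real, 'd) vec \<times> (real, 'd) vec"
    and T :: real
    and h :: "nat \<Rightarrow> real"
    and P :: "'w measure"
  assumes "T > 0"
    and "hyp_H0 \<sigma>" and "hyp_H1 V" and "hyp_H2 c"
    and "standard_brownian_motion M W"
    and "unique_strong_solution M W \<sigma> c V z Z"
    and "\<And>n. h n > 0" and "h \<longlonglongrightarrow> 0"
  defines "P \<equiv> restr_to_subalg M (sigma_gen_by M {0..T} Z)"
  shows "\<exists>(M' :: ('w \<times> ((real, 'd) vec, 'd) vec) measure) \<pi> N.
           sym_gaussian_matrix M' N \<and>
           independent_of_base P M' \<pi> N \<and>
           stably_converges P
             (\<lambda>n \<omega>. sqrt (T / (2 * h n)) *\<^sub>R
                (matrix_inv \<sigma> ** sigma2_hat T (h n) (\<lambda>t. fst (Z t \<omega>)) ** matrix_inv \<sigma> - mat 1))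
             M' \<pi> N"
proof -
  interpret prob_space M using assms(5) by (simp add: standard_brownian_motion_def)
  interpret brownian_motion M W by unfold_locales (rule assms(5))
  define F where "F = sigma_gen_by M {0..T} Z"
  define est where "est s \<omega> = sqrt (T / (2 * s)) *\<^sub>R
      (matrix_inv \<sigma> ** sigma2_hat T s (\<lambda>t. fst (Z t \<omega>)) ** matrix_inv \<sigma> - mat 1)" for s \<omega>
  have sol: "strong_solution M W \<sigma> c V z Z" using assms(6) by (simp add: unique_strong_solution_def)
  have Zaug: "Z t \<in> borel_measurable (augmented_filtration M W t)" if "0 \<le> t" for t
    using sol that by (simp add: strong_solution_def)
  \<comment> \<open>Adaptedness of Z places its sigma-algebra up to T inside the augmented Brownian
    filtration at T, so that \<open>mixing\<close> covers all test variables of P.\<close>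
  have F_aug: "sets F \<subseteq> sets (augmented_filtration M W T)"
    unfolding F_def
  proof (rule sets_sigma_gen_by_subset)
    fix s assume "s \<in> {0..T}"
    then show "Z s \<in> borel_measurable (augmented_filtration M W T)"
      using borel_measurable_mono[OF augmented_filtration_mono _ Zaug] by auto
  qed simp
  have sub: "subalgebra M F"
    unfolding subalgebra_def using F_aug augmented_filtration_subset[of W M T, OF W_measurable] by (auto simp: F_def)
  have P: "P = restr_to_subalg M F" by (simp add: P_def F_def)
  have PP: "prob_space P" unfolding P by (rule prob_space_restr_to_subalg[OF sub prob_space_axioms])
  have spP: "space P = space M" by (simp add: P space_restr_to_subalg)
  have estF: "est s \<in> borel_measurable F" if "0 < s" for s
    unfolding est_def[abs_def]
  proof (rule estimator_measurable[OF that])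
    fix t assume "0 \<le> t" "t \<le> T"
    then have "Z t \<in> borel_measurable F" unfolding F_def by (intro sigma_gen_by_measurable) auto
    then show "(\<lambda>\<omega>. fst (Z t \<omega>)) \<in> borel_measurable F"
      by (rule measurable_compose) (intro borel_measurable_continuous_onI continuous_intros)
  qed
  \<comment> \<open>The drift along the path. Its almost sure continuity, from the continuity of c,
    of the gradient of V and of Z, is all that the pathwise expansion asks of it.\<close>
  define b where "b \<omega> s = c (fst (Z s \<omega>)) (snd (Z s \<omega>)) *v snd (Z s \<omega>) + gradient V (fst (Z s \<omega>))" for \<omega> s
  have contV: "continuous_on UNIV (gradient V)"
    using assms(3) by (auto simp: hyp_H1_def intro: continuous_on_gradient)
  have contc: "continuous_on UNIV (\<lambda>(x, y). c x y)"
    using assms(4) by (auto simp: hyp_H2_def intro: continuously_differentiable_continuous)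
  have path: "AE \<omega> in M. continuous_on {0..} (b \<omega>) \<and>
      (\<forall>t\<ge>0. fst (Z t \<omega>) = fst z + integral {0..t} (\<lambda>s. snd (Z s \<omega>))) \<and>
      (\<forall>t\<ge>0. snd (Z t \<omega>) = snd z + \<sigma> *v W t \<omega> - integral {0..t} (b \<omega>))"
  proof -
    have "AE \<omega> in M. continuous_on {0..} (\<lambda>t. Z t \<omega>) \<and>
        (\<forall>t\<ge>0. fst (Z t \<omega>) = fst z + integral {0..t} (\<lambda>s. snd (Z s \<omega>)) \<and>
           snd (Z t \<omega>) = snd z + \<sigma> *v W t \<omega> - integral {0..t} (b \<omega>))"
      using sol unfolding strong_solution_def b_def[abs_def] by blast
    then show ?thesis
    proof eventually_elim
      case (elim \<omega>)
      have Z: "continuous_on {0..} (\<lambda>t. Z t \<omega>)" using elim by blast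
      have "continuous_on {0..} (\<lambda>s. (\<lambda>(x, y). c x y) (Z s \<omega>))"
        by (rule continuous_on_compose2[OF contc Z]) simp
      then have cZ: "continuous_on {0..} (\<lambda>s. c (fst (Z s \<omega>)) (snd (Z s \<omega>)))" by (simp add: case_prod_beta)
      have "continuous_on {0..} (\<lambda>s. gradient V (fst (Z s \<omega>)))"
        by (rule continuous_on_compose2[OF contV continuous_on_fst[OF Z]]) simp
      then have "continuous_on {0..} (b \<omega>)"
        unfolding b_def[abs_def]
        by (intro continuous_on_add continuous_on_matrix_vector_mult[OF cZ] continuous_on_snd[OF Z])
      then show ?case using elim by blast
    qed
  qed
  \<comment> \<open>The limit matrix lives on the second factor, so its independence of the base is
    built in.\<close>
  let ?M' = "P \<Otimes>\<^sub>M (limit_law :: ((real, 'd) vec, 'd) vec measure)"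
  have conv: "(\<lambda>n. \<integral>\<omega>. g (est (h n) \<omega>) * \<zeta> \<omega> \<partial>P) \<longlonglongrightarrow> (\<integral>\<omega>. g (limit_matrix \<omega>) * \<zeta> (fst \<omega>) \<partial>?M')"
    if g: "continuous_on UNIV g" "bounded (range g)" and \<zeta>: "\<zeta> \<in> borel_measurable P" "bounded (\<zeta> ` space P)"
    for g :: "((real, 'd) vec, 'd) vec \<Rightarrow> real" and \<zeta>
  proof -
    obtain C where C: "\<And>x. \<bar>g x\<bar> \<le> C" using g(2) by (auto simp: bounded_iff)
    obtain B where B: "\<And>\<omega>. \<omega> \<in> space M \<Longrightarrow> \<bar>\<zeta> \<omega>\<bar> \<le> B" using \<zeta>(2) by (auto simp: bounded_iff spP)
    have \<zeta>F: "\<zeta> \<in> borel_measurable F" using \<zeta>(1) unfolding P by (rule measurable_in_subalg'[OF sub])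
    have \<zeta>M: "\<zeta> \<in> borel_measurable M" by (rule measurable_from_subalg[OF sub \<zeta>F])
    have \<zeta>A: "\<zeta> \<in> borel_measurable (augmented_filtration M W T)"
      by (rule borel_measurable_mono[OF F_aug _ \<zeta>F]) (simp add: F_def)
    have [measurable]: "g \<in> borel_measurable borel" by (rule borel_measurable_continuous_onI[OF g(1)])
    \<comment> \<open>The integrands are measurable for the sigma-algebra of Z, so integration over
      its restriction P agrees with integration over M, where the limit theorem is proved.\<close>
    have eqP: "(\<integral>\<omega>. g (est s \<omega>) * \<zeta> \<omega> \<partial>P) = (\<integral>\<omega>. g (est s \<omega>) * \<zeta> \<omega> \<partial>M)" if "0 < s" for s
    proof -
      note [measurable] = estF[OF that] \<zeta>F
      show ?thesis unfolding P by (rule integral_subalgebra2[OF sub]) measurable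
    qed
    have \<zeta>P: "(\<integral>\<omega>. \<zeta> \<omega> \<partial>P) = (\<integral>\<omega>. \<zeta> \<omega> \<partial>M)" unfolding P by (rule integral_subalgebra2[OF sub \<zeta>F])
    have "(\<lambda>n. \<integral>\<omega>. g (est (h n) \<omega>) * \<zeta> \<omega> \<partial>M) \<longlonglongrightarrow> (\<integral>x. g x \<partial>limit_law) * (\<integral>\<omega>. \<zeta> \<omega> \<partial>M)"
    \<comment> \<open>The integral depends on n only through the step, and the limit is the same
      number for every step sequence, so the reduction to summable steps applies to each pair of
      test functions separately.\<close>
    proof (rule tendsto_via_summable[of h "\<lambda>s. \<integral>\<omega>. g (est s \<omega>) * \<zeta> \<omega> \<partial>M", OF assms(7,8)])
      fix k :: "nat \<Rightarrow> real" assume k: "\<And>n. 0 < k n" "k \<longlonglongrightarrow> 0" "summable k"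
      interpret brownian_sampling M W T k by unfold_locales (use assms(1) k in auto)
      show "(\<lambda>n. \<integral>\<omega>. g (est (k n) \<omega>) * \<zeta> \<omega> \<partial>M) \<longlonglongrightarrow> (\<integral>x. g x \<partial>limit_law) * (\<integral>\<omega>. \<zeta> \<omega> \<partial>M)"
      proof (rule stable_limit[OF _ _ prob_space_limit_law sets_limit_law limit_law_char g(1) C \<zeta>A \<zeta>M B])
        show "est (k n) \<in> borel_measurable M" for n by (rule measurable_from_subalg[OF sub estF[OF k(1)]])
        show "AE \<omega> in M. (\<lambda>n. est (k n) \<omega> - fluctuation T (k n) \<omega>) \<longlonglongrightarrow> 0"
          unfolding est_def by (rule AE_estimator[OF k(3) assms(2) path])
      qed
    qed
    moreover have "(\<integral>\<omega>. g (limit_matrix \<omega>) * \<zeta> (fst \<omega>) \<partial>?M') = (\<integral>x. g x \<partial>limit_law) * (\<integral>\<omega>. \<zeta> \<omega> \<partial>P)"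
      by (rule integral_extension[OF PP g(1) C \<zeta>(1)]) (unfold spP, rule B)
    ultimately show ?thesis by (simp only: eqP[OF assms(7)] \<zeta>P)
  qed
  have "stably_converges P (\<lambda>n. est (h n)) ?M' fst limit_matrix"
    unfolding stably_converges_def
    using prob_extension_extension[OF PP] limit_matrix_measurable[OF PP] conv
      measurable_in_subalg[OF sub estF[OF assms(7)], folded P] by blast
  then show ?thesis
    using sym_gaussian_limit_matrix[OF PP] independent_of_base_limit_matrix[OF PP]
    unfolding est_def[abs_def] by blast
qed

end
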